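(* Let $\Omega\subseteq\mathbb{R}^n$ be open and let $P$ be a partial differential operator of order $m$ with coefficients in $\mathcal{G}(\Omega)$ which is WH-elliptic with slow scales. Then for all $u\in\mathcal{G}(\Omega)$ $$\mathrm{WF}_g(u)=\mathrm{WF}_g(Pu).$$
   Context: Colombeau algebra: $\mathcal{E}_M(\Omega)$ is the set of families $(u_\varepsilon)_{\varepsilon\in(0,1]}$ of functions $u_\varepsilon\in C^\infty(\Omega)$ such that for all compact $K\subset\Omega$ and all $\alpha\in\mathbb{N}_0^n$ there is $p\ge0$ with $\sup_{x\in K}|\partial^\alpha u_\varepsilon(x)|=O(\varepsilon^{-p})$ as $\varepsilon\to0$. $\mathcal{N}(\Omega)$ is the set of families such that for all compact $K\subset\Omega$, all $\alpha$ and all $q\ge0$, $\sup_{x\in K}|\partial^\alpha u_\varepsilon(x)|=O(\varepsilon^q)$. $\mathcal{G}(\Omega)=\mathcal{E}_M(\Omega)/\mathcal{N}(\Omega)$; classes are written $[(u_\varepsilon)_\varepsilon]$. Operators: with $D=(-i\partial_1,\dots,-i\partial_n)$, an operator of order $m$ with coefficients $a_\alpha=[(a_\alpha^\varepsilon)_\varepsilon]\in\mathcal{G}(\Omega)$ is $P=\sum_{|\alpha|\le m}a_\alpha D^\alpha$, represented by $P_\varepsilon(x,D)=\sum_{|\alpha|\le m}a_\alpha^\varepsilon(x)D^\alpha$ with symbol $P_\varepsilon(x,\xi)=\sum_{|\alpha|\le m}a^\varepsilon_\alpha(x)\xi^\alpha$; it acts by $Pu=[(P_\varepsilon(x,D)u_\varepsilon)_\varepsilon]$.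 Slow scale: a net $(r_\varepsilon)_{\varepsilon\in(0,1]}$ of complex numbers with $|r_\varepsilon|=O(\varepsilon^{-p})$ for some $p$ is a slow scale net if for all $t\ge0$ there is $\varepsilon_t>0$ with $|r_\varepsilon|^t\le\varepsilon^{-1}$ for all $\varepsilon\in(0,\varepsilon_t)$. WH-ellipticity with slow scales: $P$ (with representative $(P_\varepsilon)_\varepsilon$) is WH-elliptic with slow scales if for every compact $K\subset\Omega$: (1) there exist $q>0$, a slow scale net $r_\varepsilon>0$ and $\varepsilon_0>0$ such that $|P_\varepsilon(x,\xi)|\ge\varepsilon^q(1+|\xi|)^m$ for all $(x,\xi)\in K\times\mathbb{R}^n$, $|\xi|\ge r_\varepsilon$, $0<\varepsilon<\varepsilon_0$; (2) for every $\alpha\in\mathbb{N}_0^n$ there exist slow scale nets $s_\varepsilon^\alpha,r_\varepsilon^\alpha>0$ and $\varepsilon_\alpha>0$ such that for all $\beta\in\mathbb{N}_0^n$ with $0\le|\beta|\le m$, $|\partial_x^\alpha\partial_\xi^\beta P_\varepsilon(x,\xi)|\le s_\varepsilon^\alpha|P_\varepsilon(x,\xi)|(1+|\xi|)^{-|\beta|}$ for all $(x,\xi)\in K\times\mathbb{R}^n$, $|\xi|\ge r_\varepsilon^\alpha$, $0<\varepsilon<\varepsilon_\alpha$. Generalized wave front set: $u=[(u_\varepsilon)_\varepsilon]\in\mathcal{G}(\Omega)$ is microlocally regular at $(x_0,\xi_0)\in\Omega\times(\mathbb{R}^n\setminus\{0\})$ if there are an open neighborhood $U$ of $x_0$ and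 a conic neighborhood $\Gamma$ of $\xi_0$ such that for all $\varphi\in\mathcal{D}(U)=C_c^\infty(U)$: there is $N\in\mathbb{R}$ such that for all $l\in\mathbb{N}_0$ there are $C>0$, $\varepsilon_0>0$ with $|\widehat{\varphi u_\varepsilon}(\xi)|\le C\varepsilon^{-N}(1+|\xi|)^{-l}$ for all $\xi\in\Gamma$, $\varepsilon\in(0,\varepsilon_0)$, where $\widehat{v}(\xi)=\int v(x)e^{-i\xi x}dx$. $\mathrm{WF}_g(u)$ is the complement in $\Omega\times(\mathbb{R}^n\setminus\{0\})$ of the set of points where $u$ is microlocally regular. *)

theory Defs
  imports "HOL-Analysis.Analysis" "HOL-Library.Landau_Symbols"
begin

section \<open>Multi-indices, partial derivatives, smooth functions\<close>

text \<open>A multi-index in \<open>\<nat>\<^sub>0\<^sup>n\<close> is a function \<open>\<alpha> :: 'n \<Rightarrow> nat\<close> on the finite index type of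
  \<^typ>\<open>real ^ 'n\<close>. Functions on an open set \<open>\<Omega>\<close> are total functions whose values outside
  \<open>\<Omega>\<close> are irrelevant.\<close>

definition mi_order :: "('n::finite \<Rightarrow> nat) \<Rightarrow> nat" where
  "mi_order \<alpha> = (\<Sum>i\<in>UNIV. \<alpha> i)"

definition mi_power :: "real ^ 'n \<Rightarrow> ('n \<Rightarrow> nat) \<Rightarrow> real" where
  "mi_power \<xi> \<alpha> = (\<Prod>i\<in>UNIV. (\<xi> $ i) ^ \<alpha> i)"

definition partial_deriv :: "'n \<Rightarrow> (real ^ 'n \<Rightarrow> complex) \<Rightarrow> real ^ 'n \<Rightarrow> complex" where
  "partial_deriv i f x = vector_derivative (\<lambda>t. f (x + t *\<^sub>R axis i 1)) (at 0)"

primrec iter_deriv :: "'n list \<Rightarrow> (real ^ 'n \<Rightarrow> complex) \<Rightarrow> real ^ 'n \<Rightarrow> complex" where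
  "iter_deriv [] f = f"
| "iter_deriv (i # js) f = partial_deriv i (iter_deriv js f)"

text \<open>\<open>C\<^sup>\<infinity>(\<Omega>)\<close> for open \<open>\<Omega>\<close>: total differentiability of every iterated partial derivative
  provides both the existence and the continuity of all of them.\<close>

definition smooth_on :: "(real ^ 'n) set \<Rightarrow> (real ^ 'n \<Rightarrow> complex) \<Rightarrow> bool" where
  "smooth_on \<Omega> f \<longleftrightarrow> (\<forall>js. iter_deriv js f differentiable_on \<Omega>)"

text \<open>\<open>\<partial>\<^sup>\<alpha>\<close>: differentiate \<open>\<alpha> i\<close> times in each direction \<open>i\<close>. The order in which this is done is
  left unspecified; by Schwarz's theorem it does not matter for smooth functions.\<close>

definition mi_deriv :: "('n \<Rightarrow> nat) \<Rightarrow> (real ^ 'n \<Rightarrow> complex) \<Rightarrow> real ^ 'n \<Rightarrow> complex" where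
  "mi_deriv \<alpha> = iter_deriv (SOME js. \<forall>i. count_list js i = \<alpha> i)"

section \<open>The Colombeau algebra\<close>

text \<open>Nets are indexed by \<open>\<epsilon> \<in> (0,1]\<close>; their values at other \<open>\<epsilon>\<close> are irrelevant.
  \<open>\<forall>\<^sub>F \<epsilon> in at_right 0\<close> means: for all \<open>\<epsilon> \<in> (0,\<epsilon>\<^sub>0)\<close>, for some \<open>\<epsilon>\<^sub>0 > 0\<close>.
  A bound on \<open>sup\<^sub>K\<close> is written as a bound at all points of \<open>K\<close>.\<close>

type_synonym 'n net = "real \<Rightarrow> real ^ 'n \<Rightarrow> complex"

definition moderate_nets :: "(real ^ 'n) set \<Rightarrow> 'n net set" where
  "moderate_nets \<Omega> = {u. (\<forall>\<epsilon>\<in>{0<..1}. smooth_on \<Omega> (u \<epsilon>)) \<and>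
     (\<forall>K \<alpha>. compact K \<and> K \<subseteq> \<Omega> \<longrightarrow>
        (\<exists>p\<ge>0. \<exists>C. \<forall>\<^sub>F \<epsilon> in at_right 0. \<forall>x\<in>K. norm (mi_deriv \<alpha> (u \<epsilon>) x) \<le> C * \<epsilon> powr (- p)))}"

definition null_nets :: "(real ^ 'n) set \<Rightarrow> 'n net set" where
  "null_nets \<Omega> = {u. (\<forall>\<epsilon>\<in>{0<..1}. smooth_on \<Omega> (u \<epsilon>)) \<and>
     (\<forall>K \<alpha>. compact K \<and> K \<subseteq> \<Omega> \<longrightarrow>
        (\<forall>q\<ge>0. \<exists>C. \<forall>\<^sub>F \<epsilon> in at_right 0. \<forall>x\<in>K. norm (mi_deriv \<alpha> (u \<epsilon>) x) \<le> C * \<epsilon> powr q))}"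

definition colombeau_rel :: "(real ^ 'n) set \<Rightarrow> ('n net \<times> 'n net) set" where
  "colombeau_rel \<Omega> = {(u, v). u \<in> moderate_nets \<Omega> \<and> v \<in> moderate_nets \<Omega> \<and>
     (\<lambda>\<epsilon> x. u \<epsilon> x - v \<epsilon> x) \<in> null_nets \<Omega>}"

text \<open>A generalized function is the set of all its representatives.\<close>

definition colombeau :: "(real ^ 'n) set \<Rightarrow> 'n net set set" where
  "colombeau \<Omega> = moderate_nets \<Omega> // colombeau_rel \<Omega>"

section \<open>Differential operators with generalized coefficients\<close>

text \<open>An operator is given by \<open>m\<close> and the family \<open>a\<close> of its coefficients, of which only
  the \<open>a \<alpha>\<close> with \<open>\<bar>\<alpha>\<bar> \<le> m\<close> are used. Here \<open>D\<^sup>\<alpha> = (-i)\<^bsup>\<bar>\<alpha>\<bar>\<^esup> \<partial>\<^sup>\<alpha>\<close>.\<close>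

definition diff_op ::
    "nat \<Rightarrow> (('n \<Rightarrow> nat) \<Rightarrow> real ^ 'n \<Rightarrow> complex) \<Rightarrow> (real ^ 'n \<Rightarrow> complex) \<Rightarrow> real ^ 'n \<Rightarrow> complex" where
  "diff_op m c f x = (\<Sum>\<alpha> | mi_order \<alpha> \<le> m. c \<alpha> x * ((- \<i>) ^ mi_order \<alpha> * mi_deriv \<alpha> f x))"

definition diff_symbol ::
    "nat \<Rightarrow> (('n \<Rightarrow> nat) \<Rightarrow> real ^ 'n \<Rightarrow> complex) \<Rightarrow> real ^ 'n \<Rightarrow> real ^ 'n \<Rightarrow> complex" where
  "diff_symbol m c x \<xi> = (\<Sum>\<alpha> | mi_order \<alpha> \<le> m. c \<alpha> x * complex_of_real (mi_power \<xi> \<alpha>))"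

definition coeff_reps ::
    "nat \<Rightarrow> (('n::finite \<Rightarrow> nat) \<Rightarrow> 'n net set) \<Rightarrow> (('n \<Rightarrow> nat) \<Rightarrow> 'n net) set" where
  "coeff_reps m a = {A. \<forall>\<alpha>. mi_order \<alpha> \<le> m \<longrightarrow> A \<alpha> \<in> a \<alpha>}"

text \<open>\<open>P u = [(P\<^sub>\<epsilon>(x,D) u\<^sub>\<epsilon>)\<^sub>\<epsilon>]\<close>: the class is independent of the representatives of \<open>a\<close> and \<open>u\<close>,
  so the union below is over copies of one and the same class.\<close>

definition gen_diff_op ::
    "(real ^ 'n) set \<Rightarrow> nat \<Rightarrow> (('n \<Rightarrow> nat) \<Rightarrow> 'n net set) \<Rightarrow> 'n net set \<Rightarrow> 'n net set" where
  "gen_diff_op \<Omega> m a u =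
     (\<Union>A\<in>coeff_reps m a. \<Union>v\<in>u. colombeau_rel \<Omega> `` {\<lambda>\<epsilon>. diff_op m (\<lambda>\<alpha>. A \<alpha> \<epsilon>) (v \<epsilon>)})"

section \<open>WH-ellipticity with slow scales\<close>

definition slow_scale :: "(real \<Rightarrow> 'a::real_normed_field) \<Rightarrow> bool" where
  "slow_scale r \<longleftrightarrow>
     (\<exists>p. (\<lambda>\<epsilon>. norm (r \<epsilon>)) \<in> O[at_right 0](\<lambda>\<epsilon>. \<epsilon> powr (- p))) \<and>
     (\<forall>t\<ge>0. \<forall>\<^sub>F \<epsilon> in at_right 0. norm (r \<epsilon>) powr t \<le> inverse \<epsilon>)"

definition pos_slow_scale :: "(real \<Rightarrow> real) \<Rightarrow> bool" where
  "pos_slow_scale r \<longleftrightarrow> slow_scale r \<and> (\<forall>\<epsilon>\<in>{0<..1}. r \<epsilon> > 0)"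

definition wh_elliptic_rep ::
    "(real ^ 'n) set \<Rightarrow> nat \<Rightarrow> (('n \<Rightarrow> nat) \<Rightarrow> 'n net) \<Rightarrow> bool" where
  "wh_elliptic_rep \<Omega> m A \<longleftrightarrow> (let P = (\<lambda>\<epsilon>. diff_symbol m (\<lambda>\<alpha>. A \<alpha> \<epsilon>)) in
     \<forall>K. compact K \<and> K \<subseteq> \<Omega> \<longrightarrow>
       (\<exists>q>0. \<exists>r. pos_slow_scale r \<and>
          (\<forall>\<^sub>F \<epsilon> in at_right 0. \<forall>x\<in>K. \<forall>\<xi>. norm \<xi> \<ge> r \<epsilon> \<longrightarrow>
             norm (P \<epsilon> x \<xi>) \<ge> \<epsilon> powr q * (1 + norm \<xi>) ^ m)) \<and>
       (\<forall>\<alpha>. \<exists>s r. pos_slow_scale s \<and> pos_slow_scale r \<and>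
          (\<forall>\<^sub>F \<epsilon> in at_right 0. \<forall>\<beta>. mi_order \<beta> \<le> m \<longrightarrow>
             (\<forall>x\<in>K. \<forall>\<xi>. norm \<xi> \<ge> r \<epsilon> \<longrightarrow>
                norm (mi_deriv \<alpha> (\<lambda>y. mi_deriv \<beta> (\<lambda>\<eta>. P \<epsilon> y \<eta>) \<xi>) x)
                  \<le> s \<epsilon> * norm (P \<epsilon> x \<xi>) / (1 + norm \<xi>) ^ mi_order \<beta>))))"

text \<open>The condition does not depend on the representative of the coefficients.\<close>

definition wh_elliptic_slow ::
    "(real ^ 'n) set \<Rightarrow> nat \<Rightarrow> (('n \<Rightarrow> nat) \<Rightarrow> 'n net set) \<Rightarrow> bool" where
  "wh_elliptic_slow \<Omega> m a \<longleftrightarrow> (\<exists>A\<in>coeff_reps m a. wh_elliptic_rep \<Omega> m A)"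

section \<open>The generalized wave front set\<close>

definition test_functions :: "(real ^ 'n) set \<Rightarrow> (real ^ 'n \<Rightarrow> complex) set" where
  "test_functions U = {\<phi>. smooth_on UNIV \<phi> \<and>
     compact (closure {x. \<phi> x \<noteq> 0}) \<and> closure {x. \<phi> x \<noteq> 0} \<subseteq> U}"

definition fourier :: "(real ^ 'n \<Rightarrow> complex) \<Rightarrow> real ^ 'n \<Rightarrow> complex" where
  "fourier v \<xi> = (LINT x|lborel. v x * exp (- (\<i> * complex_of_real (\<xi> \<bullet> x))))"

text \<open>The library's \<open>conic\<close> sets are closed under multiplication by \<open>0\<close> and hence contain the origin,
  so they cannot serve here.\<close>

definition conic_neighborhood :: "real ^ 'n \<Rightarrow> (real ^ 'n) set \<Rightarrow> bool" where
  "conic_neighborhood \<xi>\<^sub>0 \<Gamma> \<longleftrightarrow>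
     \<xi>\<^sub>0 \<in> interior \<Gamma> \<and> 0 \<notin> \<Gamma> \<and> (\<forall>\<xi>\<in>\<Gamma>. \<forall>t>0. t *\<^sub>R \<xi> \<in> \<Gamma>)"

definition microlocally_regular_rep ::
    "(real ^ 'n) set \<Rightarrow> 'n net \<Rightarrow> real ^ 'n \<Rightarrow> real ^ 'n \<Rightarrow> bool" where
  "microlocally_regular_rep \<Omega> v x\<^sub>0 \<xi>\<^sub>0 \<longleftrightarrow>
     (\<exists>U \<Gamma>. open U \<and> x\<^sub>0 \<in> U \<and> U \<subseteq> \<Omega> \<and> conic_neighborhood \<xi>\<^sub>0 \<Gamma> \<and>
       (\<forall>\<phi>\<in>test_functions U. \<exists>N. \<forall>l::nat. \<exists>C>0. \<forall>\<^sub>F \<epsilon> in at_right 0. \<forall>\<xi>\<in>\<Gamma>.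
          norm (fourier (\<lambda>x. \<phi> x * v \<epsilon> x) \<xi>) \<le> C * \<epsilon> powr (- N) / (1 + norm \<xi>) ^ l))"

text \<open>Microlocal regularity, too, does not depend on the representative.\<close>

definition microlocally_regular ::
    "(real ^ 'n) set \<Rightarrow> 'n net set \<Rightarrow> real ^ 'n \<Rightarrow> real ^ 'n \<Rightarrow> bool" where
  "microlocally_regular \<Omega> u x\<^sub>0 \<xi>\<^sub>0 \<longleftrightarrow> (\<exists>v\<in>u. microlocally_regular_rep \<Omega> v x\<^sub>0 \<xi>\<^sub>0)"

definition WF_g :: "(real ^ 'n) set \<Rightarrow> 'n net set \<Rightarrow> ((real ^ 'n) \<times> (real ^ 'n)) set" where
  "WF_g \<Omega> u = {(x, \<xi>). x \<in> \<Omega> \<and> \<xi> \<noteq> 0 \<and> \<not> microlocally_regular \<Omega> u x \<xi>}"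

end

theory Submission
  imports Defs "HOL-Probability.Probability"
begin

text \<open>
  Write \<open>P\<^sub>\<epsilon>(x,\<xi>)\<close> for the symbol and \<open>F\<close> for the Fourier transform. Both inclusions rest on one
  integration by parts: for a cut-off \<open>w\<close> with compact support,
  \<open>F(w Pv)(\<xi>) = F(v T\<^sub>\<xi>w)(\<xi>)\<close> with \<open>T\<^sub>\<xi>w = \<Sum>\<^sub>\<beta> i\<^bsup>\<bar>\<beta>\<bar>\<^esup>/\<beta>! \<partial>\<^sup>\<beta>(\<partial>\<^sub>\<xi>\<^sup>\<beta>P\<^sub>\<epsilon>(\<cdot>,\<xi>) w)\<close>
  (\<open>transposed\<close> and \<open>fourier_diff_op\<close> below).

  If \<open>v\<close> is regular, apply this with \<open>w = \<phi>\<close>. Ellipticity bounds every \<open>x\<close>-derivative of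
  \<open>\<partial>\<^sub>\<xi>\<^sup>\<beta>P\<^sub>\<epsilon>\<close> by \<open>P\<^sub>\<epsilon>\<close> itself, up to slow scale factors, hence by \<open>\<epsilon>\<^bsup>-N\<^esup>(1 + \<bar>\<xi>\<bar>)\<^sup>m\<close> with \<open>N\<close> independent
  of the number of derivatives. So \<open>T\<^sub>\<xi>\<phi>\<close> is a family of cut-offs with uniform loss, and multiplication
  by such a family keeps the decay of \<open>v\<close> in a slightly smaller cone (\<open>fourier_mult_regular\<close>).
  General moderate coefficients do not preserve regularity; this is where ellipticity enters the
  inclusion that one would expect to be trivial.

  Conversely, let \<open>Pv\<close> be regular. One needs \<open>w\<close> with \<open>T\<^sub>\<xi>w = \<phi>\<close> up to a small remainder. With
  \<open>Rh = - \<Sum>\<^bsub>\<beta>\<noteq>0\<^esub> i\<^bsup>\<bar>\<beta>\<bar>\<^esup>/\<beta>! \<partial>\<^sup>\<beta>((\<partial>\<^sub>\<xi>\<^sup>\<beta>P\<^sub>\<epsilon>/P\<^sub>\<epsilon>) h)\<close> one has \<open>T\<^sub>\<xi>(h/P\<^sub>\<epsilon>) = h - Rh\<close>, so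
  \<open>w = \<Sum>\<^bsub>k<M\<^esub> R\<^sup>k\<phi>/P\<^sub>\<epsilon>\<close> gives \<open>T\<^sub>\<xi>w = \<phi> - R\<^sup>M\<phi>\<close> and \<open>F(\<phi>v) = F(w Pv) + F(R\<^sup>M\<phi> v)\<close>.
  The quotients \<open>\<partial>\<^sub>\<xi>\<^sup>\<beta>P\<^sub>\<epsilon>/P\<^sub>\<epsilon>\<close> and their derivatives are of size \<open>(1 + \<bar>\<xi>\<bar>)\<^bsup>-\<bar>\<beta>\<bar>\<^esup>\<close> up to slow scale
  factors. Hence \<open>R\<^sup>M\<phi>\<close> is of size \<open>(1 + \<bar>\<xi>\<bar>)\<^bsup>-M\<^esup>\<close>, while \<open>1/P\<^sub>\<epsilon>\<close> costs a fixed power of \<open>\<epsilon>\<close>. A slow scale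
  factor costs at most \<open>1/\<epsilon>\<close>, however large \<open>M\<close> is, so the exponent of \<open>\<epsilon>\<close> does not grow with \<open>M\<close>.

  All this happens at frequencies above some slow scale net. As a slow scale net is eventually below
  each \<open>\<epsilon>\<^bsup>-\<delta>\<^esup>\<close>, the thresholds are absorbed by the filter \<open>high_freq\<close>. At the remaining
  frequencies, \<open>\<bar>\<xi>\<bar> < \<epsilon>\<^bsup>-\<delta>\<^esup>\<close> with \<open>\<delta> = 1/(l+1)\<close>, a factor \<open>(1 + \<bar>\<xi>\<bar>)\<^sup>l\<close> costs only a constant times
  \<open>1/\<epsilon>\<close> (\<open>low_high_freq\<close>).

  The analysis behind \<open>fourier_mult_regular\<close> is the convolution formula for the Fourier transform of a
  product, obtained from the inversion formula for test functions, and the existence of enough test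
  functions. Finally, regularity does not depend on the representative, because cut-off null nets decay
  in all directions (\<open>regular_in_null\<close>).
\<close>

section \<open>Partial derivatives and smooth functions\<close>

named_theorems smooth_intros

lemma iter_deriv_append: "iter_deriv (js @ ks) f = iter_deriv js (iter_deriv ks f)"
  by (induction js) auto

lemma has_vector_derivative_line:
  assumes "f differentiable (at (x + s *\<^sub>R axis i 1))"
  shows "((\<lambda>t. f (x + t *\<^sub>R axis i 1)) has_vector_derivative
           partial_deriv i f (x + s *\<^sub>R axis i 1)) (at s)"
proof -
  obtain f' where f': "(f has_derivative f') (at (x + s *\<^sub>R axis i 1))"
    using assms by (auto simp: differentiable_def)
  interpret f': bounded_linear f' by (rule has_derivative_bounded_linear[OF f'])
  have *: "((\<lambda>t. f (x + t *\<^sub>R axis i 1)) has_vector_derivative f' (axis i 1)) (at s)"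
    unfolding has_vector_derivative_def
    by (rule has_derivative_eq_rhs, rule has_derivative_compose[of _ _ _ _ f f'])
       (auto intro!: derivative_eq_intros f' simp: f'.scaleR)
  have "((\<lambda>t. f ((x + s *\<^sub>R axis i 1) + t *\<^sub>R axis i 1)) has_vector_derivative f' (axis i 1)) (at 0)"
    unfolding has_vector_derivative_def
    by (rule has_derivative_eq_rhs, rule has_derivative_compose[of _ _ _ _ f f'])
       (auto intro!: derivative_eq_intros f' simp: f'.scaleR)
  hence "partial_deriv i f (x + s *\<^sub>R axis i 1) = f' (axis i 1)"
    unfolding partial_deriv_def by (rule vector_derivative_at)
  with * show ?thesis by simp
qed

lemma partial_deriv_eqI:
  assumes "(f has_derivative f') (at x)"
  shows "partial_deriv i f x = f' (axis i 1)"
proof -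
  interpret f': bounded_linear f' by (rule has_derivative_bounded_linear[OF assms])
  have "((\<lambda>t. f (x + t *\<^sub>R axis i 1)) has_vector_derivative f' (axis i 1)) (at 0)"
    unfolding has_vector_derivative_def
    by (rule has_derivative_eq_rhs, rule has_derivative_compose[of _ _ _ _ f f'])
       (auto intro!: derivative_eq_intros assms simp: f'.scaleR)
  thus ?thesis unfolding partial_deriv_def by (rule vector_derivative_at)
qed

lemma partial_deriv_cong:
  assumes "open S" "x \<in> S" "\<And>y. y \<in> S \<Longrightarrow> f y = g y"
  shows "partial_deriv i f x = partial_deriv i g x"
proof -
  have "((\<lambda>t. x + t *\<^sub>R axis i 1) \<longlongrightarrow> x + 0 *\<^sub>R axis i 1) (nhds (0::real))"
    by (intro tendsto_intros filterlim_ident)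
  hence "eventually (\<lambda>t. x + t *\<^sub>R axis i 1 \<in> S) (nhds (0::real))"
    using assms(1,2) by (auto elim: topological_tendstoD)
  hence "eventually (\<lambda>t::real. t \<in> UNIV \<longrightarrow> f (x + t *\<^sub>R axis i 1) = g (x + t *\<^sub>R axis i 1)) (nhds 0)"
    by eventually_elim (auto simp: assms(3))
  thus ?thesis unfolding partial_deriv_def
    by (intro vector_derivative_cong_eq) auto
qed

lemma iter_deriv_cong:
  assumes "open S" "x \<in> S" "\<And>y. y \<in> S \<Longrightarrow> f y = g y"
  shows "iter_deriv js f x = iter_deriv js g x"
  using assms(2)
proof (induction js arbitrary: x)
  case (Cons j js)
  thus ?case by (auto intro: partial_deriv_cong[OF assms(1)])
qed (use assms in auto)

lemma differentiable_on_openD: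
  "\<lbrakk>open S; f differentiable_on S; x \<in> S\<rbrakk> \<Longrightarrow> f differentiable (at x)"
  by (metis at_within_open differentiable_on_def)

lemma smooth_on_iter: "smooth_on S f \<Longrightarrow> smooth_on S (iter_deriv js f)"
  by (simp add: smooth_on_def iter_deriv_append[symmetric])

lemma smooth_on_partial: "smooth_on S f \<Longrightarrow> smooth_on S (partial_deriv j f)"
  using smooth_on_iter[of S f "[j]"] by simp

lemma smooth_on_mi_deriv: "smooth_on S f \<Longrightarrow> smooth_on S (mi_deriv \<alpha> f)"
  unfolding mi_deriv_def by (rule smooth_on_iter)

lemma smooth_on_differentiable:
  assumes "open S" "smooth_on S f" "x \<in> S" shows "f differentiable (at x)"
  using assms smooth_on_def[of S f] differentiable_on_openD[OF assms(1), of "iter_deriv [] f"]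
  by (metis iter_deriv.simps(1))

lemma smooth_on_subset: "smooth_on S f \<Longrightarrow> T \<subseteq> S \<Longrightarrow> smooth_on T f"
  unfolding smooth_on_def by (meson differentiable_on_subset)

lemma smooth_on_continuous: "smooth_on S f \<Longrightarrow> continuous_on S f"
  unfolding smooth_on_def by (metis iter_deriv.simps(1) differentiable_imp_continuous_on)

lemma differentiable_on_cong':
  assumes "f differentiable_on S" "\<And>x. x \<in> S \<Longrightarrow> f x = g x"
  shows "g differentiable_on S"
  using assms unfolding differentiable_on_def differentiable_def
  by (metis has_derivative_transform)

text \<open>Coinduction for \<open>C\<^sup>\<infinity>\<close>: higher derivatives are reached one at a time, so it is enough to control a
  single partial derivative of each member of a class.\<close>

lemma smooth_on_coinduct:
  assumes "open S" "C f"
    and "\<And>f. C f \<Longrightarrow> f differentiable_on S"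
    and "\<And>f j. C f \<Longrightarrow> \<exists>g. C g \<and> (\<forall>x\<in>S. partial_deriv j f x = g x)"
  shows "smooth_on S f"
proof -
  have "\<exists>g. C g \<and> (\<forall>x\<in>S. iter_deriv js f x = g x)" for js
  proof (induction js)
    case (Cons j js)
    then obtain g where g: "C g" "\<And>x. x \<in> S \<Longrightarrow> iter_deriv js f x = g x" by auto
    obtain h where h: "C h" "\<And>x. x \<in> S \<Longrightarrow> partial_deriv j g x = h x"
      using assms(4)[OF g(1), of j] by blast
    have "partial_deriv j (iter_deriv js f) x = h x" if "x \<in> S" for x
      using partial_deriv_cong[OF assms(1) that g(2)] h(2)[OF that] by simp
    thus ?case using h(1) by auto
  qed (use assms in auto)
  thus ?thesis unfolding smooth_on_def
    by (metis assms(3) differentiable_on_cong')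
qed

lemma smooth_on_cong:
  assumes "open S" "smooth_on S f" "\<And>x. x \<in> S \<Longrightarrow> f x = g x"
  shows "smooth_on S g"
  unfolding smooth_on_def
proof
  fix js
  have "iter_deriv js f differentiable_on S" using assms(2) by (simp add: smooth_on_def)
  thus "iter_deriv js g differentiable_on S"
    by (rule differentiable_on_cong') (rule iter_deriv_cong[OF assms(1) _ assms(3)])
qed

lemma smooth_on_Un:
  assumes "open S" "open T" "smooth_on S f" "smooth_on T f"
  shows "smooth_on (S \<union> T) f"
  using assms unfolding smooth_on_def differentiable_on_def
  by (metis Un_iff at_within_open open_Un)

lemma partial_deriv_const [simp]: "partial_deriv j (\<lambda>_. c) = (\<lambda>_. 0)"
  by (auto simp: partial_deriv_def)

lemma iter_deriv_zero [simp]: "iter_deriv js (\<lambda>_. 0) = (\<lambda>_. 0)"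
  by (induction js) auto

lemma smooth_on_const [smooth_intros]: "open S \<Longrightarrow> smooth_on S (\<lambda>_. c)"
  by (rule smooth_on_coinduct[where C = "\<lambda>f. \<exists>c. f = (\<lambda>_. c)"]) auto

lemma partial_deriv_add:
  assumes "f differentiable (at x)" "g differentiable (at x)"
  shows "partial_deriv j (\<lambda>x. f x + g x) x = partial_deriv j f x + partial_deriv j g x"
proof -
  obtain f' g' where d: "(f has_derivative f') (at x)" "(g has_derivative g') (at x)"
    using assms by (auto simp: differentiable_def)
  show ?thesis
    by (simp add: partial_deriv_eqI[OF has_derivative_add[OF d]] partial_deriv_eqI[OF d(1)]
      partial_deriv_eqI[OF d(2)])
qed

lemma partial_deriv_mult:
  assumes "f differentiable (at x)" "g differentiable (at x)"
  shows "partial_deriv j (\<lambda>x. f x * g x) x = partial_deriv j f x * g x + f x * partial_deriv j g x"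
proof -
  obtain f' g' where d: "(f has_derivative f') (at x)" "(g has_derivative g') (at x)"
    using assms by (auto simp: differentiable_def)
  show ?thesis
    by (simp add: partial_deriv_eqI[OF has_derivative_mult[OF d]] partial_deriv_eqI[OF d(1)]
      partial_deriv_eqI[OF d(2)])
qed

lemma partial_deriv_inverse:
  assumes "f differentiable (at x)" "f x \<noteq> 0"
  shows "partial_deriv j (\<lambda>x. inverse (f x)) x = (- 1) * (partial_deriv j f x * (inverse (f x) * inverse (f x)))"
proof -
  obtain f' where d: "(f has_derivative f') (at x)"
    using assms by (auto simp: differentiable_def)
  show ?thesis
    by (simp add: partial_deriv_eqI[OF Deriv.has_derivative_inverse[OF assms(2) d]] partial_deriv_eqI[OF d])
qed

text \<open>The functions that arise by pointwise arithmetic from smooth functions form a class that is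
  closed under partial derivatives, so all of them are smooth.\<close>

inductive smooth_expr :: "(real ^ 'n) set \<Rightarrow> (real ^ 'n \<Rightarrow> complex) \<Rightarrow> bool" for S where
  base: "smooth_on S f \<Longrightarrow> smooth_expr S f"
| add: "smooth_expr S f \<Longrightarrow> smooth_expr S g \<Longrightarrow> smooth_expr S (\<lambda>x. f x + g x)"
| mult: "smooth_expr S f \<Longrightarrow> smooth_expr S g \<Longrightarrow> smooth_expr S (\<lambda>x. f x * g x)"
| inverse: "smooth_expr S f \<Longrightarrow> (\<And>x. x \<in> S \<Longrightarrow> f x \<noteq> 0) \<Longrightarrow> smooth_expr S (\<lambda>x. inverse (f x))"

lemma smooth_expr_step:
  assumes S: "open S" and "smooth_expr S f"
  shows "f differentiable_on S \<and> (\<forall>j. \<exists>g. smooth_expr S g \<and> (\<forall>x\<in>S. partial_deriv j f x = g x))"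
  using assms(2)
proof induction
  case (base f)
  have "f differentiable_on S" using base unfolding smooth_on_def by (metis iter_deriv.simps(1))
  thus ?case using smooth_on_partial[OF base] smooth_expr.base by blast
next
  case (add f g)
  have d: "f differentiable (at x)" "g differentiable (at x)" if "x \<in> S" for x
    using add that differentiable_on_openD[OF S] by auto
  have "\<exists>h. smooth_expr S h \<and> (\<forall>x\<in>S. partial_deriv j (\<lambda>x. f x + g x) x = h x)" for j
  proof -
    obtain f1 g1 where "smooth_expr S f1" "smooth_expr S g1"
      "\<forall>x\<in>S. partial_deriv j f x = f1 x" "\<forall>x\<in>S. partial_deriv j g x = g1 x"
      using add by metis
    thus ?thesis using d
      by (intro exI[of _ "\<lambda>x. f1 x + g1 x"]) (auto simp: partial_deriv_add intro: smooth_expr.intros)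
  qed
  thus ?case using add by (auto intro: derivative_intros)
next
  case (mult f g)
  have d: "f differentiable (at x)" "g differentiable (at x)" if "x \<in> S" for x
    using mult that differentiable_on_openD[OF S] by auto
  have "\<exists>h. smooth_expr S h \<and> (\<forall>x\<in>S. partial_deriv j (\<lambda>x. f x * g x) x = h x)" for j
  proof -
    obtain f1 g1 where "smooth_expr S f1" "smooth_expr S g1"
      "\<forall>x\<in>S. partial_deriv j f x = f1 x" "\<forall>x\<in>S. partial_deriv j g x = g1 x"
      using mult by metis
    thus ?thesis using d mult
      by (intro exI[of _ "\<lambda>x. f1 x * g x + f x * g1 x"])
         (auto simp: partial_deriv_mult intro!: smooth_expr.add smooth_expr.mult)
  qed
  thus ?case using mult by (auto intro: derivative_intros)
next
  case (inverse f)
  have d: "f differentiable (at x)" if "x \<in> S" for x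
    using inverse that differentiable_on_openD[OF S] by auto
  have "\<exists>h. smooth_expr S h \<and> (\<forall>x\<in>S. partial_deriv j (\<lambda>x. inverse (f x)) x = h x)" for j
  proof -
    obtain f1 where "smooth_expr S f1" "\<forall>x\<in>S. partial_deriv j f x = f1 x"
      using inverse by metis
    moreover from this have "smooth_expr S (\<lambda>x. (- 1) * (f1 x * (inverse (f x) * inverse (f x))))"
      by (intro smooth_expr.mult smooth_expr.inverse smooth_expr.base[of S "\<lambda>_. -1"] inverse
        smooth_on_const S)
    ultimately show ?thesis using d inverse
      by (intro exI[of _ "\<lambda>x. (- 1) * (f1 x * (inverse (f x) * inverse (f x)))"])
         (auto simp: partial_deriv_inverse)
  qed
  thus ?case using inverse by (auto intro!: derivative_intros)
qed

lemma smooth_expr_smooth: "open S \<Longrightarrow> smooth_expr S f \<Longrightarrow> smooth_on S f"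
  by (rule smooth_on_coinduct[where C = "smooth_expr S"]) (auto dest: smooth_expr_step)

lemma smooth_on_add [smooth_intros]:
  "open S \<Longrightarrow> smooth_on S f \<Longrightarrow> smooth_on S g \<Longrightarrow> smooth_on S (\<lambda>x. f x + g x)"
  by (intro smooth_expr_smooth) (auto intro: smooth_expr.intros)

lemma smooth_on_mult [smooth_intros]:
  "open S \<Longrightarrow> smooth_on S f \<Longrightarrow> smooth_on S g \<Longrightarrow> smooth_on S (\<lambda>x. f x * g x)"
  by (intro smooth_expr_smooth) (auto intro: smooth_expr.intros)

lemma smooth_on_minus [smooth_intros]:
  "open S \<Longrightarrow> smooth_on S f \<Longrightarrow> smooth_on S (\<lambda>x. - f x)"
  using smooth_on_mult[of S "\<lambda>_. -1" f] smooth_on_const[of S "-1"] by simp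

lemma smooth_on_diff [smooth_intros]:
  "open S \<Longrightarrow> smooth_on S f \<Longrightarrow> smooth_on S g \<Longrightarrow> smooth_on S (\<lambda>x. f x - g x)"
  using smooth_on_add[of S f "\<lambda>x. - g x"] smooth_on_minus[of S g] by simp

lemma smooth_on_divide [smooth_intros]:
  "open S \<Longrightarrow> smooth_on S f \<Longrightarrow> smooth_on S g \<Longrightarrow> (\<And>x. x \<in> S \<Longrightarrow> g x \<noteq> 0) \<Longrightarrow>
     smooth_on S (\<lambda>x. f x / g x)"
  unfolding divide_inverse
  by (rule smooth_expr_smooth, assumption, rule smooth_expr.mult)
     (blast intro: smooth_expr.inverse smooth_expr.base)+

lemma smooth_on_sum [smooth_intros]:
  "open S \<Longrightarrow> (\<And>i. i \<in> I \<Longrightarrow> smooth_on S (f i)) \<Longrightarrow> smooth_on S (\<lambda>x. \<Sum>i\<in>I. f i x)"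
proof (induction I rule: infinite_finite_induct)
  case (insert i I)
  have "smooth_on S (\<lambda>x. f i x + (\<Sum>i\<in>I. f i x))"
    by (rule smooth_on_add[OF insert.prems(1) insert.prems(2) insert.IH]) (use insert.prems in simp_all)
  thus ?case using insert.hyps by simp
qed (simp_all add: smooth_on_const)

subsection \<open>Symmetry of partial derivatives\<close>

text \<open>With \<open>c\<close> the claimed limit, the function \<open>s \<mapsto> f(x + s e\<^sub>i + t e\<^sub>j) - f(x + s e\<^sub>i) - s t c\<close> has
  derivative \<open>o(t)\<close> on \<open>[0,t]\<close>, because \<open>\<partial>\<^sub>i f\<close> is differentiable at \<open>x\<close>; the mean value inequality
  then gives the second difference up to \<open>o(t\<^sup>2)\<close>. The quotient itself is symmetric in \<open>i\<close> and \<open>j\<close>.\<close>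

lemma second_difference_quotient:
  assumes S: "open S" "x \<in> S" and f: "f differentiable_on S"
    and g: "partial_deriv i f differentiable (at x)"
  shows "((\<lambda>t. (f (x + t *\<^sub>R axis i 1 + t *\<^sub>R axis j 1) - f (x + t *\<^sub>R axis i 1)
             - f (x + t *\<^sub>R axis j 1) + f x) /\<^sub>R t\<^sup>2)
           \<longlongrightarrow> partial_deriv j (partial_deriv i f) x) (at_right 0)"
proof -
  define ei ej :: "real ^ 'a" where "ei = axis i 1" and "ej = axis j 1"
  define h where "h = partial_deriv i f"
  have n: "norm ei = 1" "norm ej = 1" by (auto simp: ei_def ej_def)
  obtain h' where h': "(h has_derivative h') (at x)"
    using g by (auto simp: differentiable_def h_def)
  interpret h': bounded_linear h' by (rule has_derivative_bounded_linear[OF h'])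
  have pd: "partial_deriv j (partial_deriv i f) x = h' ej"
    using partial_deriv_eqI[OF h'] by (simp add: h_def ej_def)
  define \<Delta> where "\<Delta> = (\<lambda>t::real. f (x + t *\<^sub>R ei + t *\<^sub>R ej) - f (x + t *\<^sub>R ei) - f (x + t *\<^sub>R ej) + f x)"
  have "((\<lambda>t. \<Delta> t /\<^sub>R t\<^sup>2) \<longlongrightarrow> h' ej) (at_right 0)"
  proof (rule tendstoI)
    fix e :: real assume e: "e > 0"
    obtain d1 where d1: "d1 > 0" "ball x d1 \<subseteq> S" using S open_contains_ball by blast
    obtain d2 where d2: "d2 > 0"
      "\<And>y. norm (y - x) < d2 \<Longrightarrow> norm (h y - h x - h' (y - x)) \<le> (e/4) * norm (y - x)"
      using has_derivative_within_alt[THEN iffD1, OF h'] e by (metis UNIV_I divide_pos_pos zero_less_numeral)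
    define d where "d = min d1 d2"
    have d: "d > 0" "d \<le> d1" "d \<le> d2" using d1 d2 by (auto simp: d_def)
    have main: "dist (\<Delta> t /\<^sub>R t\<^sup>2) (h' ej) < e" if t: "0 < t" "t < d / 2" for t
    proof -
      define \<phi> where "\<phi> = (\<lambda>s. f ((x + t *\<^sub>R ej) + s *\<^sub>R ei) - f (x + s *\<^sub>R ei) - (s * t) *\<^sub>R h' ej)"
      define \<phi>' where "\<phi>' = (\<lambda>s. h ((x + t *\<^sub>R ej) + s *\<^sub>R ei) - h (x + s *\<^sub>R ei) - t *\<^sub>R h' ej)"
      have nn: "norm (t *\<^sub>R ej + s *\<^sub>R ei) \<le> 2 * t" "norm (s *\<^sub>R ei) \<le> t"
        if "0 \<le> s" "s \<le> t" for s
        using norm_triangle_ineq[of "t *\<^sub>R ej" "s *\<^sub>R ei"] n that t by auto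
      have inS: "(x + t *\<^sub>R ej) + s *\<^sub>R ei \<in> S" "x + s *\<^sub>R ei \<in> S" if "0 \<le> s" "s \<le> t" for s
      proof -
        have "dist x ((x + t *\<^sub>R ej) + s *\<^sub>R ei) = norm (t *\<^sub>R ej + s *\<^sub>R ei)"
          by (metis add.assoc add_diff_cancel_left' dist_commute dist_norm)
        thus "(x + t *\<^sub>R ej) + s *\<^sub>R ei \<in> S" using nn(1)[OF that] d t d1(2) by (auto simp: subset_iff)
        have "dist x (x + s *\<^sub>R ei) = norm (s *\<^sub>R ei)" by (simp add: dist_norm)
        thus "x + s *\<^sub>R ei \<in> S" using nn(2)[OF that] d t d1(2) by (auto simp: subset_iff)
      qed
      have der: "(\<phi> has_vector_derivative \<phi>' s) (at s)" if s: "0 \<le> s" "s \<le> t" for s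
      proof -
        have 1: "((\<lambda>s. f ((x + t *\<^sub>R ej) + s *\<^sub>R ei)) has_vector_derivative h ((x + t *\<^sub>R ej) + s *\<^sub>R ei)) (at s)"
          unfolding h_def ei_def using inS(1)[OF s]
          by (intro has_vector_derivative_line differentiable_on_openD[OF S(1) f]) (auto simp: ei_def)
        have 2: "((\<lambda>s. f (x + s *\<^sub>R ei)) has_vector_derivative h (x + s *\<^sub>R ei)) (at s)"
          unfolding h_def ei_def using inS(2)[OF s]
          by (intro has_vector_derivative_line differentiable_on_openD[OF S(1) f]) (auto simp: ei_def)
        have 3: "((\<lambda>s. (s * t) *\<^sub>R h' ej) has_vector_derivative t *\<^sub>R h' ej) (at s)"
          by (auto intro!: derivative_eq_intros simp: has_vector_derivative_def)
        show ?thesis unfolding \<phi>_def \<phi>'_def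
          by (intro has_vector_derivative_diff 1 2 3)
      qed
      have bnd: "norm (\<phi>' s) \<le> 3/4 * e * t" if s: "0 \<le> s" "s \<le> t" for s
      proof -
        define y1 y2 where "y1 = (x + t *\<^sub>R ej) + s *\<^sub>R ei" and "y2 = x + s *\<^sub>R ei"
        have y: "y1 - x = t *\<^sub>R ej + s *\<^sub>R ei" "y2 - x = s *\<^sub>R ei" by (auto simp: y1_def y2_def)
        have a: "norm (h y1 - h x - h' (y1 - x)) \<le> (e/4) * (2 * t)"
          using d2(2)[of y1] nn(1)[OF s] d t e unfolding y
          by (smt (verit, ccfv_SIG) divide_pos_pos mult_left_mono field_sum_of_halves)
        have b: "norm (h y2 - h x - h' (y2 - x)) \<le> (e/4) * t"
          using d2(2)[of y2] nn(2)[OF s] d t e unfolding y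
          by (smt (verit, ccfv_SIG) divide_pos_pos mult_left_mono field_sum_of_halves)
        have "\<phi>' s = (h y1 - h x - h' (y1 - x)) - (h y2 - h x - h' (y2 - x))"
          by (simp add: \<phi>'_def y1_def y2_def h'.add h'.scaleR algebra_simps)
        hence "norm (\<phi>' s) \<le> (e/4) * (2 * t) + (e/4) * t"
          using a b norm_triangle_ineq4 by (smt (verit))
        thus ?thesis by (simp add: field_simps)
      qed
      have "norm (\<phi> t - \<phi> 0) \<le> (\<lambda>s. (3/4 * e * t) * s) t - (\<lambda>s. (3/4 * e * t) * s) 0"
      proof (rule differentiable_bound_general[where f' = \<phi>' and \<phi>' = "\<lambda>_. 3/4 * e * t"])
        show "continuous_on {0..t} \<phi>"
          using der by (intro continuous_at_imp_continuous_on ballI)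
             (meson atLeastAtMost_iff has_vector_derivative_continuous)
        show "((*) (3/4 * e * t) has_vector_derivative 3/4 * e * t) (at s)" for s
          by (auto intro!: derivative_eq_intros simp: has_vector_derivative_def)
      qed (use t der bnd in \<open>auto intro!: continuous_intros\<close>)
      moreover have "\<phi> t - \<phi> 0 = \<Delta> t - t\<^sup>2 *\<^sub>R h' ej"
        by (simp add: \<phi>_def \<Delta>_def power2_eq_square algebra_simps)
      ultimately have *: "norm (\<Delta> t - t\<^sup>2 *\<^sub>R h' ej) \<le> 3/4 * e * t\<^sup>2"
        by (simp add: power2_eq_square algebra_simps)
      have "\<Delta> t /\<^sub>R t\<^sup>2 - h' ej = (\<Delta> t - t\<^sup>2 *\<^sub>R h' ej) /\<^sub>R t\<^sup>2"
        using t by (simp add: algebra_simps)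
      hence "norm (\<Delta> t /\<^sub>R t\<^sup>2 - h' ej) = norm (\<Delta> t - t\<^sup>2 *\<^sub>R h' ej) / t\<^sup>2"
        by (simp add: divide_inverse mult.commute)
      also have "\<dots> \<le> (3/4 * e * t\<^sup>2) / t\<^sup>2" using * by (intro divide_right_mono) auto
      also have "\<dots> < e" using t e by simp
      finally show ?thesis by (simp add: dist_norm)
    qed
    show "\<forall>\<^sub>F t in at_right 0. dist (\<Delta> t /\<^sub>R t\<^sup>2) (h' ej) < e"
      unfolding eventually_at_right_field using main d
      by (intro exI[of _ "d/2"]) auto
  qed
  thus ?thesis unfolding pd \<Delta>_def ei_def ej_def .
qed

theorem partial_deriv_commute:
  assumes S: "open S" "x \<in> S" and f: "smooth_on S f"
  shows "partial_deriv i (partial_deriv j f) x = partial_deriv j (partial_deriv i f) x"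
proof -
  have fd: "f differentiable_on S" using f unfolding smooth_on_def by (metis iter_deriv.simps(1))
  have pd: "partial_deriv k f differentiable (at x)" for k
    using smooth_on_differentiable[OF S(1) smooth_on_partial[OF f] S(2)] .
  have 1: "((\<lambda>t. (f (x + t *\<^sub>R axis i 1 + t *\<^sub>R axis j 1) - f (x + t *\<^sub>R axis i 1)
             - f (x + t *\<^sub>R axis j 1) + f x) /\<^sub>R t\<^sup>2)
           \<longlongrightarrow> partial_deriv j (partial_deriv i f) x) (at_right 0)"
    by (rule second_difference_quotient[OF S fd pd])
  have 2: "((\<lambda>t. (f (x + t *\<^sub>R axis j 1 + t *\<^sub>R axis i 1) - f (x + t *\<^sub>R axis j 1)
             - f (x + t *\<^sub>R axis i 1) + f x) /\<^sub>R t\<^sup>2)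
           \<longlongrightarrow> partial_deriv i (partial_deriv j f) x) (at_right 0)"
    by (rule second_difference_quotient[OF S fd pd])
  have eq: "(\<lambda>t. (f (x + t *\<^sub>R axis j 1 + t *\<^sub>R axis i 1) - f (x + t *\<^sub>R axis j 1)
             - f (x + t *\<^sub>R axis i 1) + f x) /\<^sub>R t\<^sup>2) = 
        (\<lambda>t. (f (x + t *\<^sub>R axis i 1 + t *\<^sub>R axis j 1) - f (x + t *\<^sub>R axis i 1)
             - f (x + t *\<^sub>R axis j 1) + f x) /\<^sub>R t\<^sup>2)"
    by (simp add: algebra_simps)
  show ?thesis
    by (rule tendsto_unique[OF _ 2[unfolded eq] 1]) simp
qed

lemma iter_deriv_move:
  assumes S: "open S" "smooth_on S f" "x \<in> S"
  shows "iter_deriv (ks @ j # js) f x = iter_deriv (j # ks @ js) f x"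
  using assms(3)
proof (induction ks arbitrary: x)
  case (Cons k ks)
  have "iter_deriv ((k # ks) @ j # js) f x = partial_deriv k (iter_deriv (j # ks @ js) f) x"
    using Cons by (auto intro: partial_deriv_cong[OF S(1)])
  also have "\<dots> = iter_deriv (j # (k # ks) @ js) f x"
    using partial_deriv_commute[OF S(1) Cons.prems smooth_on_iter[OF S(2)]] by simp
  finally show ?case .
qed auto

theorem iter_deriv_perm:
  assumes S: "open S" "smooth_on S f" "x \<in> S" and "mset js = mset js'"
  shows "iter_deriv js f x = iter_deriv js' f x"
  using assms(3,4)
proof (induction js arbitrary: js' x)
  case (Cons j js)
  obtain ks ls where js': "js' = ks @ j # ls"
    using Cons.prems(2) by (metis list.set_intros(1) mset_eq_setD split_list)
  have m: "mset js = mset (ks @ ls)" using Cons.prems(2) js' by simp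
  have "iter_deriv (j # js) f x = partial_deriv j (iter_deriv (ks @ ls) f) x"
    using Cons.IH[OF _ m] by (auto intro!: partial_deriv_cong[OF S(1) Cons.prems(1)])
  also have "\<dots> = iter_deriv js' f x"
    using iter_deriv_move[OF S(1,2) Cons.prems(1)] js' by simp
  finally show ?case .
qed auto

section \<open>Multi-indices\<close>

lemma ex_list_count: "\<exists>js. \<forall>i. count_list js i = (\<alpha> :: 'n::finite \<Rightarrow> nat) i"
proof -
  obtain js where "mset js = Abs_multiset \<alpha>" using ex_mset by blast
  thus ?thesis by (intro exI[of _ js]) (simp add: count_mset[symmetric])
qed

lemma mi_order_count_list: "mi_order (count_list js) = length js"
  by (simp add: mi_order_def sum_count_set)

text \<open>Symmetry of the derivatives makes the order chosen in \<^const>\<open>mi_deriv\<close> irrelevant.\<close>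

lemma mi_deriv_eq_iter_deriv:
  assumes "open S" "smooth_on S f" "x \<in> S" and "\<And>i. count_list js i = \<alpha> i"
  shows "mi_deriv \<alpha> f x = iter_deriv js f x"
proof -
  define ks where "ks = (SOME js. \<forall>i. count_list js i = \<alpha> i)"
  have "\<forall>i. count_list ks i = \<alpha> i" unfolding ks_def by (rule someI_ex[OF ex_list_count])
  hence "mset ks = mset js" using assms(4) by (intro multiset_eqI) (simp add: count_mset)
  hence "iter_deriv ks f x = iter_deriv js f x" by (rule iter_deriv_perm[OF assms(1-3)])
  thus ?thesis by (simp add: mi_deriv_def ks_def)
qed

lemma mi_deriv_iter_list:
  "\<exists>js. length js = mi_order \<alpha> \<and> count_list js = \<alpha> \<and> (\<forall>f. mi_deriv \<alpha> f = iter_deriv js f)"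
proof -
  define ks where "ks = (SOME js. \<forall>i. count_list js i = \<alpha> i)"
  have "\<forall>i. count_list ks i = \<alpha> i" unfolding ks_def by (rule someI_ex[OF ex_list_count])
  hence "count_list ks = \<alpha>" by auto
  thus ?thesis using mi_order_count_list[of ks] by (auto simp: mi_deriv_def ks_def)
qed

lemma mi_deriv_Suc:
  assumes "open S" "smooth_on S f" "x \<in> S"
  shows "mi_deriv (\<alpha>(j := Suc (\<alpha> j))) f x = partial_deriv j (mi_deriv \<alpha> f) x"
proof -
  obtain js where js: "\<forall>i. count_list js i = \<alpha> i" using ex_list_count by blast
  have "mi_deriv (\<alpha>(j := Suc (\<alpha> j))) f x = iter_deriv (j # js) f x"
    by (rule mi_deriv_eq_iter_deriv[OF assms]) (use js in auto)
  also have "\<dots> = partial_deriv j (mi_deriv \<alpha> f) x"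
    using js by (auto intro!: partial_deriv_cong[OF assms(1,3)] mi_deriv_eq_iter_deriv[OF assms(1,2), symmetric])
  finally show ?thesis .
qed

lemma mi_deriv_0 [simp]: "mi_deriv (\<lambda>_. 0) f = f"
  using mi_deriv_iter_list[of "\<lambda>_. 0"] by (auto simp: mi_order_def)

lemma mi_order_eq_0_iff: "mi_order \<alpha> = 0 \<longleftrightarrow> \<alpha> = (\<lambda>_. 0)"
  by (auto simp: mi_order_def)

lemma mi_order_upd: "mi_order (\<alpha>(j := Suc (\<alpha> j))) = Suc (mi_order \<alpha>)"
proof -
  have "mi_order (\<alpha>(j := Suc (\<alpha> j))) = (\<Sum>i\<in>UNIV. \<alpha> i + (if i = j then 1 else 0))"
    unfolding mi_order_def by (rule sum.cong) auto
  thus ?thesis by (simp add: sum.distrib mi_order_def)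
qed

lemma finite_mi_order [simp, intro]: "finite {\<alpha> :: 'n::finite \<Rightarrow> nat. mi_order \<alpha> \<le> m}"
proof (rule finite_subset)
  show "finite {\<alpha> :: 'n \<Rightarrow> nat. \<forall>i. (i \<in> UNIV \<longrightarrow> \<alpha> i \<in> {..m}) \<and> (i \<notin> UNIV \<longrightarrow> \<alpha> i = 0)}"
    by (rule finite_set_of_finite_funs) auto
  show "{\<alpha> :: 'n \<Rightarrow> nat. mi_order \<alpha> \<le> m} \<subseteq> \<dots>"
  proof (safe; simp)
    fix \<alpha> :: "'n \<Rightarrow> nat" and i assume "mi_order \<alpha> \<le> m"
    moreover have "\<alpha> i \<le> mi_order \<alpha>" unfolding mi_order_def by (rule member_le_sum) auto
    ultimately show "\<alpha> i \<le> m" by simp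
  qed
qed

definition mi_fact :: "('n::finite \<Rightarrow> nat) \<Rightarrow> real" where
  "mi_fact \<beta> = (\<Prod>i\<in>UNIV. fact (\<beta> i))"

text \<open>\<open>\<partial>\<^sup>\<beta> \<xi>\<^sup>\<alpha> / \<beta>!\<close>\<close>

definition monomial_taylor :: "real ^ 'n \<Rightarrow> ('n \<Rightarrow> nat) \<Rightarrow> ('n \<Rightarrow> nat) \<Rightarrow> real" where
  "monomial_taylor \<xi> \<alpha> \<beta> = (\<Prod>i\<in>UNIV. real (\<alpha> i choose \<beta> i) * (\<xi> $ i) ^ (\<alpha> i - \<beta> i))"

lemma mi_fact_pos [simp]: "mi_fact \<beta> > 0"
  by (auto simp: mi_fact_def intro!: prod_pos)

lemma mi_fact_0 [simp]: "mi_fact (\<lambda>_. 0) = 1"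
  by (simp add: mi_fact_def)

lemma monomial_taylor_eq_0: "mi_order \<beta> > mi_order \<alpha> \<Longrightarrow> monomial_taylor \<xi> \<alpha> \<beta> = 0"
proof -
  assume "mi_order \<beta> > mi_order \<alpha>"
  hence "\<exists>i. \<beta> i > \<alpha> i" unfolding mi_order_def by (metis not_le sum_mono)
  then obtain i where "\<beta> i > \<alpha> i" by blast
  thus ?thesis unfolding monomial_taylor_def by (intro prod_zero) (auto intro!: bexI[of _ i])
qed

lemma prod_upd_split:
  fixes g :: "'n::finite \<Rightarrow> 'b \<Rightarrow> 'c::comm_monoid_mult"
  shows "(\<Prod>i\<in>UNIV. g i ((\<alpha>(j := a)) i)) = g j a * (\<Prod>i\<in>UNIV - {j}. g i (\<alpha> i))"
  by (subst prod.remove[of UNIV j]) auto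

text \<open>Pascal's rule, which adds one factor \<open>\<xi>\<^sub>j\<close> to the monomial.\<close>

lemma monomial_taylor_Suc:
  fixes \<alpha> :: "'n::finite \<Rightarrow> nat"
  shows "monomial_taylor \<xi> (\<alpha>(j := Suc (\<alpha> j))) \<beta> = \<xi> $ j * monomial_taylor \<xi> \<alpha> \<beta>
     + (if \<beta> j > 0 then monomial_taylor \<xi> \<alpha> (\<beta>(j := \<beta> j - 1)) else 0)"
proof -
  define r where "r = (\<Prod>i\<in>UNIV - {j}. real (\<alpha> i choose \<beta> i) * (\<xi> $ i) ^ (\<alpha> i - \<beta> i))"
  have 1: "monomial_taylor \<xi> (\<alpha>(j := Suc (\<alpha> j))) \<beta> =
      (real (Suc (\<alpha> j) choose \<beta> j) * (\<xi> $ j) ^ (Suc (\<alpha> j) - \<beta> j)) * r"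
    unfolding monomial_taylor_def r_def
    using prod_upd_split[of "\<lambda>i a. real (a choose \<beta> i) * (\<xi> $ i) ^ (a - \<beta> i)" \<alpha> j "Suc (\<alpha> j)"] by simp
  have 2: "monomial_taylor \<xi> \<alpha> \<beta> = (real (\<alpha> j choose \<beta> j) * (\<xi> $ j) ^ (\<alpha> j - \<beta> j)) * r"
    unfolding monomial_taylor_def r_def by (subst prod.remove[of UNIV j]) auto
  have 3: "monomial_taylor \<xi> \<alpha> (\<beta>(j := b)) = (real (\<alpha> j choose b) * (\<xi> $ j) ^ (\<alpha> j - b)) * r" for b
    unfolding monomial_taylor_def r_def
    using prod_upd_split[of "\<lambda>i a. real (\<alpha> i choose a) * (\<xi> $ i) ^ (\<alpha> i - a)" \<beta> j b] by simp
  show ?thesis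
  proof (cases "\<beta> j")
    case 0
    thus ?thesis unfolding 1 2 by simp
  next
    case (Suc b)
    show ?thesis
    proof (cases "\<alpha> j > b")
      case True
      hence "\<alpha> j - b = Suc (\<alpha> j - Suc b)" by simp
      thus ?thesis unfolding 1 2 3 Suc by (simp add: algebra_simps)
    next
      case False
      thus ?thesis unfolding 1 2 3 Suc by (simp add: algebra_simps)
    qed
  qed
qed

subsection \<open>Derivatives of the symbol\<close>

lemma partial_deriv_poly:
  assumes "finite I"
  shows "partial_deriv j (\<lambda>\<xi>. \<Sum>\<alpha>\<in>I. d \<alpha> * of_real (mi_power \<xi> (\<gamma> \<alpha>))) \<xi>
       = (\<Sum>\<alpha>\<in>I. d \<alpha> * of_real (real (\<gamma> \<alpha> j) * mi_power \<xi> ((\<gamma> \<alpha>)(j := \<gamma> \<alpha> j - 1))))"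
proof -
  define r where "r = (\<lambda>\<alpha>. \<Prod>i\<in>UNIV - {j}. (\<xi> $ i) ^ \<gamma> \<alpha> i)"
  have 1: "mi_power (\<xi> + t *\<^sub>R axis j 1) (\<gamma> \<alpha>) = (\<xi> $ j + t) ^ \<gamma> \<alpha> j * r \<alpha>" for t \<alpha>
    unfolding mi_power_def r_def by (subst prod.remove[of UNIV j]) (auto simp: axis_def)
  have 2: "mi_power \<xi> ((\<gamma> \<alpha>)(j := \<gamma> \<alpha> j - 1)) = (\<xi> $ j) ^ (\<gamma> \<alpha> j - 1) * r \<alpha>" for \<alpha>
    unfolding mi_power_def r_def
    using prod_upd_split[of "\<lambda>i a. (\<xi> $ i) ^ a" "\<gamma> \<alpha>" j "\<gamma> \<alpha> j - 1"] by simp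
  have "((\<lambda>t. \<Sum>\<alpha>\<in>I. d \<alpha> * of_real (mi_power (\<xi> + t *\<^sub>R axis j 1) (\<gamma> \<alpha>))) has_vector_derivative
     (\<Sum>\<alpha>\<in>I. d \<alpha> * of_real (real (\<gamma> \<alpha> j) * mi_power \<xi> ((\<gamma> \<alpha>)(j := \<gamma> \<alpha> j - 1))))) (at 0)"
    unfolding 1 2
  proof (intro has_vector_derivative_sum has_vector_derivative_mult_right has_vector_derivative_of_real)
    fix \<alpha>
    have "((\<lambda>t. (\<xi> $ j + t) ^ \<gamma> \<alpha> j * r \<alpha>) has_real_derivative
       real (\<gamma> \<alpha> j) * ((\<xi> $ j + 0) ^ (\<gamma> \<alpha> j - 1) * r \<alpha>)) (at 0)"
      by (rule derivative_eq_intros refl | simp)+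
    thus "((\<lambda>t. (\<xi> $ j + t) ^ \<gamma> \<alpha> j * r \<alpha>) has_real_derivative
       real (\<gamma> \<alpha> j) * ((\<xi> $ j) ^ (\<gamma> \<alpha> j - 1) * r \<alpha>)) (at 0)" by simp
  qed
  thus ?thesis unfolding partial_deriv_def by (rule vector_derivative_at)
qed

lemma fact_choose_Suc: "fact b * real (a choose b) * real (a - b) = fact (Suc b) * real (a choose Suc b)"
proof -
  have "(a - b) * (a choose b) = Suc b * (a choose Suc b)"
    by (simp only: binomial_absorb_comp binomial_absorption)
  hence "real (a - b) * real (a choose b) = real (Suc b) * real (a choose Suc b)"
    by (metis of_nat_mult)
  thus ?thesis by (simp add: algebra_simps)
qed

lemma iter_deriv_poly:
  assumes "finite I"
  shows "iter_deriv js (\<lambda>\<xi>. \<Sum>\<alpha>\<in>I. c \<alpha> * of_real (mi_power \<xi> \<alpha>)) =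
     (\<lambda>\<xi>. \<Sum>\<alpha>\<in>I. c \<alpha> * of_real (mi_fact (count_list js) * monomial_taylor \<xi> \<alpha> (count_list js)))"
proof (induction js)
  case Nil
  show ?case by (simp add: mi_fact_def monomial_taylor_def mi_power_def)
next
  case (Cons j js)
  define \<beta> where "\<beta> = count_list js"
  define \<beta>' where "\<beta>' = count_list (j # js)"
  have \<beta>': "\<beta>' = \<beta>(j := Suc (\<beta> j))" by (auto simp: \<beta>_def \<beta>'_def)
  define b where "b = (\<lambda>\<alpha>::'a\<Rightarrow>nat. \<Prod>i\<in>UNIV. fact (\<beta> i) * real (\<alpha> i choose \<beta> i))"
  have eq: "mi_fact \<beta> * monomial_taylor \<xi> \<alpha> \<beta> = b \<alpha> * mi_power \<xi> (\<lambda>i. \<alpha> i - \<beta> i)" for \<xi> \<alpha>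
    by (simp add: mi_fact_def monomial_taylor_def mi_power_def b_def prod.distrib)
  have eq': "mi_fact \<beta>' * monomial_taylor \<xi> \<alpha> \<beta>' =
     b \<alpha> * (real (\<alpha> j - \<beta> j) * mi_power \<xi> ((\<lambda>i. \<alpha> i - \<beta> i)(j := \<alpha> j - \<beta> j - 1)))" for \<xi> \<alpha>
  proof -
    define p where "p = (\<Prod>i\<in>UNIV - {j}. fact (\<beta> i) * real (\<alpha> i choose \<beta> i) * (\<xi> $ i) ^ (\<alpha> i - \<beta> i))"
    have "mi_fact \<beta>' * monomial_taylor \<xi> \<alpha> \<beta>' =
        (\<Prod>i\<in>UNIV. fact (\<beta>' i) * real (\<alpha> i choose \<beta>' i) * (\<xi> $ i) ^ (\<alpha> i - \<beta>' i))"
      by (simp add: mi_fact_def monomial_taylor_def prod.distrib)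
    also have "\<dots> = fact (Suc (\<beta> j)) * real (\<alpha> j choose Suc (\<beta> j)) * (\<xi> $ j) ^ (\<alpha> j - Suc (\<beta> j)) * p"
      unfolding p_def \<beta>'
      using prod_upd_split[of "\<lambda>i a. fact a * real (\<alpha> i choose a) * (\<xi> $ i) ^ (\<alpha> i - a)" \<beta> j "Suc (\<beta> j)"] by simp
    also have "\<dots> = (fact (\<beta> j) * real (\<alpha> j choose \<beta> j)) * real (\<alpha> j - \<beta> j) * (\<xi> $ j) ^ (\<alpha> j - \<beta> j - 1) * p"
      by (simp only: fact_choose_Suc[symmetric]) simp
    also have "\<dots> = b \<alpha> * (real (\<alpha> j - \<beta> j) * mi_power \<xi> ((\<lambda>i. \<alpha> i - \<beta> i)(j := \<alpha> j - \<beta> j - 1)))"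
    proof -
      have "b \<alpha> = fact (\<beta> j) * real (\<alpha> j choose \<beta> j) * (\<Prod>i\<in>UNIV - {j}. fact (\<beta> i) * real (\<alpha> i choose \<beta> i))"
        unfolding b_def by (subst prod.remove[of UNIV j]) auto
      moreover have "mi_power \<xi> ((\<lambda>i. \<alpha> i - \<beta> i)(j := \<alpha> j - \<beta> j - 1)) =
          (\<xi> $ j) ^ (\<alpha> j - \<beta> j - 1) * (\<Prod>i\<in>UNIV - {j}. (\<xi> $ i) ^ (\<alpha> i - \<beta> i))"
        unfolding mi_power_def
        using prod_upd_split[of "\<lambda>i a. (\<xi> $ i) ^ a" "\<lambda>i. \<alpha> i - \<beta> i" j "\<alpha> j - \<beta> j - 1"] by simp
      ultimately show ?thesis by (simp add: p_def prod.distrib)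
    qed
    finally show ?thesis .
  qed
  have "iter_deriv (j # js) (\<lambda>\<xi>. \<Sum>\<alpha>\<in>I. c \<alpha> * of_real (mi_power \<xi> \<alpha>)) \<xi> =
     (\<Sum>\<alpha>\<in>I. c \<alpha> * of_real (mi_fact \<beta>' * monomial_taylor \<xi> \<alpha> \<beta>'))" for \<xi>
  proof -
    have "iter_deriv (j # js) (\<lambda>\<xi>. \<Sum>\<alpha>\<in>I. c \<alpha> * of_real (mi_power \<xi> \<alpha>)) \<xi> =
      partial_deriv j (\<lambda>\<xi>. \<Sum>\<alpha>\<in>I. (c \<alpha> * of_real (b \<alpha>)) * of_real (mi_power \<xi> (\<lambda>i. \<alpha> i - \<beta> i))) \<xi>"
      using Cons.IH by (simp add: \<beta>_def[symmetric] eq mult.assoc)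
    also have "\<dots> = (\<Sum>\<alpha>\<in>I. c \<alpha> * of_real (mi_fact \<beta>' * monomial_taylor \<xi> \<alpha> \<beta>'))"
      by (subst partial_deriv_poly[OF assms]) (simp add: eq' mult.assoc)
    finally show ?thesis .
  qed
  thus ?case unfolding \<beta>'_def by blast
qed

text \<open>\<open>\<partial>\<^sub>\<xi>\<^sup>\<beta> P(x,\<xi>) / \<beta>!\<close>\<close>

definition symbol_taylor ::
    "nat \<Rightarrow> (('n \<Rightarrow> nat) \<Rightarrow> real ^ 'n \<Rightarrow> complex) \<Rightarrow> real ^ 'n \<Rightarrow> ('n \<Rightarrow> nat) \<Rightarrow> real ^ 'n \<Rightarrow> complex" where
  "symbol_taylor m c \<xi> \<beta> x = (\<Sum>\<alpha> | mi_order \<alpha> \<le> m. c \<alpha> x * of_real (monomial_taylor \<xi> \<alpha> \<beta>))"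

lemma mi_deriv_symbol:
  fixes \<beta> :: "'n::finite \<Rightarrow> nat"
  shows "mi_deriv \<beta> (\<lambda>\<eta>. diff_symbol m c x \<eta>) \<xi> = of_real (mi_fact \<beta>) * symbol_taylor m c \<xi> \<beta> x"
proof -
  define ks where "ks = (SOME js. \<forall>i. count_list js i = \<beta> i)"
  have "\<forall>i. count_list ks i = \<beta> i" unfolding ks_def by (rule someI_ex[OF ex_list_count])
  hence ks: "count_list ks = \<beta>" by auto
  have "mi_deriv \<beta> (\<lambda>\<eta>. diff_symbol m c x \<eta>) \<xi> = iter_deriv ks (\<lambda>\<eta>. diff_symbol m c x \<eta>) \<xi>"
    by (simp add: mi_deriv_def ks_def)
  thus ?thesis
    by (simp add: diff_symbol_def iter_deriv_poly ks symbol_taylor_def sum_distrib_left mult_ac)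
qed

lemma symbol_taylor_0: "symbol_taylor m c \<xi> (\<lambda>_. 0) x = diff_symbol m c x \<xi>"
  using mi_deriv_symbol[of "\<lambda>_. 0" m c x \<xi>] by simp

lemma smooth_on_symbol_taylor:
  "open S \<Longrightarrow> (\<And>\<alpha>. mi_order \<alpha> \<le> m \<Longrightarrow> smooth_on S (c \<alpha>)) \<Longrightarrow> smooth_on S (symbol_taylor m c \<xi> \<beta>)"
  unfolding symbol_taylor_def[abs_def] by (intro smooth_intros) auto

subsection \<open>Conjugating derivatives by an exponential\<close>

text \<open>The operator \<open>v \<mapsto> e\<^bsup>ix\<xi>\<^esup> (-D)\<^sup>\<alpha> (e\<^bsup>-ix\<xi>\<^esup> v)\<close>: as \<open>-D\<^sub>j = i\<partial>\<^sub>j\<close>, conjugation turns it into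
  \<open>\<xi>\<^sub>j + i\<partial>\<^sub>j\<close>.\<close>

primrec conj_deriv :: "real ^ 'n \<Rightarrow> 'n list \<Rightarrow> (real ^ 'n \<Rightarrow> complex) \<Rightarrow> real ^ 'n \<Rightarrow> complex" where
  "conj_deriv \<xi> [] v = v"
| "conj_deriv \<xi> (j # js) v = (\<lambda>x. of_real (\<xi> $ j) * conj_deriv \<xi> js v x + \<i> * partial_deriv j (conj_deriv \<xi> js v) x)"

lemma smooth_on_conj_deriv: "open S \<Longrightarrow> smooth_on S v \<Longrightarrow> smooth_on S (conj_deriv \<xi> js v)"
  by (induction js) (auto intro!: smooth_intros smooth_on_partial)

lemma partial_deriv_cmult:
  assumes "f differentiable (at x)" shows "partial_deriv j (\<lambda>x. c * f x) x = c * partial_deriv j f x"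
  using partial_deriv_mult[of "\<lambda>_. c" x f j] assms by simp

lemma partial_deriv_sum:
  assumes "\<And>i. i \<in> I \<Longrightarrow> f i differentiable (at x)"
  shows "partial_deriv j (\<lambda>x. \<Sum>i\<in>I. f i x) x = (\<Sum>i\<in>I. partial_deriv j (f i) x)"
  using assms
proof (induction I rule: infinite_finite_induct)
  case (insert i I)
  have "(\<lambda>x. \<Sum>i\<in>I. f i x) differentiable (at x)"
    using insert by (intro differentiable_sum) auto
  thus ?case using insert by (simp add: partial_deriv_add)
qed auto

text \<open>The binomial expansion of \<open>(\<xi> + i\<partial>)\<^sup>\<alpha>\<close>, valid since the factors commute on smooth functions.\<close>

lemma conj_deriv_eq:
  assumes S: "open S" "smooth_on S v" "x \<in> S"
  shows "conj_deriv \<xi> js v x =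
    (\<Sum>\<beta> | mi_order \<beta> \<le> length js. of_real (monomial_taylor \<xi> (count_list js) \<beta>) * (\<i> ^ mi_order \<beta> * mi_deriv \<beta> v x))"
  using S(3)
proof (induction js arbitrary: x)
  case Nil
  have "{\<beta> :: 'a \<Rightarrow> nat. mi_order \<beta> \<le> 0} = {\<lambda>_. 0}" by (auto simp: mi_order_eq_0_iff)
  moreover have "mi_order (\<lambda>_::'a. 0) = 0" by (simp add: mi_order_eq_0_iff)
  ultimately show ?case by (simp add: monomial_taylor_def)
next
  case (Cons j js)
  define \<alpha> where "\<alpha> = count_list js"
  define l where "l = length js"
  have l: "l = mi_order \<alpha>" by (simp add: \<alpha>_def l_def mi_order_count_list)
  have \<alpha>': "count_list (j # js) = \<alpha>(j := Suc (\<alpha> j))" by (auto simp: \<alpha>_def)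
  define Y where "Y = (\<lambda>\<beta>. \<i> ^ mi_order \<beta> * mi_deriv \<beta> v x)"
  define t where "t = (\<lambda>\<beta>. complex_of_real (monomial_taylor \<xi> \<alpha> \<beta>))"
  have d: "mi_deriv \<beta> v differentiable (at x)" for \<beta>
    using smooth_on_differentiable[OF S(1) smooth_on_mi_deriv[OF S(2)] Cons.prems] .
  have Y: "\<i> * partial_deriv j (\<lambda>x. t \<beta> * (\<i> ^ mi_order \<beta> * mi_deriv \<beta> v x)) x = t \<beta> * Y (\<beta>(j := Suc (\<beta> j)))" for \<beta>
    using mi_deriv_Suc[OF S(1,2) Cons.prems, of \<beta> j] d[of \<beta>] partial_deriv_cmult[OF d, of j "t \<beta> * \<i> ^ mi_order \<beta>" \<beta>]
    by (simp add: Y_def mi_order_upd mult_ac)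
  have "partial_deriv j (conj_deriv \<xi> js v) x =
      partial_deriv j (\<lambda>x. \<Sum>\<beta> | mi_order \<beta> \<le> l. t \<beta> * (\<i> ^ mi_order \<beta> * mi_deriv \<beta> v x)) x"
    using Cons.IH by (intro partial_deriv_cong[OF S(1) Cons.prems]) (auto simp: t_def \<alpha>_def l_def)
  also have "\<dots> = (\<Sum>\<beta> | mi_order \<beta> \<le> l. partial_deriv j (\<lambda>x. t \<beta> * (\<i> ^ mi_order \<beta> * mi_deriv \<beta> v x)) x)"
    using d by (intro partial_deriv_sum) (auto intro!: derivative_intros)
  finally have "\<i> * partial_deriv j (conj_deriv \<xi> js v) x = (\<Sum>\<beta> | mi_order \<beta> \<le> l. t \<beta> * Y (\<beta>(j := Suc (\<beta> j))))"
    by (simp add: sum_distrib_left Y)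
  also have "\<dots> = (\<Sum>\<beta> | mi_order \<beta> \<le> Suc l \<and> \<beta> j > 0. t (\<beta>(j := \<beta> j - 1)) * Y \<beta>)"
  proof (rule sum.reindex_bij_witness[where j = "\<lambda>\<beta>. \<beta>(j := Suc (\<beta> j))" and i = "\<lambda>\<beta>. \<beta>(j := \<beta> j - 1)"])
    fix \<beta> :: "'a \<Rightarrow> nat" assume "\<beta> \<in> {\<beta>. mi_order \<beta> \<le> Suc l \<and> \<beta> j > 0}"
    hence "mi_order ((\<beta>(j := \<beta> j - 1))(j := Suc ((\<beta>(j := \<beta> j - 1)) j))) \<le> Suc l" "\<beta> j > 0" by auto
    thus "\<beta>(j := \<beta> j - 1) \<in> {\<beta>. mi_order \<beta> \<le> l}" unfolding mi_order_upd by simp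
  qed (auto simp: mi_order_upd)
  also have "\<dots> = (\<Sum>\<beta> | mi_order \<beta> \<le> Suc l. if \<beta> j > 0 then t (\<beta>(j := \<beta> j - 1)) * Y \<beta> else 0)"
    by (subst sum.inter_filter[symmetric]) auto
  finally have B: "\<i> * partial_deriv j (conj_deriv \<xi> js v) x = \<dots>" .
  have A: "conj_deriv \<xi> js v x = (\<Sum>\<beta> | mi_order \<beta> \<le> Suc l. t \<beta> * Y \<beta>)"
    unfolding Cons.IH[OF Cons.prems] Y_def t_def \<alpha>_def[symmetric] l_def[symmetric]
    by (rule sum.mono_neutral_left) (auto simp: monomial_taylor_eq_0 l)
  have "conj_deriv \<xi> (j # js) v x = (\<Sum>\<beta> | mi_order \<beta> \<le> Suc l. of_real (\<xi> $ j) * (t \<beta> * Y \<beta>)) +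
     (\<Sum>\<beta> | mi_order \<beta> \<le> Suc l. if \<beta> j > 0 then t (\<beta>(j := \<beta> j - 1)) * Y \<beta> else 0)"
    using A B by (simp add: sum_distrib_left)
  also have "\<dots> = (\<Sum>\<beta> | mi_order \<beta> \<le> Suc l. of_real (monomial_taylor \<xi> (\<alpha>(j := Suc (\<alpha> j))) \<beta>) * Y \<beta>)"
    unfolding sum.distrib[symmetric]
    by (intro sum.cong refl) (auto simp: monomial_taylor_Suc t_def algebra_simps)
  finally show ?case by (simp only: \<alpha>' Y_def l_def length_Cons)
qed

section \<open>Bounds on finitely many derivatives\<close>

definition deriv_bound :: "(real ^ 'n) set \<Rightarrow> nat \<Rightarrow> real \<Rightarrow> (real ^ 'n \<Rightarrow> complex) \<Rightarrow> bool" where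
  "deriv_bound S L A f \<longleftrightarrow> (\<forall>js. length js \<le> L \<longrightarrow> (\<forall>x\<in>S. norm (iter_deriv js f x) \<le> A))"

lemma deriv_boundD: "deriv_bound S L A f \<Longrightarrow> length js \<le> L \<Longrightarrow> x \<in> S \<Longrightarrow> norm (iter_deriv js f x) \<le> A"
  by (auto simp: deriv_bound_def)

lemma deriv_bound_normD: "deriv_bound S L A f \<Longrightarrow> x \<in> S \<Longrightarrow> norm (f x) \<le> A"
  using deriv_boundD[of S L A f "[]" x] by simp

lemma deriv_bound_mono:
  "deriv_bound S L A f \<Longrightarrow> T \<subseteq> S \<Longrightarrow> K \<le> L \<Longrightarrow> A \<le> B \<Longrightarrow> deriv_bound T K B f"
  unfolding deriv_bound_def by (meson order_trans subsetD)

lemma deriv_bound_0: "deriv_bound S 0 A f \<longleftrightarrow> (\<forall>x\<in>S. norm (f x) \<le> A)"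
  by (auto simp: deriv_bound_def)

lemma deriv_bound_Suc:
  fixes f :: "real ^ 'n \<Rightarrow> complex"
  shows "deriv_bound S (Suc L) A f \<longleftrightarrow> (\<forall>x\<in>S. norm (f x) \<le> A) \<and> (\<forall>j. deriv_bound S L A (partial_deriv j f))"
proof (intro iffI conjI allI)
  assume *: "deriv_bound S (Suc L) A f"
  show "\<forall>x\<in>S. norm (f x) \<le> A" using deriv_bound_normD[OF *] by blast
  fix j show "deriv_bound S L A (partial_deriv j f)"
    unfolding deriv_bound_def
  proof (intro allI impI ballI)
    fix js :: "'n list" and x assume "length js \<le> L" "x \<in> S"
    thus "norm (iter_deriv js (partial_deriv j f) x) \<le> A"
      using deriv_boundD[OF *, of "js @ [j]" x] by (simp add: iter_deriv_append)
  qed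
next
  assume *: "(\<forall>x\<in>S. norm (f x) \<le> A) \<and> (\<forall>j. deriv_bound S L A (partial_deriv j f))"
  show "deriv_bound S (Suc L) A f"
    unfolding deriv_bound_def
  proof (intro allI impI ballI)
    fix js :: "'n list" and x assume a: "length js \<le> Suc L" "x \<in> S"
    show "norm (iter_deriv js f x) \<le> A"
    proof (cases js rule: rev_cases)
      case (snoc ks k)
      thus ?thesis using * a deriv_boundD[of S L A "partial_deriv k f" ks x] by (simp add: iter_deriv_append)
    qed (use * a in auto)
  qed
qed

lemma deriv_bound_iter: "deriv_bound S (length js + L) A f \<Longrightarrow> deriv_bound S L A (iter_deriv js f)"
  unfolding deriv_bound_def iter_deriv_append[symmetric] by auto

lemma deriv_bound_mi_deriv: "deriv_bound S (mi_order \<alpha> + L) A f \<Longrightarrow> deriv_bound S L A (mi_deriv \<alpha> f)"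
proof -
  assume *: "deriv_bound S (mi_order \<alpha> + L) A f"
  obtain js where "length js = mi_order \<alpha>" "\<forall>f. mi_deriv \<alpha> f = iter_deriv js f"
    using mi_deriv_iter_list by blast
  thus ?thesis using deriv_bound_iter[of S js L A f] * by simp
qed

lemma deriv_bound_cong:
  fixes f g :: "real ^ 'n \<Rightarrow> complex"
  assumes "open T" "S \<subseteq> T" "deriv_bound S L A f" "\<And>x. x \<in> T \<Longrightarrow> f x = g x"
  shows "deriv_bound S L A g"
  unfolding deriv_bound_def
proof (intro allI impI ballI)
  fix js :: "'n list" and x assume a: "length js \<le> L" "x \<in> S"
  have "iter_deriv js f x = iter_deriv js g x"
    by (rule iter_deriv_cong[OF assms(1) _ assms(4)]) (use a assms(2) in auto)
  thus "norm (iter_deriv js g x) \<le> A" using deriv_boundD[OF assms(3) a] by simp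
qed

lemma deriv_bound_const: "norm c \<le> A \<Longrightarrow> deriv_bound S L A (\<lambda>_. c)"
proof (induction L arbitrary: c)
  case (Suc L)
  have "0 \<le> A" using Suc.prems norm_ge_zero order_trans by blast
  thus ?case using Suc by (simp add: deriv_bound_Suc)
qed (simp add: deriv_bound_0)

lemma deriv_bound_add:
  assumes "open T" "S \<subseteq> T" "smooth_on T f" "smooth_on T g" "deriv_bound S L A f" "deriv_bound S L B g"
  shows "deriv_bound S L (A + B) (\<lambda>x. f x + g x)"
  using assms(3-)
proof (induction L arbitrary: f g)
  case 0
  thus ?case by (auto simp: deriv_bound_0 intro!: norm_triangle_mono)
next
  case (Suc L)
  have "deriv_bound S L (A + B) (\<lambda>x. partial_deriv j f x + partial_deriv j g x)" for j
    using Suc.prems by (intro Suc.IH smooth_on_partial) (auto simp: deriv_bound_Suc)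
  hence "deriv_bound S L (A + B) (partial_deriv j (\<lambda>x. f x + g x))" for j
    by (rule deriv_bound_cong[OF assms(1,2)])
       (simp add: partial_deriv_add smooth_on_differentiable[OF assms(1)] Suc.prems)
  moreover have "norm (f x + g x) \<le> A + B" if "x \<in> S" for x
    using deriv_bound_normD[OF Suc.prems(3) that] deriv_bound_normD[OF Suc.prems(4) that]
    by (rule norm_triangle_mono)
  ultimately show ?case unfolding deriv_bound_Suc by blast
qed

text \<open>Each application of the product rule doubles the number of terms.\<close>

lemma deriv_bound_mult:
  assumes "open T" "S \<subseteq> T" "smooth_on T f" "smooth_on T g" "deriv_bound S L A f" "deriv_bound S L B g"
    and "0 \<le> A" "0 \<le> B"
  shows "deriv_bound S L (2 ^ L * A * B) (\<lambda>x. f x * g x)"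
  using assms(3-6)
proof (induction L arbitrary: f g)
  case 0
  thus ?case using assms by (auto simp: deriv_bound_0 norm_mult intro!: mult_mono)
next
  case (Suc L)
  have sm: "smooth_on T (partial_deriv j f)" "smooth_on T (partial_deriv j g)" for j
    using Suc.prems by (auto intro: smooth_on_partial)
  have lower: "deriv_bound S L A f" "deriv_bound S L B g"
    using deriv_bound_mono[OF Suc.prems(3) order.refl, of L A] deriv_bound_mono[OF Suc.prems(4) order.refl, of L B]
    by simp_all
  have b: "deriv_bound S L (2 ^ L * A * B) (\<lambda>x. partial_deriv j f x * g x)"
    "deriv_bound S L (2 ^ L * A * B) (\<lambda>x. f x * partial_deriv j g x)" for j
    using Suc.prems lower by (auto intro!: Suc.IH sm simp: deriv_bound_Suc)
  have "deriv_bound S L (2 ^ L * A * B + 2 ^ L * A * B) (\<lambda>x. partial_deriv j f x * g x + f x * partial_deriv j g x)" for j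
    by (intro deriv_bound_add[OF assms(1,2)] b smooth_on_mult assms(1) sm Suc.prems)
  hence "deriv_bound S L (2 ^ Suc L * A * B) (\<lambda>x. partial_deriv j f x * g x + f x * partial_deriv j g x)" for j
    by (rule deriv_bound_mono) auto
  hence "deriv_bound S L (2 ^ Suc L * A * B) (partial_deriv j (\<lambda>x. f x * g x))" for j
    by (rule deriv_bound_cong[OF assms(1,2)])
       (simp add: partial_deriv_mult smooth_on_differentiable[OF assms(1)] Suc.prems)
  moreover have "norm (f x * g x) \<le> 2 ^ Suc L * A * B" if "x \<in> S" for x
  proof -
    have "norm (f x * g x) \<le> 1 * (A * B)"
      using deriv_bound_normD[OF Suc.prems(3) that] deriv_bound_normD[OF Suc.prems(4) that] assms
      by (auto simp: norm_mult intro: mult_mono)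
    also have "\<dots> \<le> 2 ^ Suc L * (A * B)" using assms by (intro mult_right_mono one_le_power) auto
    finally show ?thesis by (simp add: mult.assoc)
  qed
  ultimately show ?case by (simp only: deriv_bound_Suc) blast
qed

lemma iter_deriv_cmult:
  assumes "open T" "smooth_on T f" "x \<in> T"
  shows "iter_deriv js (\<lambda>x. c * f x) x = c * iter_deriv js f x"
  using assms(3)
proof (induction js arbitrary: x)
  case (Cons j js)
  have "iter_deriv (j # js) (\<lambda>x. c * f x) x = partial_deriv j (\<lambda>x. c * iter_deriv js f x) x"
    using Cons by (auto intro: partial_deriv_cong[OF assms(1)])
  thus ?case using smooth_on_differentiable[OF assms(1) smooth_on_iter[OF assms(2)] Cons.prems]
    by (simp add: partial_deriv_cmult)
qed auto

lemma deriv_bound_compact: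
  assumes T: "open T" "compact K" "K \<subseteq> T" and "smooth_on T f"
  shows "\<exists>A>0. deriv_bound K L A f"
  using assms(4)
proof (induction L arbitrary: f)
  have *: "\<exists>A>0. \<forall>x\<in>K. norm (f x) \<le> A" if "smooth_on T f" for f :: "real ^ 'a \<Rightarrow> complex"
  proof -
    have "compact (f ` K)"
      using T smooth_on_continuous[OF that] by (intro compact_continuous_image) (auto intro: continuous_on_subset)
    thus ?thesis using bounded_pos[of "f ` K"] compact_imp_bounded by auto
  qed
  {
    case 0 thus ?case using *[of f] by (simp add: deriv_bound_0)
  next
    case (Suc L)
    obtain A0 where A0: "A0 > 0" "\<forall>x\<in>K. norm (f x) \<le> A0" using *[OF Suc.prems] by blast
    have "\<forall>j. \<exists>A>0. deriv_bound K L A (partial_deriv j f)"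
      using Suc.IH smooth_on_partial[OF Suc.prems] by blast
    then obtain A where A: "\<And>j. A j > 0" "\<And>j. deriv_bound K L (A j) (partial_deriv j f)" by metis
    define B where "B = A0 + (\<Sum>j\<in>UNIV. A j)"
    have "A j \<le> (\<Sum>j\<in>UNIV. A j)" for j
      by (rule member_le_sum) (use A(1) in \<open>auto intro: less_imp_le\<close>)
    hence "A j \<le> B" "A0 \<le> B" for j using A0(1) A(1) by (auto simp: B_def add_increasing intro: sum_nonneg less_imp_le)
    hence "deriv_bound K (Suc L) B f"
      unfolding deriv_bound_Suc using A0(2) A(2) by (meson deriv_bound_mono order.refl order_trans)
    moreover have "B > 0" using \<open>A0 \<le> B\<close> A0 by simp
    ultimately show ?case by blast
  }
qed

section \<open>Compactly supported smooth functions\<close>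

lemma iter_deriv_outside:
  assumes "closed K" "\<And>x. x \<notin> K \<Longrightarrow> f x = 0" "x \<notin> K"
  shows "iter_deriv js f x = 0"
  using iter_deriv_cong[of "- K" x f "\<lambda>_. 0" js] assms by auto

lemma mi_deriv_outside:
  assumes "closed K" "\<And>x. x \<notin> K \<Longrightarrow> f x = 0" "x \<notin> K"
  shows "mi_deriv \<alpha> f x = 0"
proof -
  obtain js where "mi_deriv \<alpha> f = iter_deriv js f" using mi_deriv_iter_list by blast
  thus ?thesis using iter_deriv_outside[OF assms] by simp
qed

lemma smooth_on_extend_zero:
  assumes "open S" "smooth_on S f" "closed K" "K \<subseteq> S" "\<And>x. x \<notin> K \<Longrightarrow> f x = 0"
  shows "smooth_on UNIV f"
proof -
  have "smooth_on (- K) f"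
    by (rule smooth_on_cong[OF _ smooth_on_const[of _ 0]]) (use assms in auto)
  hence "smooth_on (S \<union> - K) f" using assms by (intro smooth_on_Un) auto
  moreover have "S \<union> - K = UNIV" using assms(4) by auto
  ultimately show ?thesis by simp
qed

lemma deriv_bound_extend:
  assumes "closed K" "\<And>x. x \<notin> K \<Longrightarrow> f x = 0" "deriv_bound K L A f" "0 \<le> A"
  shows "deriv_bound UNIV L A f"
  unfolding deriv_bound_def
  by (metis assms deriv_bound_def iter_deriv_outside norm_zero)

lemma integrable_compact_support:
  fixes f :: "real ^ 'n \<Rightarrow> complex"
  assumes "compact K" "continuous_on UNIV f" "\<And>x. x \<notin> K \<Longrightarrow> f x = 0"
  shows "integrable lborel f"
proof -
  have "integrable lborel (\<lambda>x. indicator K x *\<^sub>R f x)"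
    using borel_integrable_compact[OF assms(1) continuous_on_subset[OF assms(2)]] by simp
  moreover have "(\<lambda>x. indicator K x *\<^sub>R f x) = f" using assms(3) by (auto simp: indicator_def)
  ultimately show ?thesis by simp
qed

lemma partial_deriv_lipschitz:
  assumes f: "smooth_on UNIV f" and B: "\<And>x. norm (partial_deriv j f x) \<le> B" and t: "t > 0"
  shows "norm (f (x + t *\<^sub>R axis j 1) - f x) \<le> B * t"
proof -
  have "norm ((\<lambda>t. f (x + t *\<^sub>R axis j 1)) t - (\<lambda>t. f (x + t *\<^sub>R axis j 1)) 0) \<le> (\<lambda>s. B * s) t - (\<lambda>s. B * s) 0"
  proof (rule differentiable_bound_general[where f' = "\<lambda>s. partial_deriv j f (x + s *\<^sub>R axis j 1)" and \<phi>' = "\<lambda>_. B"])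
    have der: "((\<lambda>t. f (x + t *\<^sub>R axis j 1)) has_vector_derivative partial_deriv j f (x + s *\<^sub>R axis j 1)) (at s)" for s
      using smooth_on_differentiable[OF open_UNIV f] by (intro has_vector_derivative_line) auto
    show "((\<lambda>t. f (x + t *\<^sub>R axis j 1)) has_vector_derivative partial_deriv j f (x + s *\<^sub>R axis j 1)) (at s)" for s
      by (rule der)
    show "continuous_on {0..t} (\<lambda>t. f (x + t *\<^sub>R axis j 1))"
      using der by (intro continuous_at_imp_continuous_on ballI) (meson has_vector_derivative_continuous)
    show "((*) B has_vector_derivative B) (at s)" for s
      by (auto intro!: derivative_eq_intros simp: has_vector_derivative_def)
  qed (use t B in \<open>auto intro!: continuous_intros\<close>)
  thus ?thesis by simp
qed

text \<open>The integral is invariant under translation, so the difference quotients have integral zero.\<close>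

lemma integral_partial_deriv_eq_0:
  fixes f :: "real ^ 'n \<Rightarrow> complex"
  assumes f: "smooth_on UNIV f" and K: "compact K" "\<And>x. x \<notin> K \<Longrightarrow> f x = 0"
  shows "(LINT x|lborel. partial_deriv j f x) = 0"
proof -
  define a where "a = (axis j 1 :: real ^ 'n)"
  define t where "t = (\<lambda>n. inverse (real (Suc n)))"
  have t: "0 < t n" "t n \<le> 1" for n by (auto simp: t_def field_simps)
  have intf: "integrable lborel f"
    by (rule integrable_compact_support[OF K(1) smooth_on_continuous[OF f] K(2)])
  have cf: "continuous_on UNIV f" by (rule smooth_on_continuous[OF f])
  obtain B where B: "B > 0" "deriv_bound K 1 B f"
    using deriv_bound_compact[OF open_UNIV K(1) _ f] by blast
  have "deriv_bound UNIV 1 B f"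
    by (rule deriv_bound_extend[OF compact_imp_closed[OF K(1)] K(2) B(2)]) (use B in auto)
  hence B': "norm (partial_deriv j f x) \<le> B" for x
    using deriv_boundD[of UNIV 1 B f "[j]" x] by simp
  define K' where "K' = (\<lambda>(x, s). x - s *\<^sub>R a) ` (K \<times> {0..1::real})"
  have K': "compact K'" unfolding K'_def
    by (intro compact_continuous_image compact_Times K compact_Icc) (auto intro!: continuous_intros simp: case_prod_beta)
  have KK': "x \<notin> K' \<Longrightarrow> x + s *\<^sub>R a \<notin> K" if "0 \<le> s" "s \<le> 1" for x s
    unfolding K'_def using that by (auto intro!: rev_image_eqI[of "(x + s *\<^sub>R a, s)"])
  define q where "q = (\<lambda>n x. (f (x + t n *\<^sub>R a) - f x) /\<^sub>R t n)"
  have shift: "integrable lborel (\<lambda>x. f (x + c))" "(LINT x|lborel. f (x + c)) = (LINT x|lborel. f x)" for c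
  proof -
    have m: "f \<in> borel_measurable borel" using cf by (rule borel_measurable_continuous_onI)
    have "integrable (distr lborel borel ((+) c)) f" using intf by (simp add: lborel_distr_plus)
    thus "integrable lborel (\<lambda>x. f (x + c))" using m by (subst (asm) integrable_distr_eq) (auto simp: add.commute)
    have "(LINT x|lborel. f x) = (LINT x|distr lborel borel ((+) c). f x)" by (simp add: lborel_distr_plus)
    also have "\<dots> = (LINT x|lborel. f (c + x))" using m by (intro integral_distr) auto
    finally show "(LINT x|lborel. f (x + c)) = (LINT x|lborel. f x)" by (simp add: add.commute)
  qed
  have q0: "(LINT x|lborel. q n x) = 0" for n
  proof -
    have i: "integrable lborel (\<lambda>x. f (x + t n *\<^sub>R a) - f x)"
      by (rule Bochner_Integration.integrable_diff[OF shift(1) intf])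
    have z: "(LINT x|lborel. f (x + t n *\<^sub>R a) - f x) = 0"
      using Bochner_Integration.integral_diff[OF shift(1) intf, of "t n *\<^sub>R a"] shift(2) by simp
    show ?thesis
      unfolding q_def by (subst integral_scaleR_right) (rule i | simp only: z scaleR_zero_right)+
  qed
  have "(\<lambda>n. LINT x|lborel. q n x) \<longlonglongrightarrow> (LINT x|lborel. partial_deriv j f x)"
  proof (rule integral_dominated_convergence[where w = "\<lambda>x. B * indicator K' x"])
    show "partial_deriv j f \<in> borel_measurable lborel"
      using smooth_on_continuous[OF smooth_on_partial[OF f]] by (simp add: borel_measurable_continuous_onI)
    show "q n \<in> borel_measurable lborel" for n
      unfolding q_def by (intro borel_measurable_integrable integrable_scaleR_right Bochner_Integration.integrable_diff shift intf)
    show "integrable lborel (\<lambda>x. B * indicator K' x)"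
      using K' emeasure_bounded_finite[OF compact_imp_bounded[OF K']]
      by (auto intro!: integrable_mult_right simp: integrable_indicator_iff borel_compact)
    show "AE x in lborel. (\<lambda>n. q n x) \<longlonglongrightarrow> partial_deriv j f x"
    proof (rule AE_I2)
      fix x
      have "((\<lambda>t. f (x + t *\<^sub>R axis j 1)) has_vector_derivative partial_deriv j f (x + 0 *\<^sub>R axis j 1)) (at 0)"
        using smooth_on_differentiable[OF open_UNIV f] by (intro has_vector_derivative_line) auto
      hence L: "((\<lambda>s. (f (x + s *\<^sub>R a) - f x - s *\<^sub>R partial_deriv j f x) /\<^sub>R \<bar>s\<bar>) \<longlongrightarrow> 0) (at 0)"
        by (simp add: a_def has_vector_derivative_def has_derivative_at2 inverse_eq_divide diff_diff_eq)
      have "((\<lambda>s. (f (x + s *\<^sub>R a) - f x) /\<^sub>R s - partial_deriv j f x) \<longlongrightarrow> 0) (at 0)"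
      proof (rule tendsto_norm_zero_cancel, rule Lim_transform_eventually[OF tendsto_norm_zero[OF L]])
        show "\<forall>\<^sub>F s in at 0. norm ((f (x + s *\<^sub>R a) - f x - s *\<^sub>R partial_deriv j f x) /\<^sub>R \<bar>s\<bar>)
            = norm ((f (x + s *\<^sub>R a) - f x) /\<^sub>R s - partial_deriv j f x)"
          unfolding eventually_at_filter
        proof (intro always_eventually allI impI)
          fix s :: real assume "s \<noteq> 0"
          hence "(f (x + s *\<^sub>R a) - f x) /\<^sub>R s - partial_deriv j f x =
              (f (x + s *\<^sub>R a) - f x - s *\<^sub>R partial_deriv j f x) /\<^sub>R s"
            by (simp add: scaleR_diff_right)
          thus "norm ((f (x + s *\<^sub>R a) - f x - s *\<^sub>R partial_deriv j f x) /\<^sub>R \<bar>s\<bar>)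
            = norm ((f (x + s *\<^sub>R a) - f x) /\<^sub>R s - partial_deriv j f x)" by simp
        qed
      qed
      hence "((\<lambda>s. (f (x + s *\<^sub>R a) - f x) /\<^sub>R s) \<longlongrightarrow> partial_deriv j f x) (at 0)"
        by (rule LIM_zero_cancel)
      moreover have "filterlim t (at 0) sequentially"
        unfolding t_def filterlim_at using LIMSEQ_inverse_real_of_nat by auto
      ultimately show "(\<lambda>n. q n x) \<longlonglongrightarrow> partial_deriv j f x"
        unfolding q_def by (rule filterlim_compose)
    qed
    show "AE x in lborel. norm (q n x) \<le> B * indicator K' x" for n
    proof (rule AE_I2)
      fix x
      show "norm (q n x) \<le> B * indicator K' x"
      proof (cases "x \<in> K'")
        case True
        have "norm (f (x + t n *\<^sub>R a) - f x) \<le> B * t n"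
          unfolding a_def by (rule partial_deriv_lipschitz[OF f B' t(1)])
        moreover have "norm (q n x) = norm (f (x + t n *\<^sub>R a) - f x) / t n"
          unfolding q_def norm_scaleR using t(1)[of n] by (simp add: divide_inverse_commute)
        ultimately show ?thesis using True t(1)[of n] by (simp add: pos_divide_le_eq)
      next
        case False
        hence "f (x + t n *\<^sub>R a) = 0" "f x = 0"
          using KK'[of "t n" x] KK'[of 0 x] t[of n] by (auto intro!: K(2))
        thus ?thesis using False by (simp add: q_def)
      qed
    qed
  qed
  thus ?thesis unfolding q0 using LIMSEQ_unique tendsto_const by blast
qed

section \<open>The Fourier transform and the transposed operator\<close>

text \<open>The kernel \<open>e\<^bsup>-ix\<xi>\<^esup>\<close> of the Fourier transform.\<close>

definition osc :: "real ^ 'n \<Rightarrow> real ^ 'n \<Rightarrow> complex" where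
  "osc \<xi> x = exp (- (\<i> * complex_of_real (\<xi> \<bullet> x)))"

lemma norm_osc [simp]: "norm (osc \<xi> x) = 1"
  by (simp add: osc_def norm_exp_eq_Re)

lemma osc_has_derivative:
  "(osc \<xi> has_derivative (\<lambda>h. - (\<i> * complex_of_real (\<xi> \<bullet> h)) * osc \<xi> x)) (at x)"
proof -
  have "((\<lambda>x. - (\<i> * complex_of_real (\<xi> \<bullet> x))) has_derivative (\<lambda>h. - (\<i> * complex_of_real (\<xi> \<bullet> h)))) (at x)"
    by (intro derivative_intros)
  from has_derivative_compose[OF this DERIV_exp[unfolded has_field_derivative_def]]
  show ?thesis unfolding osc_def[abs_def] by (simp add: mult.commute)
qed

lemma partial_deriv_osc: "partial_deriv j (osc \<xi>) x = - (\<i> * of_real (\<xi> $ j)) * osc \<xi> x"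
  using partial_deriv_eqI[OF osc_has_derivative, of j \<xi> x] by (simp add: inner_axis)

lemma smooth_on_osc [smooth_intros]: "open S \<Longrightarrow> smooth_on S (osc \<xi>)"
proof (rule smooth_on_coinduct[where C = "\<lambda>f. \<exists>c. f = (\<lambda>x. c * osc \<xi> x)"])
  have d: "osc \<xi> differentiable (at x)" for x
    using osc_has_derivative unfolding differentiable_def by blast
  fix f assume "\<exists>c. f = (\<lambda>x. c * osc \<xi> x)"
  then obtain c where c: "f = (\<lambda>x. c * osc \<xi> x)" by blast
  show "f differentiable_on S" unfolding c
    by (rule differentiable_at_imp_differentiable_on) (simp add: d differentiable_mult)
  fix j
  have "partial_deriv j f x = (- (c * \<i> * of_real (\<xi> $ j))) * osc \<xi> x" for x
    unfolding c using partial_deriv_cmult[OF d, of j c x] by (simp add: partial_deriv_osc)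
  thus "\<exists>g. (\<exists>c. g = (\<lambda>x. c * osc \<xi> x)) \<and> (\<forall>x\<in>S. partial_deriv j f x = g x)" by blast
qed (auto intro: exI[of _ 1])

lemma fourier_osc: "fourier v \<xi> = (LINT x|lborel. v x * osc \<xi> x)"
  by (simp add: fourier_def osc_def)

lemma continuous_on_osc [continuous_intros]: "continuous_on S (osc \<xi>)"
  using continuous_on_subset[OF smooth_on_continuous[OF smooth_on_osc[OF open_UNIV]]] by blast

lemma fourier_integrable:
  assumes "compact K" "continuous_on UNIV f" "\<And>x. x \<notin> K \<Longrightarrow> f x = 0"
  shows "integrable lborel (\<lambda>x. f x * osc \<xi> x)"
  using assms by (intro integrable_compact_support[OF assms(1)]) (auto intro!: continuous_intros)

lemma smooth_on_mult_extend:
  assumes "open \<Omega>" "smooth_on \<Omega> u" "smooth_on UNIV v" "compact K" "K \<subseteq> \<Omega>" "\<And>x. x \<notin> K \<Longrightarrow> v x = 0"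
  shows "smooth_on UNIV (\<lambda>x. u x * v x)"
  using assms smooth_on_mult[OF assms(1,2) smooth_on_subset[OF assms(3)]]
  by (intro smooth_on_extend_zero[of \<Omega> _ K]) (auto intro: compact_imp_closed)

text \<open>The derivative of \<open>u v e\<^bsup>-ix\<xi>\<^esup>\<close> has integral zero; the term in which the exponential is
  differentiated is the \<open>\<xi>\<^sub>j\<close> of \<^const>\<open>conj_deriv\<close>.\<close>

lemma integral_by_parts_osc:
  assumes \<Omega>: "open \<Omega>" "smooth_on \<Omega> u" and v: "smooth_on UNIV v"
    and K: "compact K" "K \<subseteq> \<Omega>" "\<And>x. x \<notin> K \<Longrightarrow> v x = 0"
  shows "fourier (\<lambda>x. (- \<i>) * partial_deriv j u x * v x) \<xi> = fourier (\<lambda>x. u x * conj_deriv \<xi> [j] v x) \<xi>"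
proof -
  have pv: "smooth_on UNIV (partial_deriv j v)" by (rule smooth_on_partial[OF v])
  have pv0: "partial_deriv j v x = 0" if "x \<notin> K" for x
    using iter_deriv_outside[OF compact_imp_closed[OF K(1)] K(3) that, where js = "[j]"] by simp
  have s1: "smooth_on UNIV (\<lambda>x. u x * v x)" by (rule smooth_on_mult_extend[OF \<Omega> v K])
  have s2: "smooth_on UNIV (\<lambda>x. u x * v x * osc \<xi> x)"
    by (intro smooth_intros open_UNIV s1)
  have s3: "smooth_on UNIV (\<lambda>x. partial_deriv j u x * v x)"
    by (rule smooth_on_mult_extend[OF \<Omega>(1) smooth_on_partial[OF \<Omega>(2)] v K])
  have s4: "smooth_on UNIV (\<lambda>x. u x * partial_deriv j v x)"
    by (rule smooth_on_mult_extend[OF \<Omega> pv K(1,2) pv0])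
  have i1: "integrable lborel (\<lambda>x. (partial_deriv j u x * v x) * osc \<xi> x)"
    by (rule fourier_integrable[OF K(1) smooth_on_continuous[OF s3]]) (simp add: K)
  have i2: "integrable lborel (\<lambda>x. (u x * partial_deriv j v x) * osc \<xi> x)"
    by (rule fourier_integrable[OF K(1) smooth_on_continuous[OF s4]]) (simp add: pv0)
  have i3: "integrable lborel (\<lambda>x. (u x * v x) * osc \<xi> x)"
    by (rule fourier_integrable[OF K(1) smooth_on_continuous[OF s1]]) (simp add: K)
  have eq: "partial_deriv j (\<lambda>x. u x * v x * osc \<xi> x) x =
      (partial_deriv j u x * v x) * osc \<xi> x + ((u x * partial_deriv j v x) * osc \<xi> x
      - (\<i> * of_real (\<xi> $ j)) * ((u x * v x) * osc \<xi> x))" for x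
  proof (cases "x \<in> K")
    case True
    have du: "u differentiable (at x)" using smooth_on_differentiable[OF \<Omega>] True K by blast
    have dv: "v differentiable (at x)" using smooth_on_differentiable[OF open_UNIV v] by blast
    have "partial_deriv j (\<lambda>x. u x * v x * osc \<xi> x) x = partial_deriv j (\<lambda>x. u x * v x) x * osc \<xi> x
        + u x * v x * partial_deriv j (osc \<xi>) x"
      using smooth_on_differentiable[OF open_UNIV s1] smooth_on_differentiable[OF open_UNIV smooth_on_osc[OF open_UNIV]]
      by (intro partial_deriv_mult) auto
    thus ?thesis by (simp add: partial_deriv_mult[OF du dv] partial_deriv_osc algebra_simps)
  next
    case False
    have "partial_deriv j (\<lambda>x. u x * v x * osc \<xi> x) x = 0"
      using iter_deriv_outside[OF compact_imp_closed[OF K(1)] _ False, where js = "[j]" and f = "\<lambda>x. u x * v x * osc \<xi> x"] K(3)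
      by simp
    thus ?thesis using False by (simp add: K(3) pv0)
  qed
  have "0 = (LINT x|lborel. partial_deriv j (\<lambda>x. u x * v x * osc \<xi> x) x)"
    by (rule integral_partial_deriv_eq_0[OF s2 K(1), symmetric]) (simp add: K)
  also have "\<dots> = (LINT x|lborel. (partial_deriv j u x * v x) * osc \<xi> x) + ((LINT x|lborel. (u x * partial_deriv j v x) * osc \<xi> x)
      - (\<i> * of_real (\<xi> $ j)) * (LINT x|lborel. (u x * v x) * osc \<xi> x))"
    unfolding eq using i1 i2 i3 by simp
  finally have 0: "0 = (LINT x|lborel. (partial_deriv j u x * v x) * osc \<xi> x) + ((LINT x|lborel. (u x * partial_deriv j v x) * osc \<xi> x)
      - (\<i> * of_real (\<xi> $ j)) * (LINT x|lborel. (u x * v x) * osc \<xi> x))" .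
  have "a = d - b" if "0 = a + (b - d)" for a b d :: complex using that by (simp add: algebra_simps add_eq_0_iff)
  from this[OF 0] have "(LINT x|lborel. (partial_deriv j u x * v x) * osc \<xi> x) =
      (\<i> * of_real (\<xi> $ j)) * (LINT x|lborel. (u x * v x) * osc \<xi> x) - (LINT x|lborel. (u x * partial_deriv j v x) * osc \<xi> x)"
    .
  moreover have "(- \<i>) * a = x * c + \<i> * b" if "a = (\<i> * x) * c - b" for a b c x :: complex
    unfolding that by (simp add: complex_eq_iff algebra_simps)
  ultimately have *: "(- \<i>) * (LINT x|lborel. (partial_deriv j u x * v x) * osc \<xi> x) =
      of_real (\<xi> $ j) * (LINT x|lborel. (u x * v x) * osc \<xi> x) + \<i> * (LINT x|lborel. (u x * partial_deriv j v x) * osc \<xi> x)"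
    by blast
  have "fourier (\<lambda>x. u x * conj_deriv \<xi> [j] v x) \<xi> =
      (LINT x|lborel. of_real (\<xi> $ j) * ((u x * v x) * osc \<xi> x) + \<i> * ((u x * partial_deriv j v x) * osc \<xi> x))"
    unfolding fourier_osc by (intro arg_cong[where f = "integral\<^sup>L lborel"] ext) (simp add: algebra_simps)
  also have "\<dots> = of_real (\<xi> $ j) * (LINT x|lborel. (u x * v x) * osc \<xi> x) + \<i> * (LINT x|lborel. (u x * partial_deriv j v x) * osc \<xi> x)"
    using i2 i3 by simp
  also have "\<dots> = (LINT x|lborel. (- \<i>) * ((partial_deriv j u x * v x) * osc \<xi> x))"
    unfolding *[symmetric] by simp
  finally show ?thesis unfolding fourier_osc by (simp add: mult.assoc)
qed

lemma conj_deriv_append: "conj_deriv \<xi> (js @ ks) v = conj_deriv \<xi> js (conj_deriv \<xi> ks v)"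
  by (induction js) auto

lemma conj_deriv_outside:
  assumes "closed K" "\<And>x. x \<notin> K \<Longrightarrow> v x = 0" "x \<notin> K"
  shows "conj_deriv \<xi> js v x = 0"
  using assms(3)
proof (induction js arbitrary: x)
  case (Cons j js)
  thus ?case using iter_deriv_outside[OF assms(1) Cons.IH Cons.prems, where js = "[j]"] by simp
qed (use assms in auto)

text \<open>The derivative applied last is the first to be moved to the other factor, whence the reversal.\<close>

lemma fourier_iter_deriv:
  assumes \<Omega>: "open \<Omega>" "smooth_on \<Omega> u" and v: "smooth_on UNIV v"
    and K: "compact K" "K \<subseteq> \<Omega>" "\<And>x. x \<notin> K \<Longrightarrow> v x = 0"
  shows "fourier (\<lambda>x. (- \<i>) ^ length js * iter_deriv js u x * v x) \<xi> =
         fourier (\<lambda>x. u x * conj_deriv \<xi> (rev js) v x) \<xi>"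
  using v K(3)
proof (induction js arbitrary: v)
  case (Cons j js)
  have sm: "smooth_on \<Omega> (\<lambda>x. (- \<i>) ^ length js * iter_deriv js u x)"
    by (intro smooth_intros \<Omega>(1) smooth_on_iter[OF \<Omega>(2)])
  have d: "iter_deriv js u differentiable (at x)" if "x \<in> K" for x
    using smooth_on_differentiable[OF \<Omega>(1) smooth_on_iter[OF \<Omega>(2)]] that K(2) by blast
  have eq: "(- \<i>) ^ length (j # js) * iter_deriv (j # js) u x * v x =
      (- \<i>) * partial_deriv j (\<lambda>x. (- \<i>) ^ length js * iter_deriv js u x) x * v x" for x
    using partial_deriv_cmult[OF d, of x j "(- \<i>) ^ length js"] Cons.prems(2)[of x]
    by (cases "x \<in> K") auto
  have "fourier (\<lambda>x. (- \<i>) ^ length (j # js) * iter_deriv (j # js) u x * v x) \<xi> =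
     fourier (\<lambda>x. (- \<i>) ^ length js * iter_deriv js u x * conj_deriv \<xi> [j] v x) \<xi>"
    unfolding eq by (rule integral_by_parts_osc[OF \<Omega>(1) sm Cons.prems(1) K(1,2) Cons.prems(2)])
  also have "\<dots> = fourier (\<lambda>x. u x * conj_deriv \<xi> (rev js) (conj_deriv \<xi> [j] v) x) \<xi>"
    by (rule Cons.IH) (use Cons.prems in \<open>auto intro!: smooth_on_conj_deriv
      conj_deriv_outside[OF compact_imp_closed[OF K(1)]] simp del: conj_deriv.simps\<close>)
  finally show ?case by (simp add: conj_deriv_append del: conj_deriv.simps)
qed simp

lemma iter_deriv_sum:
  assumes "open T" "\<And>i. i \<in> I \<Longrightarrow> smooth_on T (f i)" "x \<in> T"
  shows "iter_deriv js (\<lambda>x. \<Sum>i\<in>I. f i x) x = (\<Sum>i\<in>I. iter_deriv js (f i) x)"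
  using assms(3)
proof (induction js arbitrary: x)
  case (Cons j js)
  have "iter_deriv (j # js) (\<lambda>x. \<Sum>i\<in>I. f i x) x = partial_deriv j (\<lambda>x. \<Sum>i\<in>I. iter_deriv js (f i) x) x"
    using Cons by (auto intro: partial_deriv_cong[OF assms(1)])
  also have "\<dots> = (\<Sum>i\<in>I. partial_deriv j (iter_deriv js (f i)) x)"
    by (rule partial_deriv_sum) (rule smooth_on_differentiable[OF assms(1) smooth_on_iter[OF assms(2)] Cons.prems])
  finally show ?case by simp
qed auto

lemma mi_deriv_sum:
  assumes "open T" "\<And>i. i \<in> I \<Longrightarrow> smooth_on T (f i)" "x \<in> T"
  shows "mi_deriv \<beta> (\<lambda>x. \<Sum>i\<in>I. f i x) x = (\<Sum>i\<in>I. mi_deriv \<beta> (f i) x)"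
  unfolding mi_deriv_def by (rule iter_deriv_sum[OF assms])

lemma mi_deriv_cmult:
  assumes "open T" "smooth_on T f" "x \<in> T"
  shows "mi_deriv \<beta> (\<lambda>x. c * f x) x = c * mi_deriv \<beta> f x"
  unfolding mi_deriv_def by (rule iter_deriv_cmult[OF assms])

text \<open>The conjugate \<open>e\<^bsup>ix\<xi>\<^esup> P\<^sup>t (e\<^bsup>-ix\<xi>\<^esup> w)\<close> of the formal transpose of \<open>P\<close>.\<close>

definition transposed ::
    "nat \<Rightarrow> (('n \<Rightarrow> nat) \<Rightarrow> real ^ 'n \<Rightarrow> complex) \<Rightarrow> real ^ 'n \<Rightarrow> (real ^ 'n \<Rightarrow> complex) \<Rightarrow> real ^ 'n \<Rightarrow> complex" where
  "transposed m c \<xi> w x =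
     (\<Sum>\<beta> | mi_order \<beta> \<le> m. \<i> ^ mi_order \<beta> * mi_deriv \<beta> (\<lambda>y. symbol_taylor m c \<xi> \<beta> y * w y) x)"

text \<open>The terms of \<^const>\<open>diff_op\<close> are integrated by parts one by one. After expansion by
  \<open>conj_deriv_eq\<close>, the coefficients that stand at a fixed \<open>\<partial>\<^sup>\<beta>\<close> add up to \<open>\<partial>\<^sub>\<xi>\<^sup>\<beta>P/\<beta>!\<close>.\<close>

theorem fourier_diff_op:
  fixes c :: "('n::finite \<Rightarrow> nat) \<Rightarrow> real ^ 'n \<Rightarrow> complex"
  assumes \<Omega>: "open \<Omega>" "smooth_on \<Omega> u" and c: "\<And>\<alpha>. mi_order \<alpha> \<le> m \<Longrightarrow> smooth_on \<Omega> (c \<alpha>)"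
    and w: "smooth_on UNIV w" and K: "compact K" "K \<subseteq> \<Omega>" "\<And>x. x \<notin> K \<Longrightarrow> w x = 0"
  shows "fourier (\<lambda>x. diff_op m c u x * w x) \<xi> = fourier (\<lambda>x. u x * transposed m c \<xi> w x) \<xi>"
proof -
  let ?I = "{\<alpha> :: 'n \<Rightarrow> nat. mi_order \<alpha> \<le> m}"
  define v where "v = (\<lambda>\<alpha> x. c \<alpha> x * w x)"
  have v: "smooth_on UNIV (v \<alpha>)" if "\<alpha> \<in> ?I" for \<alpha>
    unfolding v_def by (rule smooth_on_mult_extend[OF \<Omega>(1) c w K]) (use that in auto)
  have v0: "x \<notin> K \<Longrightarrow> v \<alpha> x = 0" for \<alpha> x by (simp add: v_def K)
  have Kc: "closed K" by (rule compact_imp_closed[OF K(1)])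
  define V where "V = (\<lambda>\<alpha> x. \<Sum>\<beta>\<in>?I. of_real (monomial_taylor \<xi> \<alpha> \<beta>) * (\<i> ^ mi_order \<beta> * mi_deriv \<beta> (v \<alpha>) x))"
  have Vs: "smooth_on UNIV (V \<alpha>)" if "\<alpha> \<in> ?I" for \<alpha>
    unfolding V_def by (intro smooth_intros open_UNIV smooth_on_mi_deriv v that)
  have V0: "x \<notin> K \<Longrightarrow> V \<alpha> x = 0" for \<alpha> x
    unfolding V_def by (simp add: mi_deriv_outside[OF Kc v0])
  have tm: "fourier (\<lambda>x. ((- \<i>) ^ mi_order \<alpha> * mi_deriv \<alpha> u x) * v \<alpha> x) \<xi> = fourier (\<lambda>x. u x * V \<alpha> x) \<xi>"
    if \<alpha>: "\<alpha> \<in> ?I" for \<alpha>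
  proof -
    obtain js where js: "length js = mi_order \<alpha>" "count_list js = \<alpha>" "mi_deriv \<alpha> u = iter_deriv js u"
      using mi_deriv_iter_list by metis
    have r: "count_list (rev js) = \<alpha>" using js(2) by (auto simp: fun_eq_iff)
    have "conj_deriv \<xi> (rev js) (v \<alpha>) x = V \<alpha> x" for x
      unfolding conj_deriv_eq[OF open_UNIV v[OF \<alpha>] UNIV_I] V_def
      by (rule sum.mono_neutral_cong_left) (use \<alpha> js r in \<open>auto simp: monomial_taylor_eq_0\<close>)
    thus ?thesis
      using fourier_iter_deriv[OF \<Omega> v[OF \<alpha>] K(1,2) v0, of js \<xi>] js by simp
  qed
  have int1: "integrable lborel (\<lambda>x. ((- \<i>) ^ mi_order \<alpha> * mi_deriv \<alpha> u x) * v \<alpha> x * osc \<xi> x)" if \<alpha>: "\<alpha> \<in> ?I" for \<alpha>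
  proof (rule fourier_integrable[OF K(1)])
    show "continuous_on UNIV (\<lambda>x. ((- \<i>) ^ mi_order \<alpha> * mi_deriv \<alpha> u x) * v \<alpha> x)"
      by (intro smooth_on_continuous smooth_on_mult_extend[OF \<Omega>(1) _ v[OF \<alpha>] K(1,2) v0]
          smooth_on_mult[OF \<Omega>(1) smooth_on_const[OF \<Omega>(1)] smooth_on_mi_deriv[OF \<Omega>(2)]])
  qed (simp add: v0)
  have int2: "integrable lborel (\<lambda>x. u x * V \<alpha> x * osc \<xi> x)" if \<alpha>: "\<alpha> \<in> ?I" for \<alpha>
    by (intro fourier_integrable[OF K(1)] smooth_on_continuous smooth_on_mult_extend[OF \<Omega> Vs[OF \<alpha>] K(1,2)])
       (simp_all add: V0)
  have "fourier (\<lambda>x. diff_op m c u x * w x) \<xi> =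
      (LINT x|lborel. (\<Sum>\<alpha>\<in>?I. ((- \<i>) ^ mi_order \<alpha> * mi_deriv \<alpha> u x) * v \<alpha> x * osc \<xi> x))"
    unfolding fourier_osc diff_op_def v_def
    by (intro arg_cong[where f = "integral\<^sup>L lborel"] ext) (simp add: sum_distrib_left sum_distrib_right mult_ac)
  also have "\<dots> = (\<Sum>\<alpha>\<in>?I. fourier (\<lambda>x. ((- \<i>) ^ mi_order \<alpha> * mi_deriv \<alpha> u x) * v \<alpha> x) \<xi>)"
    unfolding fourier_osc by (rule Bochner_Integration.integral_sum[OF int1])
  also have "\<dots> = (\<Sum>\<alpha>\<in>?I. fourier (\<lambda>x. u x * V \<alpha> x) \<xi>)"
    by (rule sum.cong) (use tm in auto)
  also have "\<dots> = (LINT x|lborel. (\<Sum>\<alpha>\<in>?I. u x * V \<alpha> x * osc \<xi> x))"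
    unfolding fourier_osc by (rule Bochner_Integration.integral_sum[OF int2, symmetric])
  also have "\<dots> = fourier (\<lambda>x. u x * transposed m c \<xi> w x) \<xi>"
    unfolding fourier_osc
  proof (intro arg_cong[where f = "integral\<^sup>L lborel"] ext)
    fix x
    have "(\<Sum>\<alpha>\<in>?I. V \<alpha> x) = (\<Sum>\<beta>\<in>?I. \<i> ^ mi_order \<beta> * (\<Sum>\<alpha>\<in>?I. of_real (monomial_taylor \<xi> \<alpha> \<beta>) * mi_deriv \<beta> (v \<alpha>) x))"
      unfolding V_def by (subst sum.swap) (simp add: sum_distrib_left mult_ac)
    also have "\<dots> = transposed m c \<xi> w x"
      unfolding transposed_def
    proof (intro sum.cong refl arg_cong2[where f = "(*)"])
      fix \<beta>
      have "(\<lambda>y. symbol_taylor m c \<xi> \<beta> y * w y) = (\<lambda>y. \<Sum>\<alpha>\<in>?I. of_real (monomial_taylor \<xi> \<alpha> \<beta>) * v \<alpha> y)"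
        by (simp add: symbol_taylor_def v_def sum_distrib_left sum_distrib_right mult_ac)
      moreover have "mi_deriv \<beta> (\<lambda>y. \<Sum>\<alpha>\<in>?I. of_real (monomial_taylor \<xi> \<alpha> \<beta>) * v \<alpha> y) x =
          (\<Sum>\<alpha>\<in>?I. mi_deriv \<beta> (\<lambda>y. of_real (monomial_taylor \<xi> \<alpha> \<beta>) * v \<alpha> y) x)"
        by (rule mi_deriv_sum[OF open_UNIV]) (auto intro!: smooth_on_mult smooth_on_const v)
      moreover have "\<dots> = (\<Sum>\<alpha>\<in>?I. of_real (monomial_taylor \<xi> \<alpha> \<beta>) * mi_deriv \<beta> (v \<alpha>) x)"
        by (intro sum.cong refl mi_deriv_cmult[OF open_UNIV v]) auto
      ultimately show "(\<Sum>\<alpha>\<in>?I. of_real (monomial_taylor \<xi> \<alpha> \<beta>) * mi_deriv \<beta> (v \<alpha>) x) =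
          mi_deriv \<beta> (\<lambda>y. symbol_taylor m c \<xi> \<beta> y * w y) x" by simp
    qed
    finally show "(\<Sum>\<alpha>\<in>?I. u x * V \<alpha> x * osc \<xi> x) = u x * transposed m c \<xi> w x * osc \<xi> x"
      by (simp only: sum_distrib_left[symmetric] sum_distrib_right[symmetric])
  qed
  finally show ?thesis .
qed

subsection \<open>Decay for smooth functions with compact support\<close>

lemma norm_fourier_le:
  assumes K: "compact K" "\<And>x. x \<notin> K \<Longrightarrow> v x = 0" and v: "continuous_on UNIV v" "\<And>x. norm (v x) \<le> A"
  shows "norm (fourier v \<xi>) \<le> measure lborel K * A"
proof -
  have e: "emeasure lborel K < \<infinity>" by (rule emeasure_bounded_finite[OF compact_imp_bounded[OF K(1)]])
  have "norm (fourier v \<xi>) \<le> (LINT x|lborel. norm (v x * osc \<xi> x))"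
    unfolding fourier_osc by (rule integral_norm_bound)
  also have "\<dots> \<le> (LINT x|lborel. indicator K x * A)"
  proof (rule integral_mono)
    show "integrable lborel (\<lambda>x. norm (v x * osc \<xi> x))"
      by (intro integrable_norm fourier_integrable[OF K(1) v(1) K(2)])
    show "integrable lborel (\<lambda>x. indicator K x * A)"
      using e K(1) by (auto intro!: integrable_mult_left simp: integrable_indicator_iff borel_compact)
    show "norm (v x * osc \<xi> x) \<le> indicator K x * A" for x
      using K(2)[of x] v(2)[of x] by (auto simp: indicator_def norm_mult)
  qed
  also have "\<dots> = measure lborel K * A" using K(1) by (simp add: borel_compact)
  finally show ?thesis .
qed

lemma fourier_iter_same:
  assumes v: "smooth_on UNIV v" and K: "compact K" "\<And>x. x \<notin> K \<Longrightarrow> v x = 0"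
  shows "fourier (iter_deriv (replicate L j) v) \<xi> = (\<i> * of_real (\<xi> $ j)) ^ L * fourier v \<xi>"
proof (induction L)
  case (Suc L)
  define g where "g = iter_deriv (replicate L j) v"
  have g: "smooth_on UNIV g" unfolding g_def by (rule smooth_on_iter[OF v])
  have g0: "x \<notin> K \<Longrightarrow> g x = 0" for x
    unfolding g_def by (rule iter_deriv_outside[OF compact_imp_closed[OF K(1)] K(2)])
  have pg: "smooth_on UNIV (partial_deriv j g)" by (rule smooth_on_partial[OF g])
  have pg0: "x \<notin> K \<Longrightarrow> partial_deriv j g x = 0" for x
    using iter_deriv_outside[OF compact_imp_closed[OF K(1)] g0, where js = "[j]"] by simp
  have i1: "integrable lborel (\<lambda>x. partial_deriv j g x * osc \<xi> x)"
    by (rule fourier_integrable[OF K(1) smooth_on_continuous[OF pg] pg0])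
  have i2: "integrable lborel (\<lambda>x. g x * osc \<xi> x)"
    by (rule fourier_integrable[OF K(1) smooth_on_continuous[OF g] g0])
  have "partial_deriv j (\<lambda>x. g x * osc \<xi> x) x = partial_deriv j g x * osc \<xi> x - (\<i> * of_real (\<xi> $ j)) * (g x * osc \<xi> x)" for x
    using partial_deriv_mult[OF smooth_on_differentiable[OF open_UNIV g UNIV_I]
       smooth_on_differentiable[OF open_UNIV smooth_on_osc[OF open_UNIV] UNIV_I], of j]
    by (simp add: partial_deriv_osc)
  moreover have "(LINT x|lborel. partial_deriv j (\<lambda>x. g x * osc \<xi> x) x) = 0"
    by (rule integral_partial_deriv_eq_0[OF _ K(1)]) (auto intro!: smooth_intros g simp: g0)
  ultimately have "0 = (LINT x|lborel. partial_deriv j g x * osc \<xi> x - (\<i> * of_real (\<xi> $ j)) * (g x * osc \<xi> x))"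
    by simp
  also have "\<dots> = fourier (partial_deriv j g) \<xi> - (\<i> * of_real (\<xi> $ j)) * fourier g \<xi>"
    unfolding fourier_osc using i1 i2 by simp
  finally show ?case using Suc.IH by (simp add: g_def)
qed simp

text \<open>Derivatives in a single direction suffice: some coordinate of \<open>\<xi>\<close> is at least \<open>\<bar>\<xi>\<bar>/n\<close>.\<close>

lemma fourier_decay:
  fixes w :: "real ^ 'n \<Rightarrow> complex"
  assumes w: "smooth_on UNIV w" and K: "compact K" "\<And>x. x \<notin> K \<Longrightarrow> w x = 0" and A: "deriv_bound UNIV L A w"
  shows "norm (fourier w \<xi>) * (1 + norm \<xi>) ^ L \<le> (real CARD('n) + 1) ^ L * (measure lborel K * A)"
proof -
  have b: "norm (fourier (iter_deriv js w) \<xi>) \<le> measure lborel K * A" if "length js \<le> L" for js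
    using deriv_boundD[OF A that] iter_deriv_outside[OF compact_imp_closed[OF K(1)] K(2)]
    by (intro norm_fourier_le K(1) smooth_on_continuous smooth_on_iter w) auto
  have A0: "0 \<le> measure lborel K * A"
    using b[of "[]"] norm_ge_zero order_trans by (metis le0 list.size(3))
  define M where "M = Max (range (\<lambda>j. \<bar>\<xi> $ j\<bar>))"
  have M: "\<bar>\<xi> $ j\<bar> \<le> M" for j unfolding M_def by (rule Max_ge) auto
  have "M \<in> range (\<lambda>j. \<bar>\<xi> $ j\<bar>)" unfolding M_def by (rule Max_in) auto
  then obtain j where j: "M = \<bar>\<xi> $ j\<bar>" by blast
  have "norm \<xi> \<le> (\<Sum>i\<in>UNIV. \<bar>\<xi> $ i\<bar>)" by (rule norm_le_l1_cart)
  also have "\<dots> \<le> real CARD('n) * M" using sum_bounded_above[of UNIV "\<lambda>i. \<bar>\<xi> $ i\<bar>" M] M by simp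
  finally have n: "norm \<xi> \<le> real CARD('n) * M" .
  show ?thesis
  proof (cases "M \<le> 1")
    case True
    have "real CARD('n) * M \<le> real CARD('n) * 1" by (intro mult_left_mono True) auto
    hence "1 + norm \<xi> \<le> real CARD('n) + 1" using n by linarith
    hence "(1 + norm \<xi>) ^ L \<le> (real CARD('n) + 1) ^ L" by (intro power_mono) (auto simp: add_nonneg_nonneg)
    hence "norm (fourier w \<xi>) * (1 + norm \<xi>) ^ L \<le> (measure lborel K * A) * (real CARD('n) + 1) ^ L"
      using b[of "[]"] A0 by (intro mult_mono) auto
    thus ?thesis by (simp add: mult.commute)
  next
    case False
    hence "1 + norm \<xi> \<le> (real CARD('n) + 1) * M" using n by (simp add: algebra_simps)
    hence "(1 + norm \<xi>) ^ L \<le> ((real CARD('n) + 1) * M) ^ L" by (intro power_mono) (auto simp: add_nonneg_nonneg)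
    hence "norm (fourier w \<xi>) * (1 + norm \<xi>) ^ L \<le> norm (fourier w \<xi>) * ((real CARD('n) + 1) * M) ^ L"
      by (intro mult_left_mono) auto
    also have "\<dots> = (real CARD('n) + 1) ^ L * norm ((\<i> * of_real (\<xi> $ j)) ^ L * fourier w \<xi>)"
      by (simp add: j norm_mult norm_power power_mult_distrib)
    also have "\<dots> \<le> (real CARD('n) + 1) ^ L * (measure lborel K * A)"
      using b[of "replicate L j"] fourier_iter_same[OF w K, of L j \<xi>] by (intro mult_left_mono) auto
    finally show ?thesis .
  qed
qed

section \<open>Fourier inversion\<close>

text \<open>Lebesgue measure is the product of its one-dimensional versions along the basis.\<close>

lemma lborel_Basis_prod:
  fixes f :: "'a::euclidean_space \<Rightarrow> real \<Rightarrow> 'b::{real_normed_field,banach,second_countable_topology}"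
  assumes f: "\<And>b. b \<in> Basis \<Longrightarrow> integrable lborel (f b)"
  shows "integrable lborel (\<lambda>x::'a. \<Prod>b\<in>Basis. f b (x \<bullet> b))"
    and "(LINT x|lborel. (\<Prod>b\<in>Basis. f b ((x::'a) \<bullet> b))) = (\<Prod>b\<in>Basis. integral\<^sup>L lborel (f b))"
proof -
  interpret product_sigma_finite "\<lambda>_::'a. lborel :: real measure" ..
  define T where "T = (\<lambda>g::'a \<Rightarrow> real. \<Sum>b\<in>Basis. g b *\<^sub>R b)"
  have T: "T \<in> (\<Pi>\<^sub>M b\<in>Basis. lborel) \<rightarrow>\<^sub>M borel" unfolding T_def by measurable
  have fm: "f b \<in> borel_measurable borel" if "b \<in> Basis" for b
    using f[OF that] by (auto dest: borel_measurable_integrable)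
  have m: "(\<lambda>x::'a. \<Prod>b\<in>Basis. f b (x \<bullet> b)) \<in> borel_measurable borel"
    using fm by measurable
  have T_inner: "T g \<bullet> b = g b" if "b \<in> Basis" for g b
    unfolding T_def using that by (simp add: inner_sum_left inner_Basis if_distrib sum.delta cong: if_cong)
  have e: "(\<Prod>b\<in>Basis. f b (T g \<bullet> b)) = (\<Prod>b\<in>Basis. f b (g b))" for g
    by (intro prod.cong refl) (simp add: T_inner)
  have l: "(lborel :: 'a measure) = distr (\<Pi>\<^sub>M b\<in>Basis. lborel) borel T"
    unfolding T_def by (rule lborel_eq)
  show "integrable lborel (\<lambda>x::'a. \<Prod>b\<in>Basis. f b (x \<bullet> b))"
    unfolding l integrable_distr_eq[OF T m] e by (rule product_integrable_prod) (use f in auto)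
  show "(LINT x|lborel. (\<Prod>b\<in>Basis. f b ((x::'a) \<bullet> b))) = (\<Prod>b\<in>Basis. integral\<^sup>L lborel (f b))"
    unfolding l integral_distr[OF T m] e by (rule product_integral_prod) (use f in auto)
qed

text \<open>The exponent makes each of the \<open>n\<close> coordinates contribute an integrable factor
  \<open>1/(1 + t\<^sup>2)\<close>.\<close>

lemma integrable_one_plus_norm_power:
  "integrable lborel (\<lambda>x::'a::euclidean_space. inverse ((1 + norm x) ^ (2 * DIM('a))))"
proof (rule Bochner_Integration.integrable_bound)
  have "integrable lborel (\<lambda>t::real. inverse (1 + t\<^sup>2))"
    using integrable_inverse_1_plus_square by (simp add: set_integrable_def einterval_eq_UNIV)
  thus "integrable lborel (\<lambda>x::'a. \<Prod>b\<in>Basis. inverse (1 + (x \<bullet> b)\<^sup>2))"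
    by (rule lborel_Basis_prod(1))
  show "AE x::'a in lborel. norm (inverse ((1 + norm x) ^ (2 * DIM('a)))) \<le> norm (\<Prod>b\<in>Basis. inverse (1 + (x \<bullet> b)\<^sup>2))"
  proof (rule AE_I2)
    fix x :: 'a
    have "1 + (x \<bullet> b)\<^sup>2 \<le> (1 + norm x)\<^sup>2" if "b \<in> Basis" for b
    proof -
      have "(x \<bullet> b)\<^sup>2 \<le> (norm x)\<^sup>2" using Basis_le_norm[OF that, of x] by (simp add: abs_le_square_iff[symmetric])
      also have "(norm x)\<^sup>2 + 1 \<le> (1 + norm x)\<^sup>2" by (simp add: power2_eq_square algebra_simps)
      finally show ?thesis by simp
    qed
    hence "(\<Prod>b\<in>(Basis :: 'a set). 1 + (x \<bullet> b)\<^sup>2) \<le> (\<Prod>b\<in>(Basis :: 'a set). (1 + norm x)\<^sup>2)"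
      by (intro prod_mono) auto
    also have "\<dots> = (1 + norm x) ^ (2 * DIM('a))" by (simp add: power_mult)
    finally have le: "(\<Prod>b\<in>(Basis :: 'a set). 1 + (x \<bullet> b)\<^sup>2) \<le> (1 + norm x) ^ (2 * DIM('a))" .
    have pos: "0 < (\<Prod>b\<in>(Basis :: 'a set). 1 + (x \<bullet> b)\<^sup>2)"
      by (intro prod_pos) (auto simp: add_pos_nonneg)
    have "inverse ((1 + norm x) ^ (2 * DIM('a))) \<le> inverse (\<Prod>b\<in>(Basis :: 'a set). 1 + (x \<bullet> b)\<^sup>2)"
      by (rule le_imp_inverse_le[OF le pos])
    thus "norm (inverse ((1 + norm x) ^ (2 * DIM('a)))) \<le> norm (\<Prod>b\<in>Basis. inverse (1 + (x \<bullet> b)\<^sup>2))"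
      using pos prod_inversef[of "\<lambda>b. 1 + (x \<bullet> b)\<^sup>2" "Basis :: 'a set"] by (simp add: comp_def abs_of_pos)
  qed
qed auto

definition gaussian :: "'a::euclidean_space \<Rightarrow> complex" where
  "gaussian x = of_real (exp (- (norm x)\<^sup>2 / 2))"

lemma gaussian_prod: "gaussian x = (\<Prod>b\<in>Basis. of_real (exp (- (x \<bullet> b)\<^sup>2 / 2)))"
proof -
  have "(norm x)\<^sup>2 = (\<Sum>b\<in>Basis. (x \<bullet> b)\<^sup>2)"
    unfolding power2_norm_eq_inner by (subst euclidean_inner) (simp add: power2_eq_square)
  hence "exp (- (norm x)\<^sup>2 / 2) = (\<Prod>b\<in>Basis. exp (- (x \<bullet> b)\<^sup>2 / 2))"
    by (simp add: exp_sum[symmetric] sum_negf sum_divide_distrib)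
  thus ?thesis by (simp add: gaussian_def)
qed

text \<open>This is the characteristic function of the standard normal distribution.\<close>

lemma gaussian_1d:
  "integrable lborel (\<lambda>t::real. of_real (exp (- t\<^sup>2 / 2)) * exp (\<i> * of_real (t * s)))"
  "(LINT t|lborel. of_real (exp (- t\<^sup>2 / 2)) * exp (\<i> * of_real (t * s))) = of_real (sqrt (2 * pi) * exp (- s\<^sup>2 / 2))"
proof -
  have eq: "of_real (exp (- t\<^sup>2 / 2)) * exp (\<i> * of_real (t * s)) =
      of_real (sqrt (2 * pi)) * (std_normal_density t *\<^sub>R exp (\<i> * of_real (s * t)))" for t
    by (simp add: std_normal_density_def scaleR_conv_of_real mult.commute)
  have m: "(\<lambda>x. exp (\<i> * of_real (s * x))) \<in> borel_measurable borel"
    by (intro borel_measurable_continuous_onI continuous_intros)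
  have "integrable lborel (\<lambda>t. std_normal_density t *\<^sub>R exp (\<i> * of_real (s * t)))"
    by (rule Bochner_Integration.integrable_bound[OF integrable_normal_density[of 1 0]])
       (use m in \<open>auto simp: norm_exp_eq_Re\<close>)
  thus "integrable lborel (\<lambda>t::real. of_real (exp (- t\<^sup>2 / 2)) * exp (\<i> * of_real (t * s)))"
    unfolding eq by (rule integrable_mult_right)
  have "(LINT t|lborel. std_normal_density t *\<^sub>R exp (\<i> * of_real (s * t))) = char std_normal_distribution s"
    unfolding char_def using m by (subst integral_density) auto
  thus "(LINT t|lborel. of_real (exp (- t\<^sup>2 / 2)) * exp (\<i> * of_real (t * s))) = of_real (sqrt (2 * pi) * exp (- s\<^sup>2 / 2))"
    unfolding eq integral_mult_right_zero by (simp add: char_std_normal_distribution)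
qed

lemma gaussian_fourier:
  fixes z :: "'a::euclidean_space"
  shows "integrable lborel (\<lambda>x::'a. gaussian x * exp (\<i> * of_real (x \<bullet> z)))"
    and "(LINT x|lborel. gaussian x * exp (\<i> * of_real (x \<bullet> z))) = of_real (sqrt (2 * pi) ^ DIM('a)) * gaussian z"
proof -
  have eq: "gaussian x * exp (\<i> * of_real (x \<bullet> z)) =
     (\<Prod>b\<in>Basis. of_real (exp (- (x \<bullet> b)\<^sup>2 / 2)) * exp (\<i> * of_real ((x \<bullet> b) * (z \<bullet> b))))" for x :: 'a
  proof -
    have "exp (\<i> * complex_of_real (x \<bullet> z)) = (\<Prod>b\<in>Basis. exp (\<i> * of_real ((x \<bullet> b) * (z \<bullet> b))))"
      by (subst euclidean_inner) (simp add: exp_sum[symmetric] sum_distrib_left)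
    thus ?thesis by (simp add: gaussian_prod prod.distrib)
  qed
  show "integrable lborel (\<lambda>x::'a. gaussian x * exp (\<i> * of_real (x \<bullet> z)))"
    unfolding eq by (rule lborel_Basis_prod(1)) (rule gaussian_1d)
  have "(LINT x|lborel. gaussian x * exp (\<i> * of_real (x \<bullet> z))) =
      (\<Prod>b\<in>(Basis::'a set). of_real (sqrt (2 * pi) * exp (- (z \<bullet> b)\<^sup>2 / 2)))"
    unfolding eq by (subst lborel_Basis_prod(2)) (rule gaussian_1d, simp only: gaussian_1d(2))
  also have "\<dots> = of_real (sqrt (2 * pi) ^ DIM('a)) * gaussian z"
    unfolding gaussian_prod by (simp add: prod.distrib)
  finally show "(LINT x|lborel. gaussian x * exp (\<i> * of_real (x \<bullet> z))) = of_real (sqrt (2 * pi) ^ DIM('a)) * gaussian z" .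
qed

lemma integrable_gaussian: "integrable lborel (gaussian :: 'a::euclidean_space \<Rightarrow> complex)"
  using gaussian_fourier(1)[of 0] by simp

lemma integral_gaussian:
  "(LINT x|lborel. gaussian (x :: 'a::euclidean_space)) = of_real (sqrt (2 * pi) ^ DIM('a))"
  using gaussian_fourier(2)[of "0::'a"] by (simp add: gaussian_def)

lemma lborel_integral_affine:
  fixes f :: "'a::euclidean_space \<Rightarrow> complex"
  assumes f: "f \<in> borel_measurable borel" and c: "c > 0"
  shows "(LINT x|lborel. f x) = of_real (c ^ DIM('a)) * (LINT z|lborel. f (t + c *\<^sub>R z))"
proof -
  have "(LINT x|lborel. f x) = (LINT x|density (distr lborel borel (\<lambda>x. t + c *\<^sub>R x)) (\<lambda>_. ennreal (\<bar>c\<bar> ^ DIM('a))). f x)"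
    using c by (subst lborel_affine[of c t]) (auto simp: ennreal_power)
  also have "\<dots> = (LINT x|distr lborel borel (\<lambda>x. t + c *\<^sub>R x). (\<bar>c\<bar> ^ DIM('a)) *\<^sub>R f x)"
    using f by (intro integral_density) auto
  also have "\<dots> = (LINT z|lborel. (\<bar>c\<bar> ^ DIM('a)) *\<^sub>R f (t + c *\<^sub>R z))"
    using f by (intro integral_distr) auto
  also have "\<dots> = of_real (c ^ DIM('a)) * (LINT z|lborel. f (t + c *\<^sub>R z))"
    using c by (simp add: scaleR_conv_of_real)
  finally show ?thesis .
qed

lemma integrable_pair_mult:
  fixes f g :: "'a::euclidean_space \<Rightarrow> complex"
  assumes f: "integrable lborel f" and g: "integrable lborel g"
    and h: "case_prod h \<in> borel_measurable (lborel \<Otimes>\<^sub>M lborel)" "\<And>x y. norm (h x y) \<le> 1"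
  shows "integrable (lborel \<Otimes>\<^sub>M lborel) (\<lambda>(x, y). f x * g y * h x y)"
proof (rule Bochner_Integration.integrable_bound)
  have fm: "f \<in> borel_measurable lborel" "g \<in> borel_measurable lborel"
    using f g by (auto dest: borel_measurable_integrable)
  show "(\<lambda>(x, y). f x * g y * h x y) \<in> borel_measurable (lborel \<Otimes>\<^sub>M lborel)"
    using fm h(1) by measurable
  show "integrable (lborel \<Otimes>\<^sub>M lborel) (\<lambda>(x, y). norm (f x) * norm (g y))"
  proof (rule lborel_pair.Fubini_integrable)
    show "(\<lambda>(x, y). norm (f x) * norm (g y)) \<in> borel_measurable (lborel \<Otimes>\<^sub>M lborel)"
      using fm by measurable
    show "integrable lborel (\<lambda>x. LINT y|lborel. norm (case (x, y) of (x, y) \<Rightarrow> norm (f x) * norm (g y)))"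
      using f g by (simp add: abs_mult)
    show "AE x in lborel. integrable lborel (\<lambda>y. case (x, y) of (x, y) \<Rightarrow> norm (f x) * norm (g y))"
      using g by simp
  qed
  show "AE x in lborel \<Otimes>\<^sub>M lborel. norm (case x of (x, y) \<Rightarrow> f x * g y * h x y) \<le>
      norm (case x of (x, y) \<Rightarrow> norm (f x) * norm (g y))"
    using h(2) by (intro AE_I2) (auto simp: norm_mult intro!: mult_right_le_one_le)
qed

lemma osc_borel_measurable: "(\<lambda>(x, y). osc x (y :: real ^ 'n)) \<in> borel_measurable (lborel \<Otimes>\<^sub>M lborel)"
proof -
  have "(\<lambda>z::(real ^ 'n) \<times> (real ^ 'n). osc (fst z) (snd z)) \<in> borel_measurable borel"
    unfolding osc_def by (intro borel_measurable_continuous_onI continuous_intros)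
  thus ?thesis by (simp add: case_prod_unfold lborel_prod)
qed

lemma fourier_measurable:
  fixes v :: "real ^ 'n \<Rightarrow> complex"
  assumes "v \<in> borel_measurable borel"
  shows "fourier v \<in> borel_measurable borel"
proof -
  have "(\<lambda>(\<xi>, x). v x * osc \<xi> x) \<in> borel_measurable (lborel \<Otimes>\<^sub>M lborel)"
  proof -
    have "(\<lambda>z. v (snd z)) \<in> borel_measurable (lborel \<Otimes>\<^sub>M (lborel :: (real ^ 'n) measure))"
      using assms by measurable
    from borel_measurable_times[OF this osc_borel_measurable] show ?thesis by (simp add: case_prod_unfold)
  qed
  hence "(\<lambda>\<xi>. LINT x|lborel. v x * osc \<xi> x) \<in> borel_measurable lborel"
    by (rule lborel.borel_measurable_lebesgue_integral)
  thus ?thesis by (simp add: fourier_osc[abs_def])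
qed

lemma integrable_fourier:
  fixes w :: "real ^ 'n \<Rightarrow> complex"
  assumes w: "smooth_on UNIV w" and K: "compact K" "\<And>x. x \<notin> K \<Longrightarrow> w x = 0"
  shows "integrable lborel (fourier w)"
proof -
  let ?L = "2 * CARD('n)"
  obtain A where A: "deriv_bound K ?L A w" "A > 0"
    using deriv_bound_compact[OF open_UNIV K(1) _ w] by blast
  have A': "deriv_bound UNIV ?L A w"
    by (rule deriv_bound_extend[OF compact_imp_closed[OF K(1)] K(2) A(1)]) (use A in auto)
  define C where "C = (real CARD('n) + 1) ^ ?L * (measure lborel K * A)"
  have C: "C \<ge> 0" using A by (auto simp: C_def)
  have "norm (fourier w \<xi>) \<le> C * inverse ((1 + norm \<xi>) ^ ?L)" for \<xi>
  proof -
    have "(1 + norm \<xi>) ^ ?L > 0" by (intro zero_less_power) (simp add: add_pos_nonneg)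
    thus ?thesis using fourier_decay[OF w K A', of \<xi>] by (simp add: C_def field_simps)
  qed
  hence b: "norm (fourier w \<xi>) \<le> norm (C * inverse ((1 + norm \<xi>) ^ ?L))" for \<xi>
    unfolding real_norm_def using order_trans[OF _ abs_ge_self] by blast
  have "integrable lborel (\<lambda>x::real^'n. C * inverse ((1 + norm x) ^ ?L))"
    using integrable_one_plus_norm_power[where 'a = "real ^ 'n"] by simp
  thus ?thesis
    by (rule Bochner_Integration.integrable_bound)
       (use b fourier_measurable[OF borel_measurable_continuous_onI[OF smooth_on_continuous[OF w]]] in auto)
qed

text \<open>Fubini moves the \<open>\<eta>\<close>-integral onto the Gaussian, whose transform is known; the substitution
  \<open>y = x + \<delta>z\<close> then cancels the powers of \<open>\<delta>\<close>.\<close>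

lemma regularized_inversion:
  fixes w :: "real ^ 'n \<Rightarrow> complex"
  assumes w: "smooth_on UNIV w" and K: "compact K" "\<And>x. x \<notin> K \<Longrightarrow> w x = 0" and \<delta>: "\<delta> > 0"
  shows "(LINT \<eta>|lborel. gaussian (\<delta> *\<^sub>R \<eta>) * fourier w \<eta> * osc (- \<eta>) x) =
         of_real (sqrt (2 * pi) ^ CARD('n)) * (LINT z|lborel. w (x + \<delta> *\<^sub>R z) * gaussian z)"
proof -
  have wc: "continuous_on UNIV w" by (rule smooth_on_continuous[OF w])
  have wm: "w \<in> borel_measurable borel" using wc by (rule borel_measurable_continuous_onI)
  have wi: "integrable lborel w" by (rule integrable_compact_support[OF K(1) wc K(2)])
  have gc: "continuous_on UNIV (gaussian :: real ^ 'n \<Rightarrow> complex)"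
    unfolding gaussian_def by (intro continuous_intros) auto
  have gm: "(gaussian :: real ^ 'n \<Rightarrow> complex) \<in> borel_measurable borel"
    using gc by (rule borel_measurable_continuous_onI)
  have gdm: "(\<lambda>\<eta>::real ^ 'n. gaussian (\<delta> *\<^sub>R \<eta>)) \<in> borel_measurable borel"
    by (intro borel_measurable_continuous_onI continuous_on_compose2[OF gc]) (auto intro!: continuous_intros)
  have gdi: "integrable lborel (\<lambda>\<eta>::real ^ 'n. gaussian (\<delta> *\<^sub>R \<eta>))"
  proof (rule ccontr)
    define N where "N = (LINT \<eta>|lborel. gaussian (\<delta> *\<^sub>R (\<eta>::real^'n)))"
    assume "\<not> ?thesis"
    hence "N = 0" unfolding N_def by (rule not_integrable_integral_eq)
    moreover have "of_real (\<delta> ^ CARD('n)) * N = (LINT x|lborel. gaussian (x :: real ^ 'n))"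
      unfolding N_def using lborel_integral_affine[OF gm \<delta>, of 0] by simp
    ultimately show False using integral_gaussian[where 'a = "real ^ 'n"] by simp
  qed
  have inner: "(LINT \<eta>|lborel. gaussian (\<delta> *\<^sub>R \<eta>) * osc \<eta> (y - x)) =
      of_real (inverse \<delta> ^ CARD('n)) * (of_real (sqrt (2 * pi) ^ CARD('n)) * gaussian ((x - y) /\<^sub>R \<delta>))" for y
  proof -
    have m: "(\<lambda>\<eta>::real^'n. gaussian (\<delta> *\<^sub>R \<eta>) * osc \<eta> (y - x)) \<in> borel_measurable borel"
      unfolding osc_def by (intro borel_measurable_times gdm borel_measurable_continuous_onI continuous_intros)
    have e: "gaussian (\<delta> *\<^sub>R (0 + inverse \<delta> *\<^sub>R \<eta>)) * osc (0 + inverse \<delta> *\<^sub>R \<eta>) (y - x) =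
        gaussian \<eta> * exp (\<i> * of_real (\<eta> \<bullet> ((x - y) /\<^sub>R \<delta>)))" for \<eta> :: "real ^ 'n"
      using \<delta> by (simp add: osc_def inner_diff_right algebra_simps)
    show ?thesis
      using lborel_integral_affine[OF m, of "inverse \<delta>" 0] \<delta> gaussian_fourier(2)[of "(x - y) /\<^sub>R \<delta>"]
      unfolding e by simp
  qed
  define H where "H = (\<lambda>(\<eta>::real^'n) y. osc \<eta> (y - x))"
  have Hm: "case_prod H \<in> borel_measurable (lborel \<Otimes>\<^sub>M lborel)"
  proof -
    have "(\<lambda>z::(real ^ 'n) \<times> (real ^ 'n). osc (fst z) (snd z - x)) \<in> borel_measurable borel"
      unfolding osc_def by (intro borel_measurable_continuous_onI continuous_intros)
    thus ?thesis by (simp add: H_def case_prod_beta' lborel_prod)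
  qed
  have int: "integrable (lborel \<Otimes>\<^sub>M lborel) (\<lambda>(\<eta>, y). gaussian (\<delta> *\<^sub>R \<eta>) * w y * H \<eta> y)"
    by (rule integrable_pair_mult[OF gdi wi Hm]) (simp add: H_def)
  have osc_split: "osc \<eta> y * osc (- \<eta>) x = H \<eta> y" for \<eta> y
    by (simp add: H_def osc_def exp_add[symmetric] inner_diff_right algebra_simps)
  have "(LINT \<eta>|lborel. gaussian (\<delta> *\<^sub>R \<eta>) * fourier w \<eta> * osc (- \<eta>) x) =
      (LINT \<eta>|lborel. LINT y|lborel. gaussian (\<delta> *\<^sub>R \<eta>) * w y * H \<eta> y)"
  proof (intro arg_cong[where f = "integral\<^sup>L lborel"] ext)
    fix \<eta> :: "real ^ 'n"
    have "(LINT y|lborel. gaussian (\<delta> *\<^sub>R \<eta>) * w y * H \<eta> y) = (LINT y|lborel. (gaussian (\<delta> *\<^sub>R \<eta>) * osc (- \<eta>) x) * (w y * osc \<eta> y))"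
      by (intro arg_cong[where f = "integral\<^sup>L lborel"] ext) (simp add: osc_split[symmetric])
    also have "\<dots> = (gaussian (\<delta> *\<^sub>R \<eta>) * osc (- \<eta>) x) * fourier w \<eta>"
      unfolding fourier_osc by (rule integral_mult_right_zero)
    finally show "gaussian (\<delta> *\<^sub>R \<eta>) * fourier w \<eta> * osc (- \<eta>) x = (LINT y|lborel. gaussian (\<delta> *\<^sub>R \<eta>) * w y * H \<eta> y)"
      by simp
  qed
  also have "\<dots> = (LINT y|lborel. LINT \<eta>|lborel. gaussian (\<delta> *\<^sub>R \<eta>) * w y * H \<eta> y)"
    by (rule lborel_pair.Fubini_integral[OF int, symmetric])
  also have "\<dots> = (LINT y|lborel. w y * (of_real (inverse \<delta> ^ CARD('n)) * (of_real (sqrt (2 * pi) ^ CARD('n)) * gaussian ((x - y) /\<^sub>R \<delta>))))"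
  proof (intro arg_cong[where f = "integral\<^sup>L lborel"] ext)
    fix y :: "real ^ 'n"
    have "(LINT \<eta>|lborel. gaussian (\<delta> *\<^sub>R \<eta>) * w y * H \<eta> y) = (LINT \<eta>|lborel. w y * (gaussian (\<delta> *\<^sub>R \<eta>) * osc \<eta> (y - x)))"
      by (simp add: H_def mult_ac)
    thus "(LINT \<eta>|lborel. gaussian (\<delta> *\<^sub>R \<eta>) * w y * H \<eta> y) =
      w y * (of_real (inverse \<delta> ^ CARD('n)) * (of_real (sqrt (2 * pi) ^ CARD('n)) * gaussian ((x - y) /\<^sub>R \<delta>)))"
      by (simp only: integral_mult_right_zero inner)
  qed
  also have "\<dots> = of_real (sqrt (2 * pi) ^ CARD('n)) * (LINT z|lborel. w (x + \<delta> *\<^sub>R z) * gaussian z)"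
  proof -
    define F where "F = (\<lambda>y. w y * (of_real (inverse \<delta> ^ CARD('n)) * (of_real (sqrt (2 * pi) ^ CARD('n)) * gaussian ((x - y) /\<^sub>R \<delta>))))"
    have Fm: "F \<in> borel_measurable borel"
      unfolding F_def by (intro borel_measurable_continuous_onI continuous_intros wc continuous_on_compose2[OF gc]) auto
    have g: "gaussian ((x - (x + \<delta> *\<^sub>R z)) /\<^sub>R \<delta>) = gaussian z" for z
      using \<delta> by (simp add: gaussian_def)
    have "F (x + \<delta> *\<^sub>R z) = of_real (inverse \<delta> ^ CARD('n) * sqrt (2 * pi) ^ CARD('n)) * (w (x + \<delta> *\<^sub>R z) * gaussian z)" for z
      unfolding F_def g by simp
    hence "(LINT y|lborel. F y) = of_real (\<delta> ^ CARD('n)) *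
        (of_real (inverse \<delta> ^ CARD('n) * sqrt (2 * pi) ^ CARD('n)) * (LINT z|lborel. w (x + \<delta> *\<^sub>R z) * gaussian z))"
      using lborel_integral_affine[OF Fm \<delta>, of x] by simp
    also have "\<dots> = of_real (sqrt (2 * pi) ^ CARD('n)) * (LINT z|lborel. w (x + \<delta> *\<^sub>R z) * gaussian z)"
      using \<delta> by (simp add: power_inverse[symmetric] field_simps)
    finally show ?thesis by (simp add: F_def)
  qed
  finally show ?thesis .
qed

text \<open>Both sides of \<open>regularized_inversion\<close> converge as \<open>\<delta> \<rightarrow> 0\<close>, by dominated convergence.\<close>

theorem fourier_inversion:
  fixes w :: "real ^ 'n \<Rightarrow> complex"
  assumes w: "smooth_on UNIV w" and K: "compact K" "\<And>x. x \<notin> K \<Longrightarrow> w x = 0"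
  shows "(LINT \<eta>|lborel. fourier w \<eta> * osc (- \<eta>) x) = of_real ((2 * pi) ^ CARD('n)) * w x"
proof -
  define \<delta> where "\<delta> = (\<lambda>n. inverse (real (Suc n)))"
  have \<delta>: "\<delta> n > 0" for n by (simp add: \<delta>_def)
  have \<delta>0: "\<delta> \<longlonglongrightarrow> 0" unfolding \<delta>_def by (rule LIMSEQ_inverse_real_of_nat)
  have wc: "continuous_on UNIV w" by (rule smooth_on_continuous[OF w])
  have wm: "w \<in> borel_measurable borel" using wc by (rule borel_measurable_continuous_onI)
  have gc: "continuous_on UNIV (gaussian :: real ^ 'n \<Rightarrow> complex)"
    unfolding gaussian_def by (intro continuous_intros) auto
  have fm: "fourier w \<in> borel_measurable borel" by (rule fourier_measurable[OF wm])
  have om: "(\<lambda>\<eta>. osc (- \<eta>) x) \<in> borel_measurable borel"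
    unfolding osc_def by (intro borel_measurable_continuous_onI continuous_intros)
  have g1: "norm (gaussian (y :: real ^ 'n)) \<le> 1" for y by (simp add: gaussian_def)
  have L: "(\<lambda>n. LINT \<eta>|lborel. gaussian (\<delta> n *\<^sub>R \<eta>) * fourier w \<eta> * osc (- \<eta>) x) \<longlonglongrightarrow>
      (LINT \<eta>|lborel. fourier w \<eta> * osc (- \<eta>) x)"
  proof (rule integral_dominated_convergence[where w = "\<lambda>\<eta>. norm (fourier w \<eta>)"])
    show "(\<lambda>\<eta>. gaussian (\<delta> n *\<^sub>R \<eta>) * fourier w \<eta> * osc (- \<eta>) x) \<in> borel_measurable lborel" for n
    proof -
      have "(\<lambda>\<eta>::real ^ 'n. gaussian (\<delta> n *\<^sub>R \<eta>)) \<in> borel_measurable borel"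
        by (intro borel_measurable_continuous_onI continuous_on_compose2[OF gc] continuous_intros) auto
      from borel_measurable_times[OF borel_measurable_times[OF this fm] om] show ?thesis by simp
    qed
    show "AE \<eta> in lborel. (\<lambda>n. gaussian (\<delta> n *\<^sub>R \<eta>) * fourier w \<eta> * osc (- \<eta>) x) \<longlonglongrightarrow> fourier w \<eta> * osc (- \<eta>) x"
    proof (rule AE_I2)
      fix \<eta> :: "real ^ 'n"
      have "(\<lambda>n. gaussian (\<delta> n *\<^sub>R \<eta>)) \<longlonglongrightarrow> gaussian (0 *\<^sub>R \<eta>)"
        by (rule continuous_on_tendsto_compose[OF gc tendsto_scaleR[OF \<delta>0 tendsto_const]]) auto
      hence "(\<lambda>n. gaussian (\<delta> n *\<^sub>R \<eta>)) \<longlonglongrightarrow> 1" by (simp add: gaussian_def)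
      from tendsto_mult[OF tendsto_mult[OF this tendsto_const[of "fourier w \<eta>"]] tendsto_const[of "osc (- \<eta>) x"]]
      show "(\<lambda>n. gaussian (\<delta> n *\<^sub>R \<eta>) * fourier w \<eta> * osc (- \<eta>) x) \<longlonglongrightarrow> fourier w \<eta> * osc (- \<eta>) x" by simp
    qed
    show "AE \<eta> in lborel. norm (gaussian (\<delta> n *\<^sub>R \<eta>) * fourier w \<eta> * osc (- \<eta>) x) \<le> norm (fourier w \<eta>)" for n
      using g1 by (intro AE_I2) (auto simp: norm_mult intro!: mult_left_le_one_le)
    show "integrable lborel (\<lambda>\<eta>. norm (fourier w \<eta>))"
      by (intro integrable_norm integrable_fourier[OF w K])
  qed (use fm om in auto)
  obtain B where B: "\<And>y. norm (w y) \<le> B"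
  proof -
    obtain A where A: "A > 0" "deriv_bound K 0 A w"
      using deriv_bound_compact[OF open_UNIV K(1) _ w] by blast
    have "norm (w y) \<le> A" for y
      using deriv_bound_normD[OF A(2), of y] K(2)[of y] A(1) by (cases "y \<in> K") auto
    thus ?thesis by (rule that)
  qed
  have R: "(\<lambda>n. LINT z|lborel. w (x + \<delta> n *\<^sub>R z) * gaussian z) \<longlonglongrightarrow> (LINT z|lborel. w x * gaussian (z :: real ^ 'n))"
  proof (rule integral_dominated_convergence[where w = "\<lambda>z::real ^ 'n. B * norm (gaussian z)"])
    show "(\<lambda>z. w (x + \<delta> n *\<^sub>R z) * gaussian z) \<in> borel_measurable lborel" for n
      by (auto intro!: borel_measurable_continuous_onI continuous_intros gc continuous_on_compose2[OF wc])
    show "(\<lambda>z::real ^ 'n. w x * gaussian z) \<in> borel_measurable lborel"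
      by (auto intro!: borel_measurable_continuous_onI continuous_intros gc)
    show "AE z in lborel. (\<lambda>n. w (x + \<delta> n *\<^sub>R z) * gaussian z) \<longlonglongrightarrow> w x * gaussian z"
    proof (rule AE_I2)
      fix z :: "real ^ 'n"
      have "(\<lambda>n. w (x + \<delta> n *\<^sub>R z)) \<longlonglongrightarrow> w (x + 0 *\<^sub>R z)"
        by (rule continuous_on_tendsto_compose[OF wc tendsto_add[OF tendsto_const tendsto_scaleR[OF \<delta>0 tendsto_const]]]) auto
      thus "(\<lambda>n. w (x + \<delta> n *\<^sub>R z) * gaussian z) \<longlonglongrightarrow> w x * gaussian z"
        by (intro tendsto_intros) simp
    qed
    show "AE z in lborel. norm (w (x + \<delta> n *\<^sub>R z) * gaussian z) \<le> B * norm (gaussian z)" for n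
      using B by (intro AE_I2) (simp add: norm_mult mult_right_mono)
    show "integrable lborel (\<lambda>z::real^'n. B * norm (gaussian z))"
      by (intro integrable_mult_right integrable_norm integrable_gaussian)
  qed
  have "(\<lambda>n. LINT \<eta>|lborel. gaussian (\<delta> n *\<^sub>R \<eta>) * fourier w \<eta> * osc (- \<eta>) x) \<longlonglongrightarrow>
      of_real (sqrt (2 * pi) ^ CARD('n)) * (LINT z|lborel. w x * gaussian (z :: real ^ 'n))"
    using tendsto_mult[OF tendsto_const R] regularized_inversion[OF w K \<delta>, of _ x] by simp
  hence "(LINT \<eta>|lborel. fourier w \<eta> * osc (- \<eta>) x) =
      of_real (sqrt (2 * pi) ^ CARD('n)) * (LINT z|lborel. w x * gaussian (z :: real ^ 'n))"
    using L LIMSEQ_unique by blast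
  also have "(LINT z|lborel. w x * gaussian (z :: real ^ 'n)) = w x * of_real (sqrt (2 * pi) ^ CARD('n))"
    using integral_gaussian[where 'a = "real ^ 'n"] by simp
  also have "complex_of_real (sqrt (2 * pi) ^ CARD('n)) * (w x * of_real (sqrt (2 * pi) ^ CARD('n))) =
      of_real ((2 * pi) ^ CARD('n)) * w x"
  proof -
    have a: "of_real a * (b * of_real a) = of_real (a * a) * b" for a and b :: complex by simp
    have "sqrt (2 * pi) ^ CARD('n) * sqrt (2 * pi) ^ CARD('n) = (sqrt (2 * pi) * sqrt (2 * pi)) ^ CARD('n)"
      by (rule power_mult_distrib[symmetric])
    thus ?thesis unfolding a by simp
  qed
  finally show ?thesis .
qed

theorem fourier_mult_convolution:
  fixes w g :: "real ^ 'n \<Rightarrow> complex"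
  assumes w: "smooth_on UNIV w" and K: "compact K" "\<And>x. x \<notin> K \<Longrightarrow> w x = 0"
    and g: "continuous_on UNIV g" and K': "compact K'" "\<And>x. x \<notin> K' \<Longrightarrow> g x = 0"
  shows "of_real ((2 * pi) ^ CARD('n)) * fourier (\<lambda>x. w x * g x) \<xi> =
      (LINT \<eta>|lborel. fourier w \<eta> * fourier g (\<xi> - \<eta>))"
proof -
  define H where "H = (\<lambda>(\<eta>::real^'n) x. osc (\<xi> - \<eta>) x)"
  have Hm: "case_prod H \<in> borel_measurable (lborel \<Otimes>\<^sub>M lborel)"
  proof -
    have "(\<lambda>z::(real ^ 'n) \<times> (real ^ 'n). osc (\<xi> - fst z) (snd z)) \<in> borel_measurable borel"
      unfolding osc_def by (intro borel_measurable_continuous_onI continuous_intros)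
    thus ?thesis by (simp add: H_def case_prod_beta' lborel_prod)
  qed
  have int: "integrable (lborel \<Otimes>\<^sub>M lborel) (\<lambda>(\<eta>, x). fourier w \<eta> * g x * H \<eta> x)"
    by (rule integrable_pair_mult[OF integrable_fourier[OF w K] integrable_compact_support[OF K'(1) g] Hm])
       (simp_all add: H_def K')
  have H: "H \<eta> x = osc (- \<eta>) x * osc \<xi> x" for \<eta> x
    by (simp add: H_def osc_def exp_add[symmetric] inner_diff_left algebra_simps)
  have "of_real ((2 * pi) ^ CARD('n)) * fourier (\<lambda>x. w x * g x) \<xi> =
      (LINT x|lborel. (of_real ((2 * pi) ^ CARD('n)) * w x) * (g x * osc \<xi> x))"
    unfolding fourier_osc integral_mult_right_zero[symmetric] by (simp add: mult_ac)
  also have "\<dots> = (LINT x|lborel. LINT \<eta>|lborel. fourier w \<eta> * g x * H \<eta> x)"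
  proof (intro arg_cong[where f = "integral\<^sup>L lborel"] ext)
    fix x
    have "(LINT \<eta>|lborel. fourier w \<eta> * g x * H \<eta> x) = (LINT \<eta>|lborel. (fourier w \<eta> * osc (- \<eta>) x) * (g x * osc \<xi> x))"
      by (simp add: H mult_ac)
    thus "of_real ((2 * pi) ^ CARD('n)) * w x * (g x * osc \<xi> x) = (LINT \<eta>|lborel. fourier w \<eta> * g x * H \<eta> x)"
      unfolding integral_mult_left_zero using fourier_inversion[OF w K, of x] by simp
  qed
  also have "\<dots> = (LINT \<eta>|lborel. LINT x|lborel. fourier w \<eta> * g x * H \<eta> x)"
    by (rule lborel_pair.Fubini_integral[OF int])
  also have "\<dots> = (LINT \<eta>|lborel. fourier w \<eta> * fourier g (\<xi> - \<eta>))"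
    unfolding fourier_osc[of g] integral_mult_right_zero[symmetric] by (simp add: H_def mult_ac)
  finally show ?thesis .
qed

section \<open>Products and Fourier decay in a cone\<close>

text \<open>The factors come from the decay of the transform of \<open>w\<close>, from the two regions of the convolution
  integral, from the integral over \<open>\<eta>\<close> and from the inversion formula. The last summand only makes
  the constant positive.\<close>

definition mult_decay_const :: "(real ^ 'n) set \<Rightarrow> real \<Rightarrow> nat \<Rightarrow> real" where
  "mult_decay_const K c l =
     (real CARD('n) + 1) ^ (l + 2 * CARD('n)) * measure lborel K * (2 ^ l + (1 / c) ^ l)
       * (LINT \<eta>|lborel. inverse ((1 + norm (\<eta> :: real ^ 'n)) ^ (2 * CARD('n)))) / (2 * pi) ^ CARD('n) + 1"

lemma mult_decay_const_pos: "c > 0 \<Longrightarrow> mult_decay_const K c l > 0"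
  unfolding mult_decay_const_def
  by (intro add_nonneg_pos divide_nonneg_pos mult_nonneg_nonneg Bochner_Integration.integral_nonneg) auto

text \<open>Split the convolution at \<open>\<bar>\<eta>\<bar> = c\<bar>\<xi>\<bar>\<close>. Below, \<open>\<xi> - \<eta>\<close> is comparable to \<open>\<xi>\<close> and the decay comes from \<open>g\<close>;
  above, it comes from \<open>w\<close>, whose transform decays by \<open>2n\<close> further powers that make the integral
  over \<open>\<eta>\<close> converge.\<close>

lemma fourier_mult_decay:
  fixes w g :: "real ^ 'n \<Rightarrow> complex"
  assumes K: "compact K" and c: "0 < c" "c \<le> 1/2"
    and w: "smooth_on UNIV w" "\<And>x. x \<notin> K \<Longrightarrow> w x = 0" "deriv_bound UNIV (l + 2 * CARD('n)) A w"
    and g: "continuous_on UNIV g" and K': "compact K'" "\<And>x. x \<notin> K' \<Longrightarrow> g x = 0"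
    and A: "0 \<le> A" and B': "0 \<le> B'" and gB: "\<And>\<zeta>. norm (fourier g \<zeta>) \<le> B"
    and gB': "\<And>\<eta>. norm \<eta> \<le> c * norm \<xi> \<Longrightarrow> norm (fourier g (\<xi> - \<eta>)) * (1 + norm (\<xi> - \<eta>)) ^ l \<le> B'"
  shows "norm (fourier (\<lambda>x. w x * g x) \<xi>) * (1 + norm \<xi>) ^ l \<le> mult_decay_const K c l * A * (B + B')"
proof -
  let ?n = "2 * CARD('n)"
  define C0 where "C0 = (real CARD('n) + 1) ^ (l + ?n) * measure lborel K"
  have C0: "C0 \<ge> 0" by (simp add: C0_def)
  define J where "J = (LINT \<eta>|lborel. inverse ((1 + norm (\<eta> :: real ^ 'n)) ^ ?n))"
  have Jint: "integrable lborel (\<lambda>\<eta> :: real ^ 'n. inverse ((1 + norm \<eta>) ^ ?n))"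
    using integrable_one_plus_norm_power[where 'a = "real ^ 'n"] by simp
  have J: "J \<ge> 0" unfolding J_def by (rule Bochner_Integration.integral_nonneg) simp
  define E where "E = 2 ^ l + (1 / c) ^ l"
  have E: "E \<ge> 0" "2 ^ l \<le> E" "(1 / c) ^ l \<le> E" using c by (auto simp: E_def)
  define P where "P = (2 * pi) ^ CARD('n)"
  have P: "P > 0" by (simp add: P_def)
  have C: "mult_decay_const K c l = C0 * E * J / P + 1"
    by (simp add: mult_decay_const_def C0_def E_def J_def P_def)
  have B: "0 \<le> B" using gB norm_ge_zero order_trans by blast
  define X where "X = (1 + norm \<xi>) ^ l"
  have X: "X > 0" unfolding X_def by (intro zero_less_power) (simp add: add_pos_nonneg)
  define Q where "Q = C0 * A * ((B + B') * E)"
  have pos: "0 < (1 + norm \<eta>) ^ k" for \<eta> :: "real ^ 'n" and k by (intro zero_less_power) (simp add: add_pos_nonneg)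
  have G: "norm (fourier g (\<xi> - \<eta>)) * X \<le> (B + B') * E * (1 + norm \<eta>) ^ l" for \<eta>
  proof (cases "norm \<eta> \<le> c * norm \<xi>")
    case True
    have "norm \<xi> - norm \<eta> \<le> norm (\<xi> - \<eta>)" by (rule norm_triangle_ineq2)
    moreover have "c * norm \<xi> \<le> 1/2 * norm \<xi>" using c by (intro mult_right_mono) auto
    with True have "norm \<eta> \<le> 1/2 * norm \<xi>" by (rule order_trans)
    ultimately have "1 + norm \<xi> \<le> 2 * (1 + norm (\<xi> - \<eta>))" by simp
    hence "X \<le> (2 * (1 + norm (\<xi> - \<eta>))) ^ l" unfolding X_def by (intro power_mono) auto
    hence "norm (fourier g (\<xi> - \<eta>)) * X \<le> norm (fourier g (\<xi> - \<eta>)) * (2 * (1 + norm (\<xi> - \<eta>))) ^ l"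
      by (intro mult_left_mono) auto
    also have "\<dots> = 2 ^ l * (norm (fourier g (\<xi> - \<eta>)) * (1 + norm (\<xi> - \<eta>)) ^ l)"
      by (simp only: power_mult_distrib) simp
    also have "\<dots> \<le> E * (B + B')" using gB' True B B' E by (intro mult_mono) (auto intro: order_trans[of _ B'])
    also have "\<dots> \<le> (E * (B + B')) * (1 + norm \<eta>) ^ l"
      using mult_left_mono[of 1 "(1 + norm \<eta>) ^ l" "E * (B + B')"] B B' E by (simp add: one_le_power)
    finally show ?thesis by (simp add: mult_ac)
  next
    case False
    hence "norm \<xi> \<le> norm \<eta> / c" using c by (simp add: pos_le_divide_eq mult.commute)
    moreover have "1 \<le> 1 / c" using c by (simp add: field_simps)
    ultimately have "1 + norm \<xi> \<le> (1 / c) * (1 + norm \<eta>)" by (simp add: algebra_simps add_divide_distrib)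
    hence "X \<le> ((1 / c) * (1 + norm \<eta>)) ^ l" unfolding X_def by (intro power_mono) auto
    hence "norm (fourier g (\<xi> - \<eta>)) * X \<le> B * ((1 / c) ^ l * (1 + norm \<eta>) ^ l)"
      using gB X B unfolding power_mult_distrib by (intro mult_mono) auto
    also have "\<dots> \<le> (B + B') * (E * (1 + norm \<eta>) ^ l)"
      using B B' E c pos[of \<eta> l] by (intro mult_mono) (auto intro: mult_nonneg_nonneg less_imp_le)
    finally show ?thesis by (simp add: mult_ac)
  qed
  have main: "norm (fourier w \<eta> * fourier g (\<xi> - \<eta>)) \<le> (Q / X) * inverse ((1 + norm \<eta>) ^ ?n)" for \<eta>
  proof -
    have "norm (fourier w \<eta>) * (1 + norm \<eta>) ^ (l + ?n) \<le> C0 * A"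
      using fourier_decay[OF w(1) K _ w(3), of \<eta>] w(2) by (simp add: C0_def mult.assoc)
    hence "(norm (fourier w \<eta>) * (1 + norm \<eta>) ^ (l + ?n)) * (norm (fourier g (\<xi> - \<eta>)) * X) \<le> (C0 * A) * ((B + B') * E * (1 + norm \<eta>) ^ l)"
      using G[of \<eta>] C0 A X by (intro mult_mono[where c = "norm (fourier g (\<xi> - \<eta>)) * X"]) auto
    hence "(norm (fourier w \<eta> * fourier g (\<xi> - \<eta>)) * X * (1 + norm \<eta>) ^ ?n) * (1 + norm \<eta>) ^ l \<le> Q * (1 + norm \<eta>) ^ l"
      by (simp add: norm_mult power_add Q_def mult_ac)
    hence "norm (fourier w \<eta> * fourier g (\<xi> - \<eta>)) * X * (1 + norm \<eta>) ^ ?n \<le> Q"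
      using mult_right_le_imp_le pos by blast
    thus ?thesis using X pos[of \<eta> ?n] by (simp add: field_simps)
  qed
  have meas: "(\<lambda>\<eta>. fourier w \<eta> * fourier g (\<xi> - \<eta>)) \<in> borel_measurable borel"
  proof -
    have m: "fourier w \<in> borel_measurable borel" "fourier g \<in> borel_measurable borel"
      using fourier_measurable borel_measurable_continuous_onI smooth_on_continuous[OF w(1)] g by blast+
    have "(\<lambda>\<eta>. \<xi> - \<eta>) \<in> borel \<rightarrow>\<^sub>M borel"
      by (intro borel_measurable_continuous_onI continuous_intros)
    from borel_measurable_times[OF m(1) measurable_compose[OF this m(2)]] show ?thesis .
  qed
  have dom: "integrable lborel (\<lambda>\<eta> :: real ^ 'n. (Q / X) * inverse ((1 + norm \<eta>) ^ ?n))"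
    by (intro integrable_mult_right Jint)
  have int: "integrable lborel (\<lambda>\<eta>. fourier w \<eta> * fourier g (\<xi> - \<eta>))"
  proof (rule Bochner_Integration.integrable_bound[OF dom])
    show "(\<lambda>\<eta>. fourier w \<eta> * fourier g (\<xi> - \<eta>)) \<in> borel_measurable lborel" using meas by simp
    show "AE \<eta> in lborel. norm (fourier w \<eta> * fourier g (\<xi> - \<eta>)) \<le> norm ((Q / X) * inverse ((1 + norm \<eta>) ^ ?n))"
      unfolding real_norm_def by (rule AE_I2) (rule order_trans[OF main abs_ge_self])
  qed
  have "P * norm (fourier (\<lambda>x. w x * g x) \<xi>) = norm (LINT \<eta>|lborel. fourier w \<eta> * fourier g (\<xi> - \<eta>))"
    using arg_cong[OF fourier_mult_convolution[OF w(1) K _ g K'(1), of \<xi>], of norm] w(2) K'(2)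
    by (simp add: P_def norm_mult norm_power)
  also have "\<dots> \<le> (LINT \<eta>|lborel. (Q / X) * inverse ((1 + norm (\<eta> :: real ^ 'n)) ^ ?n))"
    by (rule Bochner_Integration.integral_norm_bound_integral[OF int dom main])
  also have "\<dots> = (Q / X) * J" unfolding J_def by (rule integral_mult_right_zero)
  finally have "norm (fourier (\<lambda>x. w x * g x) \<xi>) * X \<le> Q * J / P"
    using P X by (simp add: field_simps)
  also have "\<dots> = (C0 * E * J / P) * (A * (B + B'))" by (simp add: Q_def mult_ac)
  also have "\<dots> \<le> mult_decay_const K c l * (A * (B + B'))" using A B B' unfolding C by (intro mult_right_mono) auto
  finally show ?thesis by (simp add: X_def mult.assoc)
qed

section \<open>Bump functions\<close>

text \<open>The functions \<open>t\<^bsup>-k\<^esup> e\<^bsup>-1/t\<^esup>\<close>, extended by zero to \<open>t \<le> 0\<close>, span a space that is closed under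
  differentiation.\<close>

definition flat :: "nat \<Rightarrow> real \<Rightarrow> real" where
  "flat k t = (if t > 0 then inverse t ^ k * exp (- inverse t) else 0)"

lemma flat_tendsto_0: "(flat k \<longlongrightarrow> 0) (at_right 0)"
proof -
  have "((\<lambda>t::real. inverse t ^ k / exp (inverse t)) \<longlongrightarrow> 0) (at_right 0)"
    by (rule filterlim_compose[OF tendsto_power_div_exp_0 filterlim_inverse_at_top_right])
  moreover have "\<forall>\<^sub>F t in at_right 0. inverse t ^ k / exp (inverse t) = flat k t"
    unfolding eventually_at_right_field
    by (intro exI[of _ 1]) (auto simp: flat_def exp_minus divide_inverse)
  ultimately show ?thesis by (rule Lim_transform_eventually)
qed

lemma flat_DERIV: "(flat k has_real_derivative flat (k + 2) t - k * flat (k + 1) t) (at t)"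
proof -
  consider "t > 0" | "t < 0" | "t = 0" by linarith
  thus ?thesis
  proof cases
    case 1
    have "((\<lambda>t. inverse t ^ k * exp (- inverse t)) has_real_derivative flat (k + 2) t - k * flat (k + 1) t) (at t)"
    proof (cases k)
      case 0
      thus ?thesis using 1 by (auto intro!: derivative_eq_intros simp: flat_def power2_eq_square)
    next
      case (Suc k')
      show ?thesis unfolding Suc
        by (rule derivative_eq_intros refl | use 1 in \<open>simp add: flat_def power2_eq_square algebra_simps\<close>)+
    qed
    thus ?thesis
      by (rule has_field_derivative_transform_within_open[of _ _ _ "{0<..}"]) (use 1 in \<open>auto simp: flat_def\<close>)
  next
    case 2
    have "((\<lambda>_. 0) has_real_derivative flat (k + 2) t - k * flat (k + 1) t) (at t)"
      using 2 by (simp add: flat_def)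
    thus ?thesis
      by (rule has_field_derivative_transform_within_open[of _ _ _ "{..<0}"]) (use 2 in \<open>auto simp: flat_def\<close>)
  next
    case 3
    have r: "((\<lambda>h. (flat k (0 + h) - flat k 0) / h) \<longlongrightarrow> 0) (at_right 0)"
    proof (rule Lim_transform_eventually[OF flat_tendsto_0[of "Suc k"]])
      show "\<forall>\<^sub>F h in at_right 0. flat (Suc k) h = (flat k (0 + h) - flat k 0) / h"
        unfolding eventually_at_right_field by (intro exI[of _ 1]) (auto simp: flat_def divide_inverse)
    qed
    have l: "((\<lambda>h. (flat k (0 + h) - flat k 0) / h) \<longlongrightarrow> 0) (at_left 0)"
    proof (rule Lim_transform_eventually[OF tendsto_const[of 0]])
      show "\<forall>\<^sub>F h in at_left 0. 0 = (flat k (0 + h) - flat k 0) / h"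
        unfolding eventually_at_left_field by (intro exI[of _ "-1"]) (auto simp: flat_def)
    qed
    show ?thesis using filterlim_split_at[OF l r] 3 by (simp add: DERIV_def flat_def)
  qed
qed

lemma smooth_on_inner: "smooth_on UNIV (\<lambda>y::real ^ 'n. complex_of_real (b + (y - a) \<bullet> v))"
proof (rule smooth_on_coinduct[where C = "\<lambda>f. \<exists>b v. f = (\<lambda>y::real ^ 'n. complex_of_real (b + (y - a) \<bullet> v))"])
  fix f :: "real ^ 'n \<Rightarrow> complex" assume "\<exists>b v. f = (\<lambda>y::real ^ 'n. complex_of_real (b + (y - a) \<bullet> v))"
  then obtain b v where f: "f = (\<lambda>y::real ^ 'n. complex_of_real (b + (y - a) \<bullet> v))" by blast
  have d: "(f has_derivative (\<lambda>h. complex_of_real (h \<bullet> v))) (at y)" for y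
    unfolding f by (auto intro!: derivative_eq_intros)
  show "f differentiable_on UNIV"
    using d unfolding differentiable_on_def differentiable_def by auto
  fix j
  show "\<exists>g. (\<exists>b v. g = (\<lambda>y. complex_of_real (b + (y - a) \<bullet> v))) \<and> (\<forall>x\<in>UNIV. partial_deriv j f x = g x)"
  proof (intro exI conjI)
    show "(\<lambda>_. complex_of_real (axis j 1 \<bullet> v)) = (\<lambda>y. complex_of_real (axis j 1 \<bullet> v + (y - a) \<bullet> 0))" by simp
  qed (simp add: partial_deriv_eqI[OF d])
qed auto

text \<open>The smooth multiples of the functions \<open>y \<mapsto> flat k (R - \<bar>y - a\<bar>\<^sup>2)\<close>, for all \<open>k\<close>, span a space that
  is closed under partial derivatives.\<close>

inductive flat_span :: "real ^ 'n \<Rightarrow> real \<Rightarrow> (real ^ 'n \<Rightarrow> complex) \<Rightarrow> bool" for a R where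
  gen: "smooth_on UNIV p \<Longrightarrow> flat_span a R (\<lambda>y. p y * of_real (flat k (R - (norm (y - a))\<^sup>2)))"
| add: "flat_span a R f \<Longrightarrow> flat_span a R g \<Longrightarrow> flat_span a R (\<lambda>y. f y + g y)"

lemma flat_span_step:
  assumes "flat_span a R f"
  shows "f differentiable_on UNIV \<and> (\<forall>j. \<exists>g. flat_span a R g \<and> (\<forall>x\<in>UNIV. partial_deriv j f x = g x))"
  using assms
proof induction
  case (gen p k)
  define \<rho> where "\<rho> = (\<lambda>y. R - (norm (y - a))\<^sup>2)"
  define q where "q = (\<lambda>k y. complex_of_real (flat k (\<rho> y)))"
  have d: "(q k has_derivative (\<lambda>h. of_real ((flat (k + 2) (\<rho> y) - k * flat (k + 1) (\<rho> y)) * (- 2 * ((y - a) \<bullet> h))))) (at y)" for y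
  proof -
    have "(\<rho> has_derivative (\<lambda>h. - 2 * ((y - a) \<bullet> h))) (at y)"
      unfolding \<rho>_def power2_norm_eq_inner by (auto intro!: derivative_eq_intros simp: inner_commute)
    from has_derivative_compose[OF this flat_DERIV[of k "\<rho> y", unfolded has_field_derivative_def]]
    show ?thesis unfolding q_def by (intro has_derivative_of_real) simp
  qed
  have dp: "p differentiable (at y)" for y using smooth_on_differentiable[OF open_UNIV gen] by blast
  have dq: "q k differentiable (at y)" for y using d unfolding differentiable_def by blast
  have "\<exists>g. flat_span a R g \<and> (\<forall>x\<in>UNIV. partial_deriv j (\<lambda>y. p y * q k y) x = g x)" for j
  proof -
    define r where "r = (\<lambda>y. complex_of_real (0 + (y - a) \<bullet> (- 2 *\<^sub>R axis j 1)))"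
    have r: "smooth_on UNIV r" unfolding r_def by (rule smooth_on_inner)
    have e: "partial_deriv j (\<lambda>y. p y * q k y) y =
       partial_deriv j p y * q k y + ((p y * r y) * q (k + 2) y + (- of_nat k * (p y * r y)) * q (k + 1) y)" for y
      unfolding partial_deriv_mult[OF dp dq] partial_deriv_eqI[OF d]
      by (simp add: q_def r_def algebra_simps)
    have "flat_span a R (\<lambda>y. partial_deriv j p y * q k y + ((p y * r y) * q (k + 2) y + (- of_nat k * (p y * r y)) * q (k + 1) y))"
      unfolding q_def \<rho>_def
      by (intro flat_span.add flat_span.gen smooth_on_partial gen smooth_on_mult smooth_on_const open_UNIV r)
    thus ?thesis using e by blast
  qed
  moreover have "(\<lambda>y. p y * q k y) differentiable_on UNIV"
    using dp dq by (intro differentiable_at_imp_differentiable_on differentiable_mult)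
  ultimately show ?case unfolding q_def \<rho>_def by blast
next
  case (add f g)
  have d: "f differentiable (at x)" "g differentiable (at x)" for x
    using add differentiable_on_openD[OF open_UNIV] by auto
  have "\<exists>h. flat_span a R h \<and> (\<forall>x\<in>UNIV. partial_deriv j (\<lambda>x. f x + g x) x = h x)" for j
  proof -
    obtain f1 g1 where "flat_span a R f1" "flat_span a R g1"
      "\<forall>x\<in>UNIV. partial_deriv j f x = f1 x" "\<forall>x\<in>UNIV. partial_deriv j g x = g1 x"
      using add.IH by meson
    thus ?thesis using d
      by (intro exI[of _ "\<lambda>x. f1 x + g1 x"]) (auto simp: partial_deriv_add intro: flat_span.intros)
  qed
  thus ?case using add by (auto intro: differentiable_on_add)
qed

lemma smooth_bump: "smooth_on UNIV (\<lambda>y. complex_of_real (flat 0 (R - (norm (y - a))\<^sup>2)))"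
proof (rule smooth_on_coinduct[where C = "flat_span a R"])
  show "flat_span a R (\<lambda>y. complex_of_real (flat 0 (R - (norm (y - a))\<^sup>2)))"
    using flat_span.gen[OF smooth_on_const[OF open_UNIV, of 1], of a R 0] by simp
qed (auto dest: flat_span_step)

text \<open>Finitely many of the balls on which bumps are positive cover \<open>K\<close>; as bumps are nonnegative, their
  sum has no zero on \<open>K\<close>.\<close>

lemma ex_test_function:
  fixes K U :: "(real ^ 'n) set"
  assumes K: "compact K" and U: "open U" "K \<subseteq> U"
  shows "\<exists>s\<in>test_functions U. \<forall>x\<in>K. s x \<noteq> 0"
proof -
  have "\<forall>x\<in>K. \<exists>r>0. cball x r \<subseteq> U" using U open_contains_cball by blast
  then obtain r where r: "\<And>x. x \<in> K \<Longrightarrow> r x > 0" "\<And>x. x \<in> K \<Longrightarrow> cball x (r x) \<subseteq> U" by metis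
  obtain D where D: "D \<subseteq> K" "finite D" "K \<subseteq> (\<Union>x\<in>D. ball x (r x))"
    by (rule compactE_image[OF K, of K "\<lambda>x. ball x (r x)"]) (use r in force)+
  define b where "b = (\<lambda>x y. flat 0 ((r x)\<^sup>2 - (norm (y - x))\<^sup>2))"
  have bnn: "b x y \<ge> 0" for x y by (simp add: b_def flat_def)
  have b0: "b x y = 0 \<longleftrightarrow> y \<notin> ball x (r x)" if "x \<in> D" for x y
  proof -
    have "r x > 0" using r D that by blast
    hence "(norm (y - x))\<^sup>2 < (r x)\<^sup>2 \<longleftrightarrow> norm (y - x) < r x"
      by (meson less_imp_le norm_ge_zero power2_less_imp_less power_strict_mono zero_less_numeral)
    thus ?thesis by (auto simp: b_def flat_def dist_norm norm_minus_commute)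
  qed
  define s where "s = (\<lambda>y. \<Sum>x\<in>D. complex_of_real (b x y))"
  have s: "s y = of_real (\<Sum>x\<in>D. b x y)" for y by (simp add: s_def)
  have sm: "smooth_on UNIV s" unfolding s_def b_def by (intro smooth_on_sum smooth_bump open_UNIV)
  define L where "L = (\<Union>x\<in>D. cball x (r x))"
  have L: "compact L" unfolding L_def using D(2) by (intro compact_UN) auto
  have LU: "L \<subseteq> U" unfolding L_def using D(1) r(2) by blast
  have "{x. s x \<noteq> 0} \<subseteq> L"
  proof
    fix y assume "y \<in> {x. s x \<noteq> 0}"
    hence "\<exists>x\<in>D. b x y \<noteq> 0" unfolding s by (metis (mono_tags, lifting) mem_Collect_eq of_real_0 sum.neutral)
    thus "y \<in> L" using b0 unfolding L_def by fastforce
  qed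
  hence "closure {x. s x \<noteq> 0} \<subseteq> L" using L by (intro closure_minimal compact_imp_closed)
  moreover from this have "compact (closure {x. s x \<noteq> 0})"
    using L by (meson closed_closure closed_subset compact_Int_closed compact_imp_bounded
      bounded_subset compact_eq_bounded_closed)
  ultimately have "s \<in> test_functions U" using sm LU unfolding test_functions_def by blast
  moreover have "s y \<noteq> 0" if y: "y \<in> K" for y
  proof -
    obtain x where x: "x \<in> D" "y \<in> ball x (r x)" using D y by blast
    hence "b x y > 0" using b0[OF x(1), of y] bnn[of x y] by linarith
    hence "(\<Sum>x\<in>D. b x y) > 0" using D bnn x by (intro sum_pos2[of _ x]) auto
    thus ?thesis using s[of y] by (metis of_real_eq_0_iff less_irrefl)
  qed
  ultimately show ?thesis by blast
qed

section \<open>Cones\<close>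

text \<open>The smaller cone is spanned by a ball around \<open>\<xi>\<^sub>0\<close> whose radius is at most half of that of a ball
  contained in the larger one.\<close>

lemma conic_neighborhood_shrink:
  assumes "conic_neighborhood \<xi>\<^sub>0 \<Gamma>"
  shows "\<exists>\<Gamma>' c. conic_neighborhood \<xi>\<^sub>0 \<Gamma>' \<and> 0 < c \<and> c \<le> 1/2 \<and>
           (\<forall>\<xi>\<in>\<Gamma>'. \<forall>\<eta>. norm \<eta> \<le> c * norm \<xi> \<longrightarrow> \<xi> - \<eta> \<in> \<Gamma>)"
proof -
  have \<Gamma>: "\<xi>\<^sub>0 \<in> interior \<Gamma>" "0 \<notin> \<Gamma>" "\<And>\<xi> t. \<xi> \<in> \<Gamma> \<Longrightarrow> t > 0 \<Longrightarrow> t *\<^sub>R \<xi> \<in> \<Gamma>"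
    using assms by (auto simp: conic_neighborhood_def)
  obtain d where d: "d > 0" "ball \<xi>\<^sub>0 d \<subseteq> \<Gamma>" using \<Gamma>(1) mem_interior by blast
  have x0: "norm \<xi>\<^sub>0 > 0" using \<Gamma>(1,2) interior_subset by force
  define \<rho> where "\<rho> = min (d / 2) (norm \<xi>\<^sub>0 / 2)"
  have \<rho>: "\<rho> > 0" "2 * \<rho> \<le> d" "\<rho> \<le> norm \<xi>\<^sub>0 / 2" using d x0 by (auto simp: \<rho>_def)
  define \<Gamma>' where "\<Gamma>' = {t *\<^sub>R \<zeta> | t \<zeta>. t > 0 \<and> \<zeta> \<in> ball \<xi>\<^sub>0 \<rho>}"
  (* A point \<xi> = t \<zeta> of the smaller cone has norm at most 2 t |\<xi>\<^sub>0|, so |\<eta>| \<le> c |\<xi>| gives |\<eta>/t| \<le> \<rho>. *)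
  define c where "c = \<rho> / (2 * norm \<xi>\<^sub>0)"
  have c: "0 < c" "c \<le> 1/2" using \<rho> x0 by (auto simp: c_def field_simps)
  have "ball \<xi>\<^sub>0 \<rho> \<subseteq> \<Gamma>'" unfolding \<Gamma>'_def by (force intro: exI[of _ 1])
  hence "\<xi>\<^sub>0 \<in> interior \<Gamma>'" using \<rho>(1) by (meson centre_in_ball interior_maximal open_ball subsetD)
  moreover have "0 \<notin> \<Gamma>'"
  proof
    assume "0 \<in> \<Gamma>'"
    hence "0 \<in> ball \<xi>\<^sub>0 \<rho>" by (auto simp: \<Gamma>'_def)
    thus False using \<rho> x0 by simp
  qed
  moreover have "t *\<^sub>R \<xi> \<in> \<Gamma>'" if "\<xi> \<in> \<Gamma>'" "t > 0" for \<xi> t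
  proof -
    obtain r \<zeta> where "\<xi> = r *\<^sub>R \<zeta>" "r > 0" "\<zeta> \<in> ball \<xi>\<^sub>0 \<rho>"
      using \<open>\<xi> \<in> \<Gamma>'\<close> unfolding \<Gamma>'_def by blast
    hence "t *\<^sub>R \<xi> = (t * r) *\<^sub>R \<zeta>" "t * r > 0" using \<open>t > 0\<close> by auto
    thus ?thesis using \<open>\<zeta> \<in> ball \<xi>\<^sub>0 \<rho>\<close> unfolding \<Gamma>'_def by blast
  qed
  moreover have "\<xi> - \<eta> \<in> \<Gamma>" if \<xi>: "\<xi> \<in> \<Gamma>'" and \<eta>: "norm \<eta> \<le> c * norm \<xi>" for \<xi> \<eta>
  proof -
    obtain t \<zeta> where t: "\<xi> = t *\<^sub>R \<zeta>" "t > 0" "\<zeta> \<in> ball \<xi>\<^sub>0 \<rho>"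
      using \<xi> unfolding \<Gamma>'_def by blast
    have n\<zeta>: "norm \<zeta> \<le> 2 * norm \<xi>\<^sub>0"
      using t(3) \<rho> norm_triangle_ineq2[of \<zeta> \<xi>\<^sub>0] by (simp add: dist_norm norm_minus_commute)
    have "norm \<eta> \<le> c * (t * norm \<zeta>)" using \<eta> t by simp
    also have "\<dots> \<le> c * (t * (2 * norm \<xi>\<^sub>0))" using n\<zeta> t c by (intro mult_left_mono) auto
    also have "\<dots> = t * \<rho>" using x0 by (simp add: c_def)
    finally have n: "norm (\<eta> /\<^sub>R t) \<le> \<rho>" using t by (simp add: field_simps)
    have "dist \<xi>\<^sub>0 (\<zeta> - \<eta> /\<^sub>R t) \<le> dist \<xi>\<^sub>0 \<zeta> + norm (\<eta> /\<^sub>R t)"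
      using norm_triangle_ineq[of "\<xi>\<^sub>0 - \<zeta>" "\<eta> /\<^sub>R t"] by (simp add: dist_norm algebra_simps)
    hence "\<zeta> - \<eta> /\<^sub>R t \<in> ball \<xi>\<^sub>0 d" using t(3) n \<rho> by simp
    hence "t *\<^sub>R (\<zeta> - \<eta> /\<^sub>R t) \<in> \<Gamma>" using d t \<Gamma>(3) by blast
    thus ?thesis using t by (simp add: algebra_simps)
  qed
  ultimately show ?thesis using c unfolding conic_neighborhood_def by blast
qed

section \<open>Localization at a regular point\<close>

lemma eventually_unit: "\<forall>\<^sub>F \<epsilon> in at_right (0::real). 0 < \<epsilon> \<and> \<epsilon> < 1"
  unfolding eventually_at_right_field by (intro exI[of _ 1]) auto

lemma powr_le_powr_small: "0 < \<epsilon> \<Longrightarrow> \<epsilon> < (1::real) \<Longrightarrow> M \<le> N \<Longrightarrow> \<epsilon> powr (- M) \<le> \<epsilon> powr (- N)"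
  by (intro powr_mono') auto

text \<open>The decay required for microlocal regularity, with the neighbourhoods as parameters.\<close>

definition regular_in :: "'n net \<Rightarrow> (real ^ 'n) set \<Rightarrow> (real ^ 'n) set \<Rightarrow> bool" where
  "regular_in v U \<Gamma> \<longleftrightarrow> (\<forall>\<phi>\<in>test_functions U. \<exists>N. \<forall>l::nat. \<exists>C>0. \<forall>\<^sub>F \<epsilon> in at_right 0. \<forall>\<xi>\<in>\<Gamma>.
          norm (fourier (\<lambda>x. \<phi> x * v \<epsilon> x) \<xi>) \<le> C * \<epsilon> powr (- N) / (1 + norm \<xi>) ^ l)"

lemma moderate_sup_bound:
  assumes "v \<in> moderate_nets \<Omega>" "compact K" "K \<subseteq> \<Omega>"
  shows "\<exists>N C. C > 0 \<and> (\<forall>\<^sub>F \<epsilon> in at_right 0. \<forall>x\<in>K. norm (v \<epsilon> x) \<le> C * \<epsilon> powr (- N))"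
proof -
  obtain p C where "\<forall>\<^sub>F \<epsilon> in at_right 0. \<forall>x\<in>K. norm (mi_deriv (\<lambda>_. 0) (v \<epsilon>) x) \<le> C * \<epsilon> powr (- p)"
    using assms unfolding moderate_nets_def by blast
  hence "\<forall>\<^sub>F \<epsilon> in at_right 0. \<forall>x\<in>K. norm (v \<epsilon> x) \<le> (\<bar>C\<bar> + 1) * \<epsilon> powr (- p)"
  proof eventually_elim
    case (elim \<epsilon>)
    have "C * \<epsilon> powr (- p) \<le> (\<bar>C\<bar> + 1) * \<epsilon> powr (- p)" by (intro mult_right_mono) auto
    thus ?case using elim by (auto intro: order_trans)
  qed
  moreover have "\<bar>C\<bar> + 1 > 0" by simp
  ultimately show ?thesis by blast
qed

text \<open>Choose a test function \<open>s\<close> without zeros on \<open>K\<close> and write \<open>w v = (w/s)(s v)\<close>. The transform of \<open>s v\<close>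
  decays in the cone \<open>\<Gamma>\<close> and is moderate everywhere, so \<open>fourier_mult_decay\<close> applies. What matters for
  the sequel is the uniformity: \<open>N\<close> depends neither on \<open>l\<close> nor on \<open>w\<close>, which may therefore vary with
  \<open>\<epsilon>\<close> and \<open>\<xi>\<close>.\<close>

lemma fourier_mult_regular:
  fixes v :: "'n::finite net"
  assumes \<Omega>: "open \<Omega>" and v: "v \<in> moderate_nets \<Omega>" and U: "open U" "U \<subseteq> \<Omega>"
    and reg: "regular_in v U \<Gamma>" and K: "compact K" "K \<subseteq> U"
    and c: "0 < c" "c \<le> 1/2" and cone: "\<And>\<xi> \<eta>. \<xi> \<in> \<Gamma>' \<Longrightarrow> norm \<eta> \<le> c * norm \<xi> \<Longrightarrow> \<xi> - \<eta> \<in> \<Gamma>"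
  shows "\<exists>N. \<forall>l. \<exists>C>0. \<forall>\<^sub>F \<epsilon> in at_right 0. \<forall>\<xi>\<in>\<Gamma>'. \<forall>w A. 0 \<le> A \<longrightarrow> smooth_on UNIV w \<longrightarrow>
     (\<forall>x. x \<notin> K \<longrightarrow> w x = 0) \<longrightarrow> deriv_bound K (l + 2 * CARD('n)) A w \<longrightarrow>
     norm (fourier (\<lambda>x. w x * v \<epsilon> x) \<xi>) * (1 + norm \<xi>) ^ l \<le> C * A * \<epsilon> powr (- N)"
proof -
  obtain s where s: "s \<in> test_functions U" "\<And>x. x \<in> K \<Longrightarrow> s x \<noteq> 0"
    using ex_test_function[OF K(1) U(1) K(2)] by blast
  define K1 where "K1 = closure {x. s x \<noteq> 0}"
  have sm: "smooth_on UNIV s" and K1: "compact K1" "K1 \<subseteq> U"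
    using s(1) by (auto simp: test_functions_def K1_def)
  have s0: "x \<notin> K1 \<Longrightarrow> s x = 0" for x
    unfolding K1_def using closure_subset[of "{x. s x \<noteq> 0}"] by blast
  define S where "S = {x. s x \<noteq> 0}"
  have S: "open S" "K \<subseteq> S"
    using smooth_on_continuous[OF sm] s(2) unfolding S_def by (auto intro!: open_Collect_neq continuous_intros)
  have iss: "smooth_on S (\<lambda>x. 1 / s x)"
    by (rule smooth_on_divide[OF S(1) smooth_on_const[OF S(1)] smooth_on_subset[OF sm]]) (auto simp: S_def)
  obtain N1 C1 where C1: "C1 > 0" "\<forall>\<^sub>F \<epsilon> in at_right 0. \<forall>x\<in>K1. norm (v \<epsilon> x) \<le> C1 * \<epsilon> powr (- N1)"
    using moderate_sup_bound[OF v K1(1)] K1(2) U(2) by blast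
  obtain D1 where D1: "D1 > 0" "deriv_bound K1 0 D1 s"
    using deriv_bound_compact[OF open_UNIV K1(1) _ sm] by blast
  obtain N2 where N2: "\<And>l. \<exists>C>0. \<forall>\<^sub>F \<epsilon> in at_right 0. \<forall>\<xi>\<in>\<Gamma>.
          norm (fourier (\<lambda>x. s x * v \<epsilon> x) \<xi>) \<le> C * \<epsilon> powr (- N2) / (1 + norm \<xi>) ^ l"
    using reg s(1) unfolding regular_in_def by blast
  define N where "N = max N1 N2"
  show ?thesis
  proof (rule exI[of _ N], rule allI)
    fix l
    let ?L = "l + 2 * CARD('n)"
    obtain C2 where C2: "C2 > 0" "\<forall>\<^sub>F \<epsilon> in at_right 0. \<forall>\<xi>\<in>\<Gamma>.
          norm (fourier (\<lambda>x. s x * v \<epsilon> x) \<xi>) \<le> C2 * \<epsilon> powr (- N2) / (1 + norm \<xi>) ^ l"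
      using N2 by blast
    obtain D where D: "D > 0" "deriv_bound K ?L D (\<lambda>x. 1 / s x)"
      using deriv_bound_compact[OF S(1) K(1) S(2) iss] by blast
    define C3 where "C3 = mult_decay_const K c l"
    have C3: "C3 > 0" unfolding C3_def by (rule mult_decay_const_pos[OF c(1)])
    define M where "M = measure lborel K1 * (D1 * C1) + C2"
    have M: "M > 0" using D1(1) C1(1) C2(1) unfolding M_def by (intro add_nonneg_pos mult_nonneg_nonneg) auto
    define C where "C = C3 * (2 ^ ?L * D) * M"
    have C: "C > 0" using C3 D(1) M by (simp add: C_def)
    have ev: "\<forall>\<^sub>F \<epsilon> in at_right 0. \<forall>\<xi>\<in>\<Gamma>'. \<forall>w A. 0 \<le> A \<longrightarrow> smooth_on UNIV w \<longrightarrow>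
     (\<forall>x. x \<notin> K \<longrightarrow> w x = 0) \<longrightarrow> deriv_bound K ?L A w \<longrightarrow>
     norm (fourier (\<lambda>x. w x * v \<epsilon> x) \<xi>) * (1 + norm \<xi>) ^ l \<le> C * A * \<epsilon> powr (- N)"
      using C1(2) C2(2) eventually_unit
    proof eventually_elim
      case (elim \<epsilon>)
      have v\<epsilon>: "smooth_on \<Omega> (v \<epsilon>)" using v elim by (auto simp: moderate_nets_def)
      define g where "g = (\<lambda>x. s x * v \<epsilon> x)"
      have "smooth_on UNIV (\<lambda>x. v \<epsilon> x * s x)"
        using smooth_on_mult_extend[OF \<Omega> v\<epsilon> sm K1(1) _ s0] K1(2) U(2) by blast
      hence gc: "continuous_on UNIV g" using smooth_on_continuous by (simp add: g_def mult.commute)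
      have g0: "x \<notin> K1 \<Longrightarrow> g x = 0" for x by (simp add: g_def s0)
      have p: "\<epsilon> powr (- N1) \<le> \<epsilon> powr (- N)" "\<epsilon> powr (- N2) \<le> \<epsilon> powr (- N)"
        using elim by (auto intro!: powr_le_powr_small simp: N_def)
      have g1: "norm (g x) \<le> (D1 * C1) * \<epsilon> powr (- N)" for x
      proof (cases "x \<in> K1")
        case True
        have "norm (g x) \<le> D1 * (C1 * \<epsilon> powr (- N1))"
          unfolding g_def norm_mult using deriv_bound_normD[OF D1(2) True] elim True D1(1) by (intro mult_mono) auto
        also have "\<dots> \<le> D1 * (C1 * \<epsilon> powr (- N))" using p C1(1) D1(1) by (intro mult_left_mono) auto
        finally show ?thesis by (simp add: mult.assoc)
      qed (use g0 D1(1) C1(1) in simp)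
      define B where "B = measure lborel K1 * (D1 * C1) * \<epsilon> powr (- N)"
      have B: "norm (fourier g \<zeta>) \<le> B" for \<zeta>
        using norm_fourier_le[OF K1(1) g0 gc g1, of \<zeta>] by (simp add: B_def mult.assoc)
      define B' where "B' = C2 * \<epsilon> powr (- N)"
      have B'0: "0 \<le> B'" using C2(1) by (simp add: B'_def)
      have BB: "B + B' = M * \<epsilon> powr (- N)" by (simp add: B_def B'_def M_def algebra_simps)
      show ?case
      proof (intro ballI allI impI)
        fix \<xi> w A
        assume \<xi>: "\<xi> \<in> \<Gamma>'" and A: "0 \<le> (A::real)" and w: "smooth_on UNIV w" "\<forall>x. x \<notin> K \<longrightarrow> w x = 0" "deriv_bound K ?L A w"
        define w' where "w' = (\<lambda>x. w x * (1 / s x))"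
        have w'0: "\<forall>x. x \<notin> K \<longrightarrow> w' x = 0" using w(2) by (simp add: w'_def)
        have "smooth_on S w'" unfolding w'_def
          by (intro smooth_on_mult S(1) iss smooth_on_subset[OF w(1)]) auto
        hence w's: "smooth_on UNIV w'"
          using smooth_on_extend_zero[OF S(1) _ compact_imp_closed[OF K(1)] S(2)] w'0 by blast
        have "deriv_bound K ?L (2 ^ ?L * A * D) w'" unfolding w'_def
          using smooth_on_subset[OF w(1)] A D
          by (intro deriv_bound_mult[OF S _ iss w(3) D(2)]) auto
        hence w'b: "deriv_bound UNIV ?L (2 ^ ?L * A * D) w'"
          using deriv_bound_extend[OF compact_imp_closed[OF K(1)]] w'0 A D(1) by simp
        have near: "norm (fourier g (\<xi> - \<eta>)) * (1 + norm (\<xi> - \<eta>)) ^ l \<le> B'" if "norm \<eta> \<le> c * norm \<xi>" for \<eta>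
        proof -
          have "0 < (1 + norm (\<xi> - \<eta>)) ^ l" by (intro zero_less_power) (simp add: add_pos_nonneg)
          moreover have "norm (fourier g (\<xi> - \<eta>)) \<le> C2 * \<epsilon> powr (- N2) / (1 + norm (\<xi> - \<eta>)) ^ l"
            using elim cone[OF \<xi> that] by (simp add: g_def)
          ultimately have "norm (fourier g (\<xi> - \<eta>)) * (1 + norm (\<xi> - \<eta>)) ^ l \<le> C2 * \<epsilon> powr (- N2)"
            by (simp add: pos_le_divide_eq)
          also have "\<dots> \<le> B'" unfolding B'_def using p C2(1) by (intro mult_left_mono) auto
          finally show ?thesis .
        qed
        have "w x * v \<epsilon> x = w' x * g x" for x
          using w(2) s(2)[of x] by (cases "x \<in> K") (auto simp: w'_def g_def)
        hence "norm (fourier (\<lambda>x. w x * v \<epsilon> x) \<xi>) * (1 + norm \<xi>) ^ l =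
            norm (fourier (\<lambda>x. w' x * g x) \<xi>) * (1 + norm \<xi>) ^ l" by simp
        also have "\<dots> \<le> C3 * (2 ^ ?L * A * D) * (B + B')"
          unfolding C3_def using near B g0 A D(1) w'0
          by (intro fourier_mult_decay[OF K(1) c w's _ w'b gc K1(1) _ _ B'0]) auto
        also have "\<dots> = C * A * \<epsilon> powr (- N)" unfolding BB by (simp add: C_def mult_ac)
        finally show "norm (fourier (\<lambda>x. w x * v \<epsilon> x) \<xi>) * (1 + norm \<xi>) ^ l \<le> C * A * \<epsilon> powr (- N)" .
      qed
    qed
    show "\<exists>C>0. \<forall>\<^sub>F \<epsilon> in at_right 0. \<forall>\<xi>\<in>\<Gamma>'. \<forall>w A. 0 \<le> A \<longrightarrow> smooth_on UNIV w \<longrightarrow>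
     (\<forall>x. x \<notin> K \<longrightarrow> w x = 0) \<longrightarrow> deriv_bound K ?L A w \<longrightarrow>
     norm (fourier (\<lambda>x. w x * v \<epsilon> x) \<xi>) * (1 + norm \<xi>) ^ l \<le> C * A * \<epsilon> powr (- N)"
      using C ev by blast
  qed
qed

section \<open>High frequencies and slow scales\<close>

text \<open>The regions \<open>\<bar>\<xi>\<bar> \<ge> \<epsilon>\<^bsup>-\<delta>\<^esup>\<close> for all \<open>\<delta> > 0\<close>, each at small \<open>\<epsilon>\<close>. A slow scale net \<open>r\<close> is eventually
  below each \<open>\<epsilon>\<^bsup>-\<delta>\<^esup>\<close>, so what holds for \<open>\<bar>\<xi>\<bar> \<ge> r\<^sub>\<epsilon>\<close> holds eventually for this filter, and conditions with
  different thresholds \<open>r\<close> can be combined.\<close>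

definition high_freq :: "(real \<times> (real ^ 'n)) filter" where
  "high_freq = Abs_filter (\<lambda>P. \<forall>\<delta>>0. \<forall>\<^sub>F \<epsilon> in at_right 0. \<forall>\<xi>. \<epsilon> powr (- \<delta>) \<le> norm \<xi> \<longrightarrow> P (\<epsilon>, \<xi>))"

lemma eventually_high_freq:
  "eventually P high_freq \<longleftrightarrow> (\<forall>\<delta>>0. \<forall>\<^sub>F \<epsilon> in at_right 0. \<forall>\<xi>. \<epsilon> powr (- \<delta>) \<le> norm \<xi> \<longrightarrow> P (\<epsilon>, \<xi>))"
  unfolding high_freq_def
proof (rule eventually_Abs_filter, rule is_filter.intro)
  show "\<forall>\<delta>>0. \<forall>\<^sub>F \<epsilon> in at_right 0. \<forall>\<xi>. \<epsilon> powr (- \<delta>) \<le> norm \<xi> \<longrightarrow> True" by simp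
next
  fix P Q :: "real \<times> (real ^ 'n) \<Rightarrow> bool"
  assume P: "\<forall>\<delta>>0. \<forall>\<^sub>F \<epsilon> in at_right 0. \<forall>\<xi>. \<epsilon> powr (- \<delta>) \<le> norm \<xi> \<longrightarrow> P (\<epsilon>, \<xi>)"
  show "\<forall>\<delta>>0. \<forall>\<^sub>F \<epsilon> in at_right 0. \<forall>\<xi>. \<epsilon> powr (- \<delta>) \<le> norm \<xi> \<longrightarrow> Q (\<epsilon>, \<xi>)" if "\<forall>z. P z \<longrightarrow> Q z"
    using P that by (auto elim!: eventually_mono)
  assume Q: "\<forall>\<delta>>0. \<forall>\<^sub>F \<epsilon> in at_right 0. \<forall>\<xi>. \<epsilon> powr (- \<delta>) \<le> norm \<xi> \<longrightarrow> Q (\<epsilon>, \<xi>)"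
  show "\<forall>\<delta>>0. \<forall>\<^sub>F \<epsilon> in at_right 0. \<forall>\<xi>. \<epsilon> powr (- \<delta>) \<le> norm \<xi> \<longrightarrow> P (\<epsilon>, \<xi>) \<and> Q (\<epsilon>, \<xi>)"
  proof (intro allI impI)
    fix \<delta> :: real assume "\<delta> > 0"
    hence "\<forall>\<^sub>F \<epsilon> in at_right 0. \<forall>\<xi>. \<epsilon> powr (- \<delta>) \<le> norm \<xi> \<longrightarrow> P (\<epsilon>, \<xi>)"
      "\<forall>\<^sub>F \<epsilon> in at_right 0. \<forall>\<xi>. \<epsilon> powr (- \<delta>) \<le> norm \<xi> \<longrightarrow> Q (\<epsilon>, \<xi>)" using P Q by auto
    thus "\<forall>\<^sub>F \<epsilon> in at_right 0. \<forall>\<xi>. \<epsilon> powr (- \<delta>) \<le> norm \<xi> \<longrightarrow> P (\<epsilon>, \<xi>) \<and> Q (\<epsilon>, \<xi>)"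
      by eventually_elim blast
  qed
qed

lemma eventually_high_freq_fst:
  assumes "\<forall>\<^sub>F \<epsilon> in at_right 0. P \<epsilon>"
  shows "\<forall>\<^sub>F z in high_freq. P (fst z)"
  unfolding eventually_high_freq
proof (intro allI impI)
  show "\<forall>\<^sub>F \<epsilon> in at_right 0. \<forall>\<xi>. \<epsilon> powr (- \<delta>) \<le> norm \<xi> \<longrightarrow> P (fst (\<epsilon>, \<xi>))" for \<delta>
    using assms by eventually_elim simp
qed

lemma const_le_powr_small:
  assumes "\<delta> > 0" shows "\<forall>\<^sub>F \<epsilon> in at_right (0::real). C \<le> \<epsilon> powr (- \<delta>)"
proof -
  have "filterlim (\<lambda>\<epsilon>::real. \<epsilon> powr (- \<delta>)) at_top (at_right 0)"
    using assms by real_asymp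
  thus ?thesis by (simp add: filterlim_at_top)
qed

lemma slow_scale_le_powr:
  assumes "pos_slow_scale r" "\<delta> > 0"
  shows "\<forall>\<^sub>F \<epsilon> in at_right 0. r \<epsilon> \<le> \<epsilon> powr (- \<delta>)"
proof -
  have "\<forall>\<^sub>F \<epsilon> in at_right 0. norm (r \<epsilon>) powr (1 / \<delta>) \<le> inverse \<epsilon>"
    using assms unfolding pos_slow_scale_def slow_scale_def by simp
  thus ?thesis using eventually_unit
  proof eventually_elim
    case (elim \<epsilon>)
    have r: "r \<epsilon> > 0" using assms(1) elim by (auto simp: pos_slow_scale_def)
    have "(r \<epsilon> powr (1 / \<delta>)) powr \<delta> \<le> inverse \<epsilon> powr \<delta>"
      using elim r assms(2) by (intro powr_mono2) auto
    thus ?case using r elim assms(2) by (simp add: powr_powr powr_minus inverse_powr)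
  qed
qed

lemma slow_scale_high_freq:
  assumes r: "pos_slow_scale r" and Q: "\<forall>\<^sub>F \<epsilon> in at_right 0. \<forall>\<xi>. r \<epsilon> \<le> norm \<xi> \<longrightarrow> Q \<epsilon> \<xi>"
  shows "\<forall>\<^sub>F z in high_freq. Q (fst z) (snd z)"
  unfolding eventually_high_freq
proof (intro allI impI)
  fix \<delta> :: real assume "\<delta> > 0"
  from slow_scale_le_powr[OF r this] Q
  show "\<forall>\<^sub>F \<epsilon> in at_right 0. \<forall>\<xi>. \<epsilon> powr (- \<delta>) \<le> norm \<xi> \<longrightarrow> Q (fst (\<epsilon>, \<xi>)) (snd (\<epsilon>, \<xi>))"
    by eventually_elim auto
qed

text \<open>At low frequencies \<open>(1 + \<bar>\<xi>\<bar>)\<^sup>l\<close> is at most \<open>(2\<epsilon>\<^bsup>-\<delta>\<^esup>)\<^sup>l \<le> 2\<^sup>l/\<epsilon>\<close> if \<open>\<delta> = 1/(l+1)\<close>. Rapid decay thus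
  has to be shown at high frequencies only, at the price of one more power of \<open>1/\<epsilon>\<close>.\<close>

lemma low_high_freq:
  fixes F :: "real \<Rightarrow> real ^ 'n \<Rightarrow> real"
  assumes low: "\<forall>\<^sub>F \<epsilon> in at_right 0. \<forall>\<xi>. F \<epsilon> \<xi> \<le> C1 * \<epsilon> powr (- N1)" and "C1 > 0"
    and high: "\<forall>\<^sub>F z in high_freq. snd z \<in> \<Gamma> \<longrightarrow> F (fst z) (snd z) * (1 + norm (snd z)) ^ l \<le> C2 * fst z powr (- N2)" and "C2 > 0"
  shows "\<exists>C>0. \<forall>\<^sub>F \<epsilon> in at_right 0. \<forall>\<xi>\<in>\<Gamma>. F \<epsilon> \<xi> \<le> C * \<epsilon> powr (- (max N1 N2 + 1)) / (1 + norm \<xi>) ^ l"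
proof -
  define N where "N = max N1 N2 + 1"
  define \<delta> where "\<delta> = 1 / (real l + 1)"
  have \<delta>: "\<delta> > 0" "\<delta> * real l \<le> 1" by (auto simp: \<delta>_def field_simps)
  define C where "C = C1 * 2 ^ l + C2"
  have C: "C > 0" using assms by (auto simp: C_def intro: add_pos_pos)
  have h: "\<forall>\<^sub>F \<epsilon> in at_right 0. \<forall>\<xi>. \<epsilon> powr (- \<delta>) \<le> norm \<xi> \<longrightarrow> \<xi> \<in> \<Gamma> \<longrightarrow> F \<epsilon> \<xi> * (1 + norm \<xi>) ^ l \<le> C2 * \<epsilon> powr (- N2)"
    using high \<delta>(1) unfolding eventually_high_freq by simp
  have "\<forall>\<^sub>F \<epsilon> in at_right 0. \<forall>\<xi>\<in>\<Gamma>. F \<epsilon> \<xi> \<le> C * \<epsilon> powr (- N) / (1 + norm \<xi>) ^ l"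
    using low h eventually_unit
  proof eventually_elim
    case (elim \<epsilon>)
    have e: "0 < \<epsilon>" "\<epsilon> < 1" using elim by auto
    show ?case
    proof
      fix \<xi> assume \<xi>: "\<xi> \<in> \<Gamma>"
      have pos: "(1 + norm \<xi>) ^ l > 0" by (intro zero_less_power) (simp add: add_pos_nonneg)
      have "F \<epsilon> \<xi> * (1 + norm \<xi>) ^ l \<le> C * \<epsilon> powr (- N)"
      proof (cases "\<epsilon> powr (- \<delta>) \<le> norm \<xi>")
        case True
        hence "F \<epsilon> \<xi> * (1 + norm \<xi>) ^ l \<le> C2 * \<epsilon> powr (- N2)" using elim \<xi> by blast
        also have "\<dots> \<le> C * \<epsilon> powr (- N)"
          using e assms by (intro mult_mono powr_le_powr_small) (auto simp: C_def N_def)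
        finally show ?thesis .
      next
        case False
        have "1 \<le> \<epsilon> powr (- \<delta>)" using e \<delta> by (intro ge_one_powr_ge_zero[of "inverse \<epsilon>" \<delta>, unfolded inverse_powr powr_minus[symmetric]]) (auto simp: one_le_inverse powr_minus inverse_powr)
        hence "1 + norm \<xi> \<le> 2 * \<epsilon> powr (- \<delta>)" using False by linarith
        hence "(1 + norm \<xi>) ^ l \<le> (2 * \<epsilon> powr (- \<delta>)) ^ l" by (intro power_mono) auto
        also have "\<dots> = 2 ^ l * \<epsilon> powr (- (\<delta> * real l))"
          using e by (simp add: power_mult_distrib powr_realpow[symmetric] powr_powr)
        also have "\<dots> \<le> 2 ^ l * \<epsilon> powr (- 1)"
          using e \<delta> by (intro mult_left_mono powr_le_powr_small) auto
        finally have b: "(1 + norm \<xi>) ^ l \<le> 2 ^ l * \<epsilon> powr (- 1)" .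
        have "F \<epsilon> \<xi> * (1 + norm \<xi>) ^ l \<le> (C1 * \<epsilon> powr (- N1)) * (1 + norm \<xi>) ^ l"
          using elim pos by (intro mult_right_mono) auto
        also have "\<dots> \<le> (C1 * \<epsilon> powr (- N1)) * (2 ^ l * \<epsilon> powr (- 1))"
          using b assms by (intro mult_left_mono) auto
        also have "\<dots> = (C1 * 2 ^ l) * \<epsilon> powr (- (N1 + 1))"
        proof -
          have "- N1 + - 1 = - (N1 + 1)" by simp
          hence "\<epsilon> powr (- (N1 + 1)) = \<epsilon> powr (- N1) * \<epsilon> powr (- 1)" by (metis powr_add)
          thus ?thesis by (simp only: mult_ac)
        qed
        also have "\<dots> \<le> C * \<epsilon> powr (- N)"
          using e assms by (intro mult_mono powr_le_powr_small) (auto simp: C_def N_def)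
        finally show ?thesis .
      qed
      thus "F \<epsilon> \<xi> \<le> C * \<epsilon> powr (- N) / (1 + norm \<xi>) ^ l" using pos by (simp add: pos_le_divide_eq)
    qed
  qed
  thus ?thesis using C unfolding N_def by blast
qed

section \<open>Slow-scale symbols\<close>

text \<open>Families of functions on \<open>V\<close>, indexed by \<open>z = (\<epsilon>, \<xi>)\<close>, whose derivatives exceed the weight \<open>W\<close> by
  slow scale factors only. Estimating such factors by \<open>\<epsilon>\<^bsup>-\<delta>\<^esup>\<close> for every \<open>\<delta> > 0\<close>
  keeps the class closed under sums and products.\<close>

definition slow_symbol ::
    "(real ^ 'n) set \<Rightarrow> nat \<Rightarrow> (real \<times> (real ^ 'n) \<Rightarrow> real) \<Rightarrow> (real \<times> (real ^ 'n) \<Rightarrow> real ^ 'n \<Rightarrow> complex) \<Rightarrow> bool" where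
  "slow_symbol V L W G \<longleftrightarrow> (\<forall>\<^sub>F z in high_freq. smooth_on V (G z)) \<and>
     (\<forall>\<delta>>0. \<forall>\<^sub>F z in high_freq. deriv_bound V L (fst z powr (- \<delta>) * W z) (G z))"

lemma eventually_hf_unit: "\<forall>\<^sub>F z in high_freq. 0 < fst z \<and> fst z < 1"
  by (rule eventually_high_freq_fst[OF eventually_unit])

lemma eventually_hf_const: "\<delta> > 0 \<Longrightarrow> \<forall>\<^sub>F z in high_freq. C \<le> fst z powr (- \<delta>)"
  by (rule eventually_high_freq_fst[OF const_le_powr_small])

lemma slow_symbol_smooth: "slow_symbol V L W G \<Longrightarrow> \<forall>\<^sub>F z in high_freq. smooth_on V (G z)"
  by (simp add: slow_symbol_def)

lemma slow_symbol_bound: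
  "slow_symbol V L W G \<Longrightarrow> \<delta> > 0 \<Longrightarrow> \<forall>\<^sub>F z in high_freq. deriv_bound V L (fst z powr (- \<delta>) * W z) (G z)"
  by (simp add: slow_symbol_def)

lemma slow_symbolI:
  assumes "\<forall>\<^sub>F z in high_freq. smooth_on V (G z)"
    and "\<And>\<delta>. \<delta> > 0 \<Longrightarrow> \<forall>\<^sub>F z in high_freq. deriv_bound V L (fst z powr (- \<delta>) * W z) (G z)"
  shows "slow_symbol V L W G"
  using assms by (simp add: slow_symbol_def)

lemma slow_symbol_mono:
  assumes "slow_symbol V L W G" "K \<le> L" "\<forall>\<^sub>F z in high_freq. W z \<le> W' z"
  shows "slow_symbol V K W' G"
proof (rule slow_symbolI[OF slow_symbol_smooth[OF assms(1)]])
  fix \<delta> :: real assume "\<delta> > 0"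
  from slow_symbol_bound[OF assms(1) this] assms(3)
  show "\<forall>\<^sub>F z in high_freq. deriv_bound V K (fst z powr (- \<delta>) * W' z) (G z)"
    by eventually_elim (erule deriv_bound_mono[OF _ order.refl assms(2)], simp add: mult_left_mono)
qed

lemma slow_symbol_cong:
  assumes V: "open V" and G: "slow_symbol V L W G" and eq: "\<forall>\<^sub>F z in high_freq. \<forall>x\<in>V. G z x = H z x"
  shows "slow_symbol V L W H"
proof (rule slow_symbolI)
  show "\<forall>\<^sub>F z in high_freq. smooth_on V (H z)"
    using slow_symbol_smooth[OF G] eq
  proof eventually_elim
    case (elim z) show ?case by (rule smooth_on_cong[OF V elim(1)]) (use elim(2) in blast)
  qed
  fix \<delta> :: real assume "\<delta> > 0"
  from slow_symbol_bound[OF G this] eq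
  show "\<forall>\<^sub>F z in high_freq. deriv_bound V L (fst z powr (- \<delta>) * W z) (H z)"
  proof eventually_elim
    case (elim z) show ?case by (rule deriv_bound_cong[OF V order.refl elim(1)]) (use elim(2) in blast)
  qed
qed

lemma slow_symbol_add:
  assumes V: "open V" and W: "\<And>z. 0 \<le> W z" and G: "slow_symbol V L W G" and H: "slow_symbol V L W H"
  shows "slow_symbol V L W (\<lambda>z x. G z x + H z x)"
proof (rule slow_symbolI)
  show "\<forall>\<^sub>F z in high_freq. smooth_on V (\<lambda>x. G z x + H z x)"
    using slow_symbol_smooth[OF G] slow_symbol_smooth[OF H]
    by eventually_elim (rule smooth_on_add[OF V])
  fix \<delta> :: real assume \<delta>: "\<delta> > 0"
  hence "\<delta>/2 > 0" by simp
  from slow_symbol_bound[OF G this] slow_symbol_bound[OF H this] eventually_hf_const[OF this, of 2]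
    slow_symbol_smooth[OF G] slow_symbol_smooth[OF H] eventually_hf_unit
  show "\<forall>\<^sub>F z in high_freq. deriv_bound V L (fst z powr (- \<delta>) * W z) (\<lambda>x. G z x + H z x)"
  proof eventually_elim
    case (elim z)
    have "fst z powr (- (\<delta>/2)) * W z + fst z powr (- (\<delta>/2)) * W z = 2 * (fst z powr (- (\<delta>/2)) * W z)" by simp
    also have "\<dots> \<le> fst z powr (- (\<delta>/2)) * (fst z powr (- (\<delta>/2)) * W z)"
      using elim W[of z] by (intro mult_right_mono) auto
    also have "\<dots> = fst z powr (- \<delta>) * W z" using elim by (simp add: mult.assoc[symmetric] powr_add[symmetric])
    finally show ?case
      by (rule deriv_bound_mono[OF deriv_bound_add[OF V order.refl elim(4,5,1,2)] order.refl order.refl])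
  qed
qed

text \<open>The three factors, of which one absorbs the constant of the product rule, are each given
  \<open>\<epsilon>\<^bsup>-\<delta>/3\<^esup>\<close>. Since \<open>\<delta>\<close> is arbitrary, nothing is lost.\<close>

lemma slow_symbol_mult:
  assumes V: "open V" and W: "\<And>z. 0 \<le> W z" "\<And>z. 0 \<le> W' z"
    and G: "slow_symbol V L W G" and H: "slow_symbol V L W' H"
  shows "slow_symbol V L (\<lambda>z. W z * W' z) (\<lambda>z x. G z x * H z x)"
proof (rule slow_symbolI)
  show "\<forall>\<^sub>F z in high_freq. smooth_on V (\<lambda>x. G z x * H z x)"
    using slow_symbol_smooth[OF G] slow_symbol_smooth[OF H]
    by eventually_elim (rule smooth_on_mult[OF V])
  fix \<delta> :: real assume \<delta>: "\<delta> > 0"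
  hence "\<delta>/3 > 0" by simp
  from slow_symbol_bound[OF G this] slow_symbol_bound[OF H this] eventually_hf_const[OF this, of "2 ^ L"]
    slow_symbol_smooth[OF G] slow_symbol_smooth[OF H] eventually_hf_unit
  show "\<forall>\<^sub>F z in high_freq. deriv_bound V L (fst z powr (- \<delta>) * (W z * W' z)) (\<lambda>x. G z x * H z x)"
  proof eventually_elim
    case (elim z)
    let ?e = "fst z powr (- (\<delta>/3))"
    have "deriv_bound V L (2 ^ L * (?e * W z) * (?e * W' z)) (\<lambda>x. G z x * H z x)"
      using W by (intro deriv_bound_mult[OF V order.refl elim(4,5,1,2)]) auto
    moreover have "2 ^ L * (?e * W z) * (?e * W' z) \<le> fst z powr (- \<delta>) * (W z * W' z)"
    proof -
      have "2 ^ L * (?e * W z) * (?e * W' z) = 2 ^ L * (?e * ?e * (W z * W' z))" by (simp add: mult_ac)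
      also have "\<dots> \<le> ?e * (?e * ?e * (W z * W' z))"
        using elim W by (intro mult_right_mono mult_nonneg_nonneg) auto
      also have "\<dots> = (?e * ?e * ?e) * (W z * W' z)" by (simp add: mult_ac)
      also have "?e * ?e * ?e = fst z powr (- \<delta>)" using elim by (simp add: powr_add[symmetric])
      finally show ?thesis .
    qed
    ultimately show ?case by (rule deriv_bound_mono[OF _ order.refl order.refl])
  qed
qed

lemma slow_symbol_fixed:
  assumes V: "open V" and \<phi>: "smooth_on V \<phi>" "deriv_bound V L A \<phi>"
  shows "slow_symbol V L (\<lambda>_. 1) (\<lambda>_. \<phi>)"
proof (rule slow_symbolI)
  fix \<delta> :: real assume "\<delta> > 0"
  from eventually_hf_const[OF this, of A]
  show "\<forall>\<^sub>F z in high_freq. deriv_bound V L (fst z powr (- \<delta>) * 1) \<phi>"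
    by eventually_elim (rule deriv_bound_mono[OF \<phi>(2)], auto)
qed (use \<phi> in simp)

lemma slow_symbol_cmult:
  assumes V: "open V" and W: "\<And>z. 0 \<le> W z" and G: "slow_symbol V L W G"
  shows "slow_symbol V L W (\<lambda>z x. c * G z x)"
proof -
  have "slow_symbol V L (\<lambda>_. 1) (\<lambda>_ _. c)"
    by (rule slow_symbol_fixed[OF V smooth_on_const[OF V] deriv_bound_const[OF order.refl]])
  from slow_symbol_mult[OF V _ W this G] show ?thesis by simp
qed

lemma slow_symbol_sum:
  assumes V: "open V" and W: "\<And>z. 0 \<le> W z" and "finite I" and G: "\<And>i. i \<in> I \<Longrightarrow> slow_symbol V L W (G i)"
  shows "slow_symbol V L W (\<lambda>z x. \<Sum>i\<in>I. G i z x)"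
  using assms(3) G
proof (induction I)
  case empty
  show ?case
    by (rule slow_symbolI) (use W in \<open>auto intro!: deriv_bound_const always_eventually smooth_on_const[OF V]\<close>)
next
  case (insert i I)
  have "slow_symbol V L W (\<lambda>z x. G i z x + (\<Sum>i\<in>I. G i z x))"
    by (rule slow_symbol_add[OF V W]) (use insert in auto)
  thus ?case using insert.hyps by simp
qed

lemma slow_symbol_mi_deriv:
  assumes "slow_symbol V (mi_order \<beta> + L) W G"
  shows "slow_symbol V L W (\<lambda>z. mi_deriv \<beta> (G z))"
proof (rule slow_symbolI)
  show "\<forall>\<^sub>F z in high_freq. smooth_on V (mi_deriv \<beta> (G z))"
    using slow_symbol_smooth[OF assms] by eventually_elim (rule smooth_on_mi_deriv)
  fix \<delta> :: real assume "\<delta> > 0"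
  from slow_symbol_bound[OF assms this]
  show "\<forall>\<^sub>F z in high_freq. deriv_bound V L (fst z powr (- \<delta>) * W z) (mi_deriv \<beta> (G z))"
    by eventually_elim (rule deriv_bound_mi_deriv)
qed

lemma slow_symbol_Suc:
  assumes "slow_symbol V 0 W G" "\<And>j. slow_symbol V L W (\<lambda>z. partial_deriv j (G z))"
  shows "slow_symbol V (Suc L) W G"
proof (rule slow_symbolI[OF slow_symbol_smooth[OF assms(1)]])
  fix \<delta> :: real assume \<delta>: "\<delta> > 0"
  have "\<forall>\<^sub>F z in high_freq. \<forall>j\<in>UNIV. deriv_bound V L (fst z powr (- \<delta>) * W z) (partial_deriv j (G z))"
    by (intro eventually_ball_finite ballI slow_symbol_bound[OF assms(2) \<delta>]) auto
  with slow_symbol_bound[OF assms(1) \<delta>]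
  show "\<forall>\<^sub>F z in high_freq. deriv_bound V (Suc L) (fst z powr (- \<delta>) * W z) (G z)"
    by eventually_elim (simp add: deriv_bound_Suc deriv_bound_0)
qed

text \<open>The form of the second condition of ellipticity: the bound at a point is relative to the value of \<open>P\<close>
  at the same point.\<close>

definition relative_bound ::
    "(real ^ 'n) set \<Rightarrow> (real \<times> (real ^ 'n) \<Rightarrow> real ^ 'n \<Rightarrow> complex) \<Rightarrow> nat \<Rightarrow> (real \<times> (real ^ 'n) \<Rightarrow> real) \<Rightarrow>
     (real \<times> (real ^ 'n) \<Rightarrow> real ^ 'n \<Rightarrow> complex) \<Rightarrow> bool" where
  "relative_bound V P L W Q \<longleftrightarrow> (\<forall>\<^sub>F z in high_freq. smooth_on V (Q z)) \<and>
     (\<forall>\<delta>>0. \<forall>\<^sub>F z in high_freq. \<forall>js x. length js \<le> L \<longrightarrow> x \<in> V \<longrightarrow>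
        norm (iter_deriv js (Q z) x) \<le> fst z powr (- \<delta>) * W z * norm (P z x))"

lemma relative_bound_partial:
  assumes "relative_bound V P (Suc L) W Q"
  shows "relative_bound V P L W (\<lambda>z. partial_deriv j (Q z))"
  unfolding relative_bound_def
proof (intro conjI allI impI)
  show "\<forall>\<^sub>F z in high_freq. smooth_on V (partial_deriv j (Q z))"
    using assms unfolding relative_bound_def by (auto elim!: eventually_mono intro: smooth_on_partial)
  fix \<delta> :: real assume "\<delta> > 0"
  hence "\<forall>\<^sub>F z in high_freq. \<forall>js x. length js \<le> Suc L \<longrightarrow> x \<in> V \<longrightarrow>
        norm (iter_deriv js (Q z) x) \<le> fst z powr (- \<delta>) * W z * norm (P z x)"
    using assms unfolding relative_bound_def by blast
  thus "\<forall>\<^sub>F z in high_freq. \<forall>js x. length js \<le> L \<longrightarrow> x \<in> V \<longrightarrow>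
        norm (iter_deriv js (partial_deriv j (Q z)) x) \<le> fst z powr (- \<delta>) * W z * norm (P z x)"
  proof eventually_elim
    case (elim z)
    show ?case
    proof (intro allI impI)
      fix js :: "'a list" and x assume "length js \<le> L" "x \<in> V"
      thus "norm (iter_deriv js (partial_deriv j (Q z)) x) \<le> fst z powr (- \<delta>) * W z * norm (P z x)"
        using elim[rule_format, of "js @ [j]" x] by (simp add: iter_deriv_append)
    qed
  qed
qed

lemma relative_bound_mono: "relative_bound V P L W Q \<Longrightarrow> K \<le> L \<Longrightarrow> relative_bound V P K W Q"
  unfolding relative_bound_def
proof (intro conjI allI impI; elim conjE)
  fix \<delta> :: real assume "\<delta> > 0" and KL: "K \<le> L"
    and *: "\<forall>\<delta>>0. \<forall>\<^sub>F z in high_freq. \<forall>js x. length js \<le> L \<longrightarrow> x \<in> V \<longrightarrow>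
        norm (iter_deriv js (Q z) x) \<le> fst z powr (- \<delta>) * W z * norm (P z x)"
  hence "\<forall>\<^sub>F z in high_freq. \<forall>js x. length js \<le> L \<longrightarrow> x \<in> V \<longrightarrow>
        norm (iter_deriv js (Q z) x) \<le> fst z powr (- \<delta>) * W z * norm (P z x)" by blast
  thus "\<forall>\<^sub>F z in high_freq. \<forall>js x. length js \<le> K \<longrightarrow> x \<in> V \<longrightarrow>
        norm (iter_deriv js (Q z) x) \<le> fst z powr (- \<delta>) * W z * norm (P z x)"
    by eventually_elim (use KL in auto)
qed

text \<open>Induction on the number of derivatives: in
  \<open>\<partial>\<^sub>j(Q/P) = \<partial>\<^sub>jQ/P - (Q/P)(\<partial>\<^sub>jP/P)\<close> every factor is again a quotient of the kind considered.\<close>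

lemma slow_symbol_quotient:
  assumes V: "open V" and P0: "\<forall>\<^sub>F z in high_freq. \<forall>x\<in>V. P z x \<noteq> 0"
    and P: "\<And>L. relative_bound V P L (\<lambda>_. 1) P"
    and W: "\<And>z. 0 \<le> W z" and Q: "relative_bound V P L W Q"
  shows "slow_symbol V L W (\<lambda>z x. Q z x / P z x)"
  using Q W
proof (induction L arbitrary: Q W)
  have sm: "\<forall>\<^sub>F z in high_freq. smooth_on V (\<lambda>x. Q z x / P z x)"
    if "relative_bound V P L W Q" for Q L W
  proof -
    have "\<forall>\<^sub>F z in high_freq. smooth_on V (Q z)" "\<forall>\<^sub>F z in high_freq. smooth_on V (P z)"
      using that P unfolding relative_bound_def by auto
    with P0 show ?thesis by eventually_elim (rule smooth_on_divide[OF V], auto)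
  qed
  have base: "slow_symbol V 0 W (\<lambda>z x. Q z x / P z x)" if Q: "relative_bound V P 0 W Q" for Q W
  proof (rule slow_symbolI[OF sm[OF Q]])
    fix \<delta> :: real assume "\<delta> > 0"
    hence "\<forall>\<^sub>F z in high_freq. \<forall>js x. length js \<le> 0 \<longrightarrow> x \<in> V \<longrightarrow>
        norm (iter_deriv js (Q z) x) \<le> fst z powr (- \<delta>) * W z * norm (P z x)"
      using Q unfolding relative_bound_def by blast
    with P0 show "\<forall>\<^sub>F z in high_freq. deriv_bound V 0 (fst z powr (- \<delta>) * W z) (\<lambda>x. Q z x / P z x)"
      by eventually_elim (auto simp: deriv_bound_0 norm_divide pos_divide_le_eq)
  qed
  {
    case 0
    thus ?case by (intro base)
  next
    case (Suc L)
    show ?case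
    proof (rule slow_symbol_Suc[OF base[OF relative_bound_mono[OF Suc.prems(1)]]])
      fix j
      have 1: "slow_symbol V L W (\<lambda>z x. partial_deriv j (Q z) x / P z x)"
        by (rule Suc.IH[OF relative_bound_partial[OF Suc.prems(1)] Suc.prems(2)])
      have 2: "slow_symbol V L W (\<lambda>z x. Q z x / P z x)"
        by (rule Suc.IH[OF relative_bound_mono[OF Suc.prems(1)] Suc.prems(2)]) simp
      have 3: "slow_symbol V L (\<lambda>_. 1) (\<lambda>z x. partial_deriv j (P z) x / P z x)"
        by (rule Suc.IH[OF relative_bound_partial[OF P]]) simp
      have 4: "slow_symbol V L (\<lambda>z. W z * 1) (\<lambda>z x. (Q z x / P z x) * (partial_deriv j (P z) x / P z x))"
        by (rule slow_symbol_mult[OF V Suc.prems(2) _ 2 3]) simp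
      have 5: "slow_symbol V L W (\<lambda>z x. partial_deriv j (Q z) x / P z x + (- 1) * ((Q z x / P z x) * (partial_deriv j (P z) x / P z x)))"
        using 4 by (intro slow_symbol_add[OF V Suc.prems(2) 1] slow_symbol_cmult[OF V Suc.prems(2)]) simp
      have sQ: "\<forall>\<^sub>F z in high_freq. smooth_on V (Q z)" and sP: "\<forall>\<^sub>F z in high_freq. smooth_on V (P z)"
        using Suc.prems(1) P unfolding relative_bound_def by auto
      show "slow_symbol V L W (\<lambda>z. partial_deriv j (\<lambda>x. Q z x / P z x))"
      proof (rule slow_symbol_cong[OF V 5])
        show "\<forall>\<^sub>F z in high_freq. \<forall>x\<in>V. partial_deriv j (Q z) x / P z x +
            (- 1) * ((Q z x / P z x) * (partial_deriv j (P z) x / P z x)) = partial_deriv j (\<lambda>x. Q z x / P z x) x"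
          using sQ sP P0
        proof eventually_elim
          case (elim z)
          show ?case
          proof
            fix x assume x: "x \<in> V"
            have d: "Q z differentiable (at x)" "P z differentiable (at x)"
              using smooth_on_differentiable[OF V _ x] elim by auto
            have P0x: "P z x \<noteq> 0" using elim x by blast
            have di: "(\<lambda>x. inverse (P z x)) differentiable (at x)"
              using d(2) P0x by (rule differentiable_inverse)
            show "partial_deriv j (Q z) x / P z x +
              (- 1) * ((Q z x / P z x) * (partial_deriv j (P z) x / P z x)) = partial_deriv j (\<lambda>x. Q z x / P z x) x"
              using P0x unfolding divide_inverse partial_deriv_mult[OF d(1) di] partial_deriv_inverse[OF d(2) P0x]
              by (simp add: algebra_simps)
          qed
        qed
      qed
    qed simp
  }
qed

section \<open>The symbol of an elliptic operator\<close>

definition net_at :: "(('n \<Rightarrow> nat) \<Rightarrow> 'n net) \<Rightarrow> real \<times> (real ^ 'n) \<Rightarrow> ('n \<Rightarrow> nat) \<Rightarrow> real ^ 'n \<Rightarrow> complex" where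
  "net_at A z = (\<lambda>\<alpha>. A \<alpha> (fst z))"

text \<open>With \<open>z = (\<epsilon>,\<xi>)\<close>, this is \<open>\<partial>\<^sub>\<xi>\<^sup>\<beta>P\<^sub>\<epsilon>(\<cdot>,\<xi>)/\<beta>!\<close>; the symbol itself is the case \<open>\<beta> = 0\<close>.\<close>

definition net_symbol :: "nat \<Rightarrow> (('n \<Rightarrow> nat) \<Rightarrow> 'n net) \<Rightarrow> ('n \<Rightarrow> nat) \<Rightarrow> real \<times> (real ^ 'n) \<Rightarrow> real ^ 'n \<Rightarrow> complex" where
  "net_symbol m A \<beta> z = symbol_taylor m (net_at A z) (snd z) \<beta>"

lemma wh_elliptic_lower_bound:
  assumes "wh_elliptic_rep \<Omega> m A" "compact K" "K \<subseteq> \<Omega>"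
  shows "\<exists>q>0. \<forall>\<^sub>F z in high_freq. \<forall>x\<in>K. fst z powr q * (1 + norm (snd z)) ^ m \<le> norm (net_symbol m A (\<lambda>_. 0) z x)"
proof -
  obtain q r where q: "q > 0" "pos_slow_scale r"
    "\<forall>\<^sub>F \<epsilon> in at_right 0. \<forall>x\<in>K. \<forall>\<xi>. norm \<xi> \<ge> r \<epsilon> \<longrightarrow>
             norm (diff_symbol m (\<lambda>\<alpha>. A \<alpha> \<epsilon>) x \<xi>) \<ge> \<epsilon> powr q * (1 + norm \<xi>) ^ m"
    using assms unfolding wh_elliptic_rep_def Let_def by blast
  have "\<forall>\<^sub>F \<epsilon> in at_right 0. \<forall>\<xi>. r \<epsilon> \<le> norm \<xi> \<longrightarrow>
     (\<forall>x\<in>K. \<epsilon> powr q * (1 + norm \<xi>) ^ m \<le> norm (diff_symbol m (\<lambda>\<alpha>. A \<alpha> \<epsilon>) x \<xi>))"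
    using q(3) by eventually_elim blast
  from slow_scale_high_freq[OF q(2) this] q(1) show ?thesis
    by (auto simp: net_symbol_def net_at_def symbol_taylor_0)
qed

lemma mi_fact_ge_1: "mi_fact \<beta> \<ge> 1"
  unfolding mi_fact_def by (rule prod_ge_1) (simp add: fact_ge_1)

text \<open>The second condition of ellipticity. Its multi-indices are replaced by lists of derivatives, the
  factor \<open>\<beta>! \<ge> 1\<close> is dropped, and the finitely many thresholds are absorbed by the filter.\<close>

lemma wh_elliptic_relative_bound:
  assumes ell: "wh_elliptic_rep \<Omega> m A" and K: "compact K" "K \<subseteq> \<Omega>" and \<Omega>: "open \<Omega>" and V: "open V" "V \<subseteq> K"
    and A: "\<And>\<alpha> \<epsilon>. mi_order \<alpha> \<le> m \<Longrightarrow> \<epsilon> \<in> {0<..1} \<Longrightarrow> smooth_on \<Omega> (A \<alpha> \<epsilon>)" and \<beta>: "mi_order \<beta> \<le> m"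
  shows "relative_bound V (net_symbol m A (\<lambda>_. 0)) L (\<lambda>z. 1 / (1 + norm (snd z)) ^ mi_order \<beta>) (net_symbol m A \<beta>)"
  unfolding relative_bound_def
proof (intro conjI allI impI)
  have smO: "\<forall>\<^sub>F z in high_freq. smooth_on \<Omega> (net_symbol m A \<beta> z)"
    using eventually_hf_unit
  proof eventually_elim
    case (elim z)
    show ?case unfolding net_symbol_def
      by (rule smooth_on_symbol_taylor[OF \<Omega>]) (use A elim in \<open>auto simp: net_at_def\<close>)
  qed
  thus "\<forall>\<^sub>F z in high_freq. smooth_on V (net_symbol m A \<beta> z)"
    by eventually_elim (rule smooth_on_subset[of \<Omega>], use V K in auto)
  fix \<delta> :: real assume \<delta>: "\<delta> > 0"
  have single: "\<forall>\<^sub>F z in high_freq. \<forall>x\<in>V.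
      norm (iter_deriv js (net_symbol m A \<beta> z) x) \<le> fst z powr (- \<delta>) * (1 / (1 + norm (snd z)) ^ mi_order \<beta>) * norm (net_symbol m A (\<lambda>_. 0) z x)" for js
  proof -
    let ?\<alpha> = "count_list js"
    obtain s r where sr: "pos_slow_scale s" "pos_slow_scale r"
      "\<forall>\<^sub>F \<epsilon> in at_right 0. \<forall>\<beta>. mi_order \<beta> \<le> m \<longrightarrow>
             (\<forall>x\<in>K. \<forall>\<xi>. norm \<xi> \<ge> r \<epsilon> \<longrightarrow>
                norm (mi_deriv ?\<alpha> (\<lambda>y. mi_deriv \<beta> (\<lambda>\<eta>. diff_symbol m (\<lambda>\<alpha>. A \<alpha> \<epsilon>) y \<eta>) \<xi>) x)
                  \<le> s \<epsilon> * norm (diff_symbol m (\<lambda>\<alpha>. A \<alpha> \<epsilon>) x \<xi>) / (1 + norm \<xi>) ^ mi_order \<beta>)"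
      using ell K unfolding wh_elliptic_rep_def Let_def by blast
    have "\<forall>\<^sub>F \<epsilon> in at_right 0. \<forall>\<xi>. r \<epsilon> \<le> norm \<xi> \<longrightarrow> (\<forall>x\<in>K.
        norm (mi_deriv ?\<alpha> (\<lambda>y. mi_deriv \<beta> (\<lambda>\<eta>. diff_symbol m (\<lambda>\<alpha>. A \<alpha> \<epsilon>) y \<eta>) \<xi>) x)
                  \<le> s \<epsilon> * norm (diff_symbol m (\<lambda>\<alpha>. A \<alpha> \<epsilon>) x \<xi>) / (1 + norm \<xi>) ^ mi_order \<beta>)"
      using sr(3) by eventually_elim (use \<beta> in blast)
    from slow_scale_high_freq[OF sr(2) this] eventually_high_freq_fst[OF slow_scale_le_powr[OF sr(1) \<delta>]] smO
    show ?thesis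
    proof eventually_elim
      case (elim z)
      show ?case
      proof
        fix x assume x: "x \<in> V"
        hence xK: "x \<in> K" "x \<in> \<Omega>" using V K by auto
        have e: "(\<lambda>y. mi_deriv \<beta> (\<lambda>\<eta>. diff_symbol m (\<lambda>\<alpha>. A \<alpha> (fst z)) y \<eta>) (snd z)) = (\<lambda>y. of_real (mi_fact \<beta>) * net_symbol m A \<beta> z y)"
          by (simp add: mi_deriv_symbol net_symbol_def net_at_def)
        have e0: "diff_symbol m (\<lambda>\<alpha>. A \<alpha> (fst z)) x (snd z) = net_symbol m A (\<lambda>_. 0) z x"
          by (simp add: net_symbol_def net_at_def symbol_taylor_0)
        have "mi_deriv ?\<alpha> (\<lambda>y. of_real (mi_fact \<beta>) * net_symbol m A \<beta> z y) x = of_real (mi_fact \<beta>) * iter_deriv js (net_symbol m A \<beta> z) x"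
          using mi_deriv_cmult[OF \<Omega> elim(3) xK(2)] mi_deriv_eq_iter_deriv[OF \<Omega> elim(3) xK(2), of js ?\<alpha>] by simp
        hence n: "norm (mi_deriv ?\<alpha> (\<lambda>y. of_real (mi_fact \<beta>) * net_symbol m A \<beta> z y) x) = mi_fact \<beta> * norm (iter_deriv js (net_symbol m A \<beta> z) x)"
          by (simp add: norm_mult abs_of_pos[OF mi_fact_pos])
        have "norm (iter_deriv js (net_symbol m A \<beta> z) x) \<le> mi_fact \<beta> * norm (iter_deriv js (net_symbol m A \<beta> z) x)"
          using mult_right_mono[OF mi_fact_ge_1[of \<beta>], of "norm (iter_deriv js (net_symbol m A \<beta> z) x)"] by simp
        also have "\<dots> \<le> s (fst z) * norm (net_symbol m A (\<lambda>_. 0) z x) / (1 + norm (snd z)) ^ mi_order \<beta>"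
          using elim(1)[rule_format, OF xK(1)] unfolding e e0 n by simp
        also have "\<dots> = s (fst z) * ((1 / (1 + norm (snd z)) ^ mi_order \<beta>) * norm (net_symbol m A (\<lambda>_. 0) z x))" by simp
        also have "\<dots> \<le> fst z powr (- \<delta>) * ((1 / (1 + norm (snd z)) ^ mi_order \<beta>) * norm (net_symbol m A (\<lambda>_. 0) z x))"
          using elim(2) by (intro mult_right_mono mult_nonneg_nonneg divide_nonneg_nonneg zero_le_power) (auto simp: add_nonneg_nonneg)
        finally show "norm (iter_deriv js (net_symbol m A \<beta> z) x) \<le> fst z powr (- \<delta>) * (1 / (1 + norm (snd z)) ^ mi_order \<beta>) * norm (net_symbol m A (\<lambda>_. 0) z x)"
          by (simp only: mult.assoc)
      qed
    qed
  qed
  have "finite {js :: 'a list. set js \<subseteq> UNIV \<and> length js \<le> L}" by (rule finite_lists_length_le) simp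
  hence "\<forall>\<^sub>F z in high_freq. \<forall>js\<in>{js :: 'a list. set js \<subseteq> UNIV \<and> length js \<le> L}. \<forall>x\<in>V.
      norm (iter_deriv js (net_symbol m A \<beta> z) x) \<le> fst z powr (- \<delta>) * (1 / (1 + norm (snd z)) ^ mi_order \<beta>) * norm (net_symbol m A (\<lambda>_. 0) z x)"
    by (rule eventually_ball_finite) (use single in blast)
  thus "\<forall>\<^sub>F z in high_freq. \<forall>js x. length js \<le> L \<longrightarrow> x \<in> V \<longrightarrow>
      norm (iter_deriv js (net_symbol m A \<beta> z) x) \<le> fst z powr (- \<delta>) * (1 / (1 + norm (snd z)) ^ mi_order \<beta>) * norm (net_symbol m A (\<lambda>_. 0) z x)"
    by eventually_elim blast
qed

section \<open>The parametrix\<close>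

text \<open>The operator \<open>R\<close> for which \<^const>\<open>transposed\<close> maps \<open>h/P\<close> to \<open>h - Rh\<close>.\<close>

definition correction ::
    "nat \<Rightarrow> (('n \<Rightarrow> nat) \<Rightarrow> real ^ 'n \<Rightarrow> complex) \<Rightarrow> real ^ 'n \<Rightarrow> (real ^ 'n \<Rightarrow> complex) \<Rightarrow> real ^ 'n \<Rightarrow> complex" where
  "correction m c \<xi> h x = - (\<Sum>\<beta> | mi_order \<beta> \<le> m \<and> mi_order \<beta> > 0.
     \<i> ^ mi_order \<beta> * mi_deriv \<beta> (\<lambda>y. (symbol_taylor m c \<xi> \<beta> y / symbol_taylor m c \<xi> (\<lambda>_. 0) y) * h y) x)"

text \<open>A partial sum of the Neumann series \<open>(1/P) \<Sum>\<^sub>k R\<^sup>k\<close>.\<close>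

definition parametrix ::
    "nat \<Rightarrow> (('n \<Rightarrow> nat) \<Rightarrow> real ^ 'n \<Rightarrow> complex) \<Rightarrow> real ^ 'n \<Rightarrow> (real ^ 'n \<Rightarrow> complex) \<Rightarrow> nat \<Rightarrow> real ^ 'n \<Rightarrow> complex" where
  "parametrix m c \<xi> \<phi> M x = (\<Sum>k<M. (correction m c \<xi> ^^ k) \<phi> x / symbol_taylor m c \<xi> (\<lambda>_. 0) x)"

lemma correction_outside:
  assumes "closed K" "\<And>x. x \<notin> K \<Longrightarrow> h x = 0" "x \<notin> K"
  shows "correction m c \<xi> h x = 0"
proof -
  have "mi_deriv \<beta> (\<lambda>y. (symbol_taylor m c \<xi> \<beta> y / symbol_taylor m c \<xi> (\<lambda>_. 0) y) * h y) x = 0" for \<beta>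
    by (rule mi_deriv_outside[OF assms(1) _ assms(3)]) (simp add: assms(2))
  thus ?thesis by (simp add: correction_def)
qed

lemma correction_iter_outside:
  assumes "closed K" "\<And>x. x \<notin> K \<Longrightarrow> \<phi> x = 0" "x \<notin> K"
  shows "(correction m c \<xi> ^^ k) \<phi> x = 0"
  using assms(3) by (induction k arbitrary: x) (auto intro: assms correction_outside[OF assms(1)])

lemma correction_smooth:
  assumes V: "open V" "K \<subseteq> V" and K: "compact K"
    and c: "\<And>\<alpha>. mi_order \<alpha> \<le> m \<Longrightarrow> smooth_on V (c \<alpha>)"
    and p0: "\<And>x. x \<in> V \<Longrightarrow> symbol_taylor m c \<xi> (\<lambda>_. 0) x \<noteq> 0"
    and h: "smooth_on UNIV h" "\<And>x. x \<notin> K \<Longrightarrow> h x = 0"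
  shows "smooth_on UNIV (\<lambda>y. (symbol_taylor m c \<xi> \<beta> y / symbol_taylor m c \<xi> (\<lambda>_. 0) y) * h y)"
    and "smooth_on UNIV (\<lambda>y. h y / symbol_taylor m c \<xi> (\<lambda>_. 0) y)"
proof -
  have s: "smooth_on V (symbol_taylor m c \<xi> \<beta>)" for \<beta> by (rule smooth_on_symbol_taylor[OF V(1) c])
  have hV: "smooth_on V h" by (rule smooth_on_subset[OF h(1)]) simp
  show "smooth_on UNIV (\<lambda>y. (symbol_taylor m c \<xi> \<beta> y / symbol_taylor m c \<xi> (\<lambda>_. 0) y) * h y)"
    by (rule smooth_on_extend_zero[OF V(1) _ compact_imp_closed[OF K] V(2)],
        rule smooth_on_mult[OF V(1) smooth_on_divide[OF V(1) s s p0] hV]) (simp_all add: h)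
  show "smooth_on UNIV (\<lambda>y. h y / symbol_taylor m c \<xi> (\<lambda>_. 0) y)"
    by (rule smooth_on_extend_zero[OF V(1) _ compact_imp_closed[OF K] V(2)],
        rule smooth_on_divide[OF V(1) hV s p0]) (simp_all add: h)
qed

text \<open>With \<open>h\<^sub>k = R\<^sup>k\<phi>\<close> for \<open>R\<close> = \<^const>\<open>correction\<close>, the term \<open>h\<^sub>k/P\<close> is mapped to \<open>h\<^sub>k - h\<^bsub>k+1\<^esub>\<close>, and
  the sum telescopes. All functions vanish off \<open>K\<close>, so that the zeros of \<open>P\<close> outside \<open>V\<close> do no harm.\<close>

lemma transposed_parametrix:
  fixes \<phi> :: "real ^ 'n \<Rightarrow> complex"
  assumes V: "open V" "K \<subseteq> V" and K: "compact K"
    and c: "\<And>\<alpha>. mi_order \<alpha> \<le> m \<Longrightarrow> smooth_on V (c \<alpha>)"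
    and p0: "\<And>x. x \<in> V \<Longrightarrow> symbol_taylor m c \<xi> (\<lambda>_. 0) x \<noteq> 0"
    and \<phi>: "smooth_on UNIV \<phi>" "\<And>x. x \<notin> K \<Longrightarrow> \<phi> x = 0"
  shows "smooth_on UNIV ((correction m c \<xi> ^^ k) \<phi>)"
    and "smooth_on UNIV (parametrix m c \<xi> \<phi> M)"
    and "\<And>x. x \<notin> K \<Longrightarrow> parametrix m c \<xi> \<phi> M x = 0"
    and "transposed m c \<xi> (parametrix m c \<xi> \<phi> M) x = \<phi> x - (correction m c \<xi> ^^ M) \<phi> x"
proof -
  have Kc: "closed K" by (rule compact_imp_closed[OF K])
  define h where "h = (\<lambda>k. (correction m c \<xi> ^^ k) \<phi>)"
  define p where "p = symbol_taylor m c \<xi> (\<lambda>_. 0)"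
  have h0: "x \<notin> K \<Longrightarrow> h k x = 0" for k x unfolding h_def by (rule correction_iter_outside[OF Kc \<phi>(2)])
  have hs: "smooth_on UNIV (h k)" for k
  proof (induction k)
    case 0 show ?case using \<phi> by (simp add: h_def)
  next
    case (Suc k)
    have "smooth_on UNIV (\<lambda>y. (symbol_taylor m c \<xi> \<beta> y / symbol_taylor m c \<xi> (\<lambda>_. 0) y) * h k y)" for \<beta>
      by (rule correction_smooth(1)[OF V K c p0 Suc h0])
    from smooth_on_mi_deriv[OF this]
    have "smooth_on UNIV (correction m c \<xi> (h k))" unfolding correction_def[abs_def]
      by (intro smooth_on_minus smooth_on_sum smooth_on_mult[OF open_UNIV smooth_on_const[OF open_UNIV]] open_UNIV)
    thus ?case by (simp add: h_def)
  qed
  show "smooth_on UNIV ((correction m c \<xi> ^^ k) \<phi>)" using hs[of k] by (simp add: h_def)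
  have par: "parametrix m c \<xi> \<phi> M = (\<lambda>x. \<Sum>k<M. h k x / p x)"
    by (simp add: parametrix_def[abs_def] h_def p_def)
  have hp: "smooth_on UNIV (\<lambda>x. h k x / p x)" for k
    unfolding p_def by (rule correction_smooth(2)[OF V K c p0 hs h0])
  show "smooth_on UNIV (parametrix m c \<xi> \<phi> M)" unfolding par by (intro smooth_on_sum open_UNIV hp)
  show "x \<notin> K \<Longrightarrow> parametrix m c \<xi> \<phi> M x = 0" for x unfolding par by (simp add: h0)
  define q where "q = (\<lambda>\<beta> k y. (symbol_taylor m c \<xi> \<beta> y / p y) * h k y)"
  have qs: "smooth_on UNIV (q \<beta> k)" for \<beta> k
    unfolding q_def p_def by (rule correction_smooth(1)[OF V K c p0 hs h0])
  have "(\<lambda>y. symbol_taylor m c \<xi> \<beta> y * parametrix m c \<xi> \<phi> M y) = (\<lambda>y. \<Sum>k<M. q \<beta> k y)" for \<beta>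
    by (simp add: par q_def sum_distrib_left)
  hence "transposed m c \<xi> (parametrix m c \<xi> \<phi> M) x =
      (\<Sum>\<beta> | mi_order \<beta> \<le> m. \<i> ^ mi_order \<beta> * (\<Sum>k<M. mi_deriv \<beta> (q \<beta> k) x))"
    unfolding transposed_def by (simp add: mi_deriv_sum[OF open_UNIV qs])
  also have "\<dots> = (\<Sum>k<M. \<Sum>\<beta> | mi_order \<beta> \<le> m. \<i> ^ mi_order \<beta> * mi_deriv \<beta> (q \<beta> k) x)"
    unfolding sum_distrib_left by (rule sum.swap)
  also have "\<dots> = (\<Sum>k<M. h k x - h (Suc k) x)"
  proof (rule sum.cong[OF refl])
    fix k
    have o: "mi_order (\<lambda>_::'n. 0) = 0" by (simp add: mi_order_eq_0_iff)
    have "mi_order \<beta> \<le> m \<longleftrightarrow> \<beta> = (\<lambda>_. 0) \<or> (mi_order \<beta> \<le> m \<and> mi_order \<beta> > 0)" for \<beta> :: "'n \<Rightarrow> nat"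
      using mi_order_eq_0_iff[of \<beta>] by (cases "mi_order \<beta> = 0") auto
    hence set: "{\<beta> :: 'n \<Rightarrow> nat. mi_order \<beta> \<le> m} = insert (\<lambda>_. 0) {\<beta>. mi_order \<beta> \<le> m \<and> mi_order \<beta> > 0}"
      unfolding set_eq_iff by blast
    have fin: "finite {\<beta> :: 'n \<Rightarrow> nat. mi_order \<beta> \<le> m \<and> mi_order \<beta> > 0}"
      by (rule finite_subset[OF _ finite_mi_order[of m]]) auto
    have "q (\<lambda>_. 0) k x = h k x"
      using p0[of x] h0[of x k] V(2) by (cases "x \<in> K") (auto simp: q_def p_def)
    moreover have "correction m c \<xi> (h k) x = - (\<Sum>\<beta> | mi_order \<beta> \<le> m \<and> mi_order \<beta> > 0. \<i> ^ mi_order \<beta> * mi_deriv \<beta> (q \<beta> k) x)"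
      by (simp add: correction_def q_def p_def)
    moreover have "h (Suc k) x = correction m c \<xi> (h k) x" by (simp add: h_def)
    ultimately show "(\<Sum>\<beta> | mi_order \<beta> \<le> m. \<i> ^ mi_order \<beta> * mi_deriv \<beta> (q \<beta> k) x) = h k x - h (Suc k) x"
      unfolding set using fin by (subst sum.insert) (auto simp: o)
  qed
  also have "\<dots> = h 0 x - h M x" by (induction M) auto
  finally show "transposed m c \<xi> (parametrix m c \<xi> \<phi> M) x = \<phi> x - (correction m c \<xi> ^^ M) \<phi> x"
    by (simp add: h_def)
qed

section \<open>The parametrix is a slow-scale symbol\<close>

text \<open>Room between the support \<open>K\<^sub>0\<close> of \<open>\<phi>\<close> and \<open>U\<close>: derivatives are bounded on the open set \<open>V\<close>, ellipticity is
  applied on the compact set \<open>K\<close>.\<close>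

lemma test_function_neighbourhood:
  assumes "\<phi> \<in> test_functions U" "open U"
  obtains K\<^sub>0 V K where "compact K\<^sub>0" "K\<^sub>0 \<subseteq> V" "open V" "V \<subseteq> K" "compact K" "K \<subseteq> U" "\<And>x. x \<notin> K\<^sub>0 \<Longrightarrow> \<phi> x = 0"
proof -
  define K\<^sub>0 where "K\<^sub>0 = closure {x. \<phi> x \<noteq> 0}"
  have K0: "compact K\<^sub>0" "K\<^sub>0 \<subseteq> U" using assms(1) by (auto simp: test_functions_def K\<^sub>0_def)
  obtain s where s: "s \<in> test_functions U" "\<forall>x\<in>K\<^sub>0. s x \<noteq> 0"
    using ex_test_function[OF K0(1) assms(2) K0(2)] by blast
  define V where "V = {x. s x \<noteq> 0}"
  define K where "K = closure V"
  have "smooth_on UNIV s" and K: "compact K" "K \<subseteq> U"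
    using s(1) unfolding test_functions_def K_def V_def by blast+
  hence "open V" unfolding V_def
    using smooth_on_continuous by (auto intro!: open_Collect_neq continuous_intros)
  moreover have "K\<^sub>0 \<subseteq> V" using s(2) by (auto simp: V_def)
  moreover have "V \<subseteq> K" unfolding K_def by (rule closure_subset)
  moreover have "x \<notin> K\<^sub>0 \<Longrightarrow> \<phi> x = 0" for x
    unfolding K\<^sub>0_def using closure_subset[of "{x. \<phi> x \<noteq> 0}"] by blast
  ultimately show ?thesis using that K0(1) K by blast
qed

lemma test_function_smooth: "\<phi> \<in> test_functions U \<Longrightarrow> smooth_on UNIV \<phi>"
  by (simp add: test_functions_def)

lemma inverse_one_plus_norm_power_le_1: "1 / (1 + norm (x :: 'a::real_normed_vector)) ^ k \<le> 1"
proof -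
  have "1 \<le> (1 + norm x) ^ k" by (intro one_le_power) simp
  thus ?thesis by (subst divide_le_eq_1_pos) linarith+
qed

text \<open>Each application of \<^const>\<open>correction\<close> brings in a quotient \<open>\<partial>\<^sub>\<xi>\<^sup>\<beta>P/P\<close> with \<open>\<beta> \<noteq> 0\<close>, hence gains a
  factor \<open>1/(1 + \<bar>\<xi>\<bar>)\<close>.\<close>

lemma correction_slow_symbol:
  fixes A :: "('n::finite \<Rightarrow> nat) \<Rightarrow> 'n net"
  assumes V: "open V" and \<phi>: "smooth_on V \<phi>" "\<And>L. \<exists>B. deriv_bound V L B \<phi>"
    and P0: "\<forall>\<^sub>F z in high_freq. \<forall>x\<in>V. net_symbol m A (\<lambda>_. 0) z x \<noteq> 0"
    and rel: "\<And>\<beta> L. mi_order \<beta> \<le> m \<Longrightarrow> relative_bound V (net_symbol m A (\<lambda>_. 0)) L (\<lambda>z. 1 / (1 + norm (snd z)) ^ mi_order \<beta>) (net_symbol m A \<beta>)"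
  shows "slow_symbol V L (\<lambda>z. 1 / (1 + norm (snd z)) ^ k) (\<lambda>z. (correction m (net_at A z) (snd z) ^^ k) \<phi>)"
proof (induction k arbitrary: L)
  case 0
  obtain B where "deriv_bound V L B \<phi>" using \<phi>(2) by blast
  thus ?case using slow_symbol_fixed[OF V \<phi>(1)] by simp
next
  case (Suc k)
  define h where "h = (\<lambda>z. (correction m (net_at A z) (snd z) ^^ k) \<phi>)"
  define W where "W = (\<lambda>j (z :: real \<times> (real ^ 'n)). 1 / (1 + norm (snd z)) ^ j)"
  have W: "0 \<le> W j z" for j z unfolding W_def by (simp add: add_nonneg_nonneg)
  have rel0: "relative_bound V (net_symbol m A (\<lambda>_. 0)) L (\<lambda>_. 1) (net_symbol m A (\<lambda>_. 0))" for L
    using rel[of "\<lambda>_. 0" L] by (simp add: mi_order_def)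
  have ratio: "slow_symbol V L (W (mi_order \<beta>)) (\<lambda>z x. net_symbol m A \<beta> z x / net_symbol m A (\<lambda>_. 0) z x)"
    if "mi_order \<beta> \<le> m" for \<beta> L
    using rel[OF that] by (intro slow_symbol_quotient[OF V P0 rel0 W]) (simp add: W_def)
  have tm: "slow_symbol V L (W (Suc k)) (\<lambda>z x. \<i> ^ mi_order \<beta> * mi_deriv \<beta> (\<lambda>y. (net_symbol m A \<beta> z y / net_symbol m A (\<lambda>_. 0) z y) * h z y) x)"
    if \<beta>: "mi_order \<beta> \<le> m" "mi_order \<beta> > 0" for \<beta> L
  proof (rule slow_symbol_cmult[OF V W], rule slow_symbol_mi_deriv)
    have "slow_symbol V (mi_order \<beta> + L) (W k) h" using Suc.IH unfolding h_def W_def .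
    from slow_symbol_mult[OF V W W ratio[OF \<beta>(1)] this]
    show "slow_symbol V (mi_order \<beta> + L) (W (Suc k)) (\<lambda>z y. (net_symbol m A \<beta> z y / net_symbol m A (\<lambda>_. 0) z y) * h z y)"
    proof (rule slow_symbol_mono[OF _ order.refl always_eventually], intro allI)
      fix z :: "real \<times> (real ^ 'n)"
      have "(1 + norm (snd z)) ^ Suc k \<le> (1 + norm (snd z)) ^ (mi_order \<beta> + k)"
        by (rule power_increasing) (use \<beta>(2) in auto)
      hence "W (mi_order \<beta> + k) z \<le> W (Suc k) z" unfolding W_def
        by (intro divide_left_mono mult_pos_pos zero_less_power) (auto simp: add_pos_nonneg)
      thus "W (mi_order \<beta>) z * W k z \<le> W (Suc k) z" by (simp add: W_def power_add)
    qed
  qed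
  have fin: "finite {\<beta> :: 'n \<Rightarrow> nat. mi_order \<beta> \<le> m \<and> mi_order \<beta> > 0}"
    by (rule finite_subset[OF _ finite_mi_order[of m]]) auto
  have "slow_symbol V L (W (Suc k)) (\<lambda>z x. (- 1) * (\<Sum>\<beta> | mi_order \<beta> \<le> m \<and> mi_order \<beta> > 0.
      \<i> ^ mi_order \<beta> * mi_deriv \<beta> (\<lambda>y. (net_symbol m A \<beta> z y / net_symbol m A (\<lambda>_. 0) z y) * h z y) x))"
    by (rule slow_symbol_cmult[OF V W], rule slow_symbol_sum[OF V W fin], rule tm) auto
  thus ?case
    by (simp add: W_def h_def net_symbol_def correction_def[abs_def])
qed

lemma iter_deriv_const: "iter_deriv js (\<lambda>_. c) = (\<lambda>_. if js = [] then c else 0)"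
  by (induction js) auto

lemma inverse_slow_symbol:
  assumes V: "open V"
    and lower: "\<forall>\<^sub>F z in high_freq. \<forall>x\<in>V. fst z powr q * (1 + norm (snd z)) ^ m \<le> norm (P z x)"
    and rel: "\<And>L. relative_bound V P L (\<lambda>_. 1) P"
  shows "slow_symbol V L (\<lambda>z. fst z powr (- q)) (\<lambda>z x. 1 / P z x)"
proof (rule slow_symbol_quotient[OF V _ rel])
  show "\<forall>\<^sub>F z in high_freq. \<forall>x\<in>V. P z x \<noteq> 0"
    using lower eventually_hf_unit
  proof eventually_elim
    case (elim z)
    have "0 < fst z powr q * (1 + norm (snd z)) ^ m"
      using elim by (intro mult_pos_pos zero_less_power) (auto simp: add_pos_nonneg)
    thus ?case using elim by fastforce
  qed
  show "relative_bound V P L (\<lambda>z. fst z powr (- q)) (\<lambda>_ _. 1)"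
    unfolding relative_bound_def
  proof (intro conjI allI impI)
    show "\<forall>\<^sub>F z in high_freq. smooth_on V (\<lambda>_. 1)" using smooth_on_const[OF V] by simp
    fix \<delta> :: real assume "\<delta> > 0"
    from eventually_hf_const[OF this, of 1] lower eventually_hf_unit
    show "\<forall>\<^sub>F z in high_freq. \<forall>js x. length js \<le> L \<longrightarrow> x \<in> V \<longrightarrow>
        norm (iter_deriv js (\<lambda>_. 1) x) \<le> fst z powr (- \<delta>) * fst z powr (- q) * norm (P z x)"
    proof eventually_elim
      case (elim z)
      show ?case
      proof (intro allI impI)
        fix js :: "'a list" and x assume x: "x \<in> V"
        have "1 * fst z powr q \<le> (1 + norm (snd z)) ^ m * fst z powr q"
          by (intro mult_right_mono one_le_power) auto
        also have "\<dots> \<le> norm (P z x)" using elim x by (simp add: mult.commute)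
        finally have "fst z powr (- q) * fst z powr q \<le> fst z powr (- q) * norm (P z x)"
          by (intro mult_left_mono) auto
        hence "1 \<le> fst z powr (- q) * norm (P z x)" using elim by (simp add: powr_add[symmetric])
        hence "1 * 1 \<le> fst z powr (- \<delta>) * (fst z powr (- q) * norm (P z x))" using elim by (intro mult_mono) auto
        thus "norm (iter_deriv js (\<lambda>_. 1) x) \<le> fst z powr (- \<delta>) * fst z powr (- q) * norm (P z x)"
          by (auto simp: iter_deriv_const mult.assoc)
      qed
    qed
  qed
qed simp

lemma parametrix_slow_symbol:
  fixes A :: "('n::finite \<Rightarrow> nat) \<Rightarrow> 'n net"
  assumes V: "open V" and \<phi>: "smooth_on V \<phi>" "\<And>L. \<exists>B. deriv_bound V L B \<phi>"
    and lower: "\<forall>\<^sub>F z in high_freq. \<forall>x\<in>V. fst z powr q * (1 + norm (snd z)) ^ m \<le> norm (net_symbol m A (\<lambda>_. 0) z x)"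
    and P0: "\<forall>\<^sub>F z in high_freq. \<forall>x\<in>V. net_symbol m A (\<lambda>_. 0) z x \<noteq> 0"
    and rel: "\<And>\<beta> L. mi_order \<beta> \<le> m \<Longrightarrow> relative_bound V (net_symbol m A (\<lambda>_. 0)) L (\<lambda>z. 1 / (1 + norm (snd z)) ^ mi_order \<beta>) (net_symbol m A \<beta>)"
  shows "slow_symbol V L (\<lambda>z. fst z powr (- q)) (\<lambda>z. parametrix m (net_at A z) (snd z) \<phi> M)"
proof -
  have rel0: "relative_bound V (net_symbol m A (\<lambda>_. 0)) L (\<lambda>_. 1) (net_symbol m A (\<lambda>_. 0))" for L
    using rel[of "\<lambda>_. 0" L] by (simp add: mi_order_def)
  have inv: "slow_symbol V L (\<lambda>z. fst z powr (- q)) (\<lambda>z x. 1 / net_symbol m A (\<lambda>_. 0) z x)"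
    by (rule inverse_slow_symbol[OF V lower rel0])
  have "slow_symbol V L (\<lambda>z. fst z powr (- q)) (\<lambda>z x. (correction m (net_at A z) (snd z) ^^ k) \<phi> x * (1 / net_symbol m A (\<lambda>_. 0) z x))" for k
  proof -
    have "slow_symbol V L (\<lambda>_. 1) (\<lambda>z. (correction m (net_at A z) (snd z) ^^ k) \<phi>)"
      by (rule slow_symbol_mono[OF correction_slow_symbol[OF V \<phi> P0 rel] order.refl always_eventually])
         (assumption, rule allI, rule inverse_one_plus_norm_power_le_1)
    from slow_symbol_mult[OF V _ _ this inv] show ?thesis by simp
  qed
  from slow_symbol_sum[OF V _ finite_lessThan[of M] this]
  show ?thesis by (simp add: parametrix_def[abs_def] net_symbol_def)
qed

lemma abs_mi_power_le: "\<bar>mi_power \<xi> \<alpha>\<bar> \<le> (1 + norm \<xi>) ^ mi_order \<alpha>"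
proof -
  have "\<bar>mi_power \<xi> \<alpha>\<bar> = (\<Prod>i\<in>UNIV. \<bar>\<xi> $ i\<bar> ^ \<alpha> i)"
    by (simp add: mi_power_def abs_prod power_abs)
  also have "\<dots> \<le> (\<Prod>i\<in>UNIV. (1 + norm \<xi>) ^ \<alpha> i)"
    using component_le_norm_cart[of \<xi>] by (intro prod_mono conjI power_mono) (auto intro: add_increasing)
  also have "\<dots> = (1 + norm \<xi>) ^ mi_order \<alpha>" by (simp add: mi_order_def power_sum)
  finally show ?thesis .
qed

lemma symbol_upper_bound:
  fixes A :: "('n::finite \<Rightarrow> nat) \<Rightarrow> 'n net"
  assumes A: "\<And>\<alpha>. mi_order \<alpha> \<le> m \<Longrightarrow> A \<alpha> \<in> moderate_nets \<Omega>" and K: "compact K" "K \<subseteq> \<Omega>"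
  shows "\<exists>N. \<forall>\<^sub>F z in high_freq. \<forall>x\<in>K. norm (net_symbol m A (\<lambda>_. 0) z x) \<le> fst z powr (- N) * (1 + norm (snd z)) ^ m"
proof -
  let ?I = "{\<alpha> :: 'n \<Rightarrow> nat. mi_order \<alpha> \<le> m}"
  have "\<forall>\<alpha>\<in>?I. \<exists>N C. C > 0 \<and> (\<forall>\<^sub>F \<epsilon> in at_right 0. \<forall>x\<in>K. norm (A \<alpha> \<epsilon> x) \<le> C * \<epsilon> powr (- N))"
    using moderate_sup_bound[OF A K] by blast
  from bchoice[OF this] obtain N where "\<forall>\<alpha>\<in>?I. \<exists>C. C > 0 \<and> (\<forall>\<^sub>F \<epsilon> in at_right 0. \<forall>x\<in>K. norm (A \<alpha> \<epsilon> x) \<le> C * \<epsilon> powr (- N \<alpha>))"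
    by blast
  from bchoice[OF this] obtain C where C: "\<And>\<alpha>. \<alpha> \<in> ?I \<Longrightarrow> C \<alpha> > 0"
    and b: "\<And>\<alpha>. \<alpha> \<in> ?I \<Longrightarrow> \<forall>\<^sub>F \<epsilon> in at_right 0. \<forall>x\<in>K. norm (A \<alpha> \<epsilon> x) \<le> C \<alpha> * \<epsilon> powr (- N \<alpha>)"
    by blast
  define N0 where "N0 = (\<Sum>\<alpha>\<in>?I. \<bar>N \<alpha>\<bar>)"
  define C0 where "C0 = (\<Sum>\<alpha>\<in>?I. C \<alpha>)"
  have N0: "N \<alpha> \<le> N0" if "\<alpha> \<in> ?I" for \<alpha>
    using member_le_sum[OF that, of "\<lambda>\<alpha>. \<bar>N \<alpha>\<bar>"] by (simp add: N0_def)
  have "\<forall>\<^sub>F \<epsilon> in at_right 0. \<forall>\<alpha>\<in>?I. \<forall>x\<in>K. norm (A \<alpha> \<epsilon> x) \<le> C \<alpha> * \<epsilon> powr (- N \<alpha>)"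
    by (rule eventually_ball_finite) (use b in auto)
  from eventually_high_freq_fst[OF this] eventually_hf_unit eventually_hf_const[OF zero_less_one, of C0]
  have "\<forall>\<^sub>F z in high_freq. \<forall>x\<in>K. norm (net_symbol m A (\<lambda>_. 0) z x) \<le> fst z powr (- (N0 + 1)) * (1 + norm (snd z)) ^ m"
  proof (eventually_elim, intro ballI)
    fix z :: "real \<times> (real ^ 'n)" and x
    assume *: "\<forall>\<alpha>\<in>?I. \<forall>x\<in>K. norm (A \<alpha> (fst z) x) \<le> C \<alpha> * fst z powr (- N \<alpha>)"
      and z: "0 < fst z \<and> fst z < 1" "C0 \<le> fst z powr - 1" and x: "x \<in> K"
    define Y where "Y = (1 + norm (snd z)) ^ m"
    have Y: "Y \<ge> 0" unfolding Y_def by (intro zero_le_power) (simp add: add_nonneg_nonneg)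
    have "norm (net_symbol m A (\<lambda>_. 0) z x) \<le> (\<Sum>\<alpha>\<in>?I. norm (A \<alpha> (fst z) x * of_real (mi_power (snd z) \<alpha>)))"
      unfolding net_symbol_def symbol_taylor_0 diff_symbol_def net_at_def by (rule norm_sum)
    also have "\<dots> \<le> (\<Sum>\<alpha>\<in>?I. C \<alpha> * (fst z powr (- N0) * Y))"
    proof (rule sum_mono)
      fix \<alpha> assume \<alpha>: "\<alpha> \<in> ?I"
      have "norm (A \<alpha> (fst z) x) \<le> C \<alpha> * fst z powr (- N \<alpha>)" using * \<alpha> x by blast
      also have "\<dots> \<le> C \<alpha> * fst z powr (- N0)"
        using z N0[OF \<alpha>] C[OF \<alpha>] by (intro mult_left_mono powr_le_powr_small) auto
      finally have 1: "norm (A \<alpha> (fst z) x) \<le> C \<alpha> * fst z powr (- N0)" .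
      have "\<bar>mi_power (snd z) \<alpha>\<bar> \<le> (1 + norm (snd z)) ^ mi_order \<alpha>" by (rule abs_mi_power_le)
      also have "\<dots> \<le> Y" unfolding Y_def using \<alpha> by (intro power_increasing) auto
      finally have 2: "\<bar>mi_power (snd z) \<alpha>\<bar> \<le> Y" .
      have "norm (A \<alpha> (fst z) x * of_real (mi_power (snd z) \<alpha>)) = norm (A \<alpha> (fst z) x) * \<bar>mi_power (snd z) \<alpha>\<bar>"
        by (simp add: norm_mult)
      also have "\<dots> \<le> (C \<alpha> * fst z powr (- N0)) * Y"
        using 1 2 C[OF \<alpha>] by (intro mult_mono) auto
      finally show "norm (A \<alpha> (fst z) x * of_real (mi_power (snd z) \<alpha>)) \<le> C \<alpha> * (fst z powr (- N0) * Y)"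
        by (simp only: mult.assoc)
    qed
    also have "\<dots> = C0 * (fst z powr (- N0) * Y)" by (simp add: C0_def sum_distrib_right)
    also have "\<dots> \<le> fst z powr (- 1) * (fst z powr (- N0) * Y)"
      using z Y by (intro mult_right_mono) auto
    also have "\<dots> = fst z powr (- (N0 + 1)) * Y"
    proof -
      have "- (N0 + 1) = - 1 + - N0" by simp
      hence "fst z powr (- (N0 + 1)) = fst z powr (- 1) * fst z powr (- N0)" by (metis powr_add)
      thus ?thesis by (simp only: mult.assoc)
    qed
    finally show "norm (net_symbol m A (\<lambda>_. 0) z x) \<le> fst z powr (- (N0 + 1)) * (1 + norm (snd z)) ^ m"
      by (simp only: Y_def)
  qed
  thus ?thesis by blast
qed

text \<open>Derivatives of the coefficients are controlled by \<open>P\<close> itself, not by their own moderateness. This is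
  why \<open>N\<close> does not depend on \<open>L\<close>.\<close>

lemma transposed_slow_symbol:
  fixes A :: "('n::finite \<Rightarrow> nat) \<Rightarrow> 'n net"
  assumes V: "open V" and \<phi>: "smooth_on V \<phi>" "\<And>L. \<exists>B. deriv_bound V L B \<phi>"
    and upper: "\<forall>\<^sub>F z in high_freq. \<forall>x\<in>V. norm (net_symbol m A (\<lambda>_. 0) z x) \<le> fst z powr (- N) * (1 + norm (snd z)) ^ m"
    and rel: "\<And>\<beta> L. mi_order \<beta> \<le> m \<Longrightarrow> relative_bound V (net_symbol m A (\<lambda>_. 0)) L (\<lambda>z. 1 / (1 + norm (snd z)) ^ mi_order \<beta>) (net_symbol m A \<beta>)"
  shows "slow_symbol V L (\<lambda>z. fst z powr (- N) * (1 + norm (snd z)) ^ m) (\<lambda>z. transposed m (net_at A z) (snd z) \<phi>)"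
proof -
  define W where "W = (\<lambda>z :: real \<times> (real ^ 'n). fst z powr (- N) * (1 + norm (snd z)) ^ m)"
  have W: "0 \<le> W z" for z unfolding W_def by (simp add: add_nonneg_nonneg)
  have s: "slow_symbol V L W (net_symbol m A \<beta>)" if \<beta>: "mi_order \<beta> \<le> m" for \<beta> L
  proof (rule slow_symbolI)
    show "\<forall>\<^sub>F z in high_freq. smooth_on V (net_symbol m A \<beta> z)"
      using rel[OF \<beta>] unfolding relative_bound_def by blast
    fix \<delta> :: real assume "\<delta> > 0"
    hence "\<forall>\<^sub>F z in high_freq. \<forall>js x. length js \<le> L \<longrightarrow> x \<in> V \<longrightarrow>
        norm (iter_deriv js (net_symbol m A \<beta> z) x) \<le> fst z powr (- \<delta>) * (1 / (1 + norm (snd z)) ^ mi_order \<beta>) * norm (net_symbol m A (\<lambda>_. 0) z x)"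
      using rel[OF \<beta>] unfolding relative_bound_def by blast
    with upper show "\<forall>\<^sub>F z in high_freq. deriv_bound V L (fst z powr (- \<delta>) * W z) (net_symbol m A \<beta> z)"
    proof eventually_elim
      case (elim z)
      show ?case unfolding deriv_bound_def
      proof (intro allI impI ballI)
        fix js :: "'n list" and x assume js: "length js \<le> L" and x: "x \<in> V"
        have "norm (iter_deriv js (net_symbol m A \<beta> z) x) \<le> fst z powr (- \<delta>) * (1 / (1 + norm (snd z)) ^ mi_order \<beta>) * norm (net_symbol m A (\<lambda>_. 0) z x)"
          using elim js x by blast
        also have "\<dots> \<le> fst z powr (- \<delta>) * 1 * W z"
          using elim x unfolding W_def
          by (intro mult_mono mult_left_mono inverse_one_plus_norm_power_le_1) (auto simp: add_nonneg_nonneg)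
        finally show "norm (iter_deriv js (net_symbol m A \<beta> z) x) \<le> fst z powr (- \<delta>) * W z" by simp
      qed
    qed
  qed
  have f: "slow_symbol V L (\<lambda>_. 1) (\<lambda>_. \<phi>)" for L
    using \<phi> slow_symbol_fixed[OF V \<phi>(1)] by blast
  have p: "slow_symbol V L W (\<lambda>z x. net_symbol m A \<beta> z x * \<phi> x)" if "mi_order \<beta> \<le> m" for \<beta> L
    using slow_symbol_mult[OF V W _ s[OF that] f] by simp
  have "slow_symbol V L W (\<lambda>z x. \<Sum>\<beta> | mi_order \<beta> \<le> m. \<i> ^ mi_order \<beta> * mi_deriv \<beta> (\<lambda>y. net_symbol m A \<beta> z y * \<phi> y) x)"
    by (intro slow_symbol_sum[OF V W finite_mi_order] slow_symbol_cmult[OF V W] slow_symbol_mi_deriv p) simp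
  thus ?thesis by (simp add: transposed_def[abs_def] net_symbol_def W_def)
qed

section \<open>Microlocal regularity and the operator\<close>

lemma fourier_mult_moderate:
  assumes \<Omega>: "open \<Omega>" and g: "g \<in> moderate_nets \<Omega>" and K: "compact K" "K \<subseteq> \<Omega>"
  shows "\<exists>N C. C > 0 \<and> (\<forall>\<^sub>F \<epsilon> in at_right 0. \<forall>h B \<xi>. smooth_on UNIV h \<longrightarrow> (\<forall>x. x \<notin> K \<longrightarrow> h x = 0) \<longrightarrow>
     0 \<le> B \<longrightarrow> (\<forall>x\<in>K. norm (h x) \<le> B) \<longrightarrow> norm (fourier (\<lambda>x. h x * g \<epsilon> x) \<xi>) \<le> C * B * \<epsilon> powr (- N))"
proof -
  obtain N C where C: "C > 0" "\<forall>\<^sub>F \<epsilon> in at_right 0. \<forall>x\<in>K. norm (g \<epsilon> x) \<le> C * \<epsilon> powr (- N)"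
    using moderate_sup_bound[OF g K] by blast
  define D where "D = measure lborel K * C + 1"
  have D: "D > 0" using C(1) by (auto simp: D_def intro: add_nonneg_pos)
  have "\<forall>\<^sub>F \<epsilon> in at_right 0. \<forall>h B \<xi>. smooth_on UNIV h \<longrightarrow> (\<forall>x. x \<notin> K \<longrightarrow> h x = 0) \<longrightarrow>
     0 \<le> B \<longrightarrow> (\<forall>x\<in>K. norm (h x) \<le> B) \<longrightarrow> norm (fourier (\<lambda>x. h x * g \<epsilon> x) \<xi>) \<le> D * B * \<epsilon> powr (- N)"
    using C(2) eventually_unit
  proof eventually_elim
    case (elim \<epsilon>)
    have g\<epsilon>: "smooth_on \<Omega> (g \<epsilon>)" using g elim by (auto simp: moderate_nets_def)
    show ?case
    proof (intro allI impI)
      fix h B \<xi> assume h: "smooth_on UNIV h" "\<forall>x. x \<notin> K \<longrightarrow> h x = 0" and B: "0 \<le> (B::real)" "\<forall>x\<in>K. norm (h x) \<le> B"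
      have "smooth_on UNIV (\<lambda>x. g \<epsilon> x * h x)"
        using smooth_on_mult_extend[OF \<Omega> g\<epsilon> h(1) K] h(2) by blast
      hence c: "continuous_on UNIV (\<lambda>x. h x * g \<epsilon> x)" using smooth_on_continuous by (simp add: mult.commute)
      have n: "norm (h x * g \<epsilon> x) \<le> B * (C * \<epsilon> powr (- N))" for x
      proof (cases "x \<in> K")
        case True thus ?thesis unfolding norm_mult using B elim by (intro mult_mono) auto
      qed (use h(2) B C(1) in simp)
      have "norm (fourier (\<lambda>x. h x * g \<epsilon> x) \<xi>) \<le> measure lborel K * (B * (C * \<epsilon> powr (- N)))"
        by (rule norm_fourier_le[OF K(1) _ c n]) (use h(2) in simp)
      also have "\<dots> = (measure lborel K * C) * (B * \<epsilon> powr (- N))" by simp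
      also have "\<dots> \<le> D * (B * \<epsilon> powr (- N))" using B by (intro mult_right_mono) (auto simp: D_def)
      finally show "norm (fourier (\<lambda>x. h x * g \<epsilon> x) \<xi>) \<le> D * B * \<epsilon> powr (- N)" by (simp only: mult.assoc)
    qed
  qed
  thus ?thesis using D by blast
qed

lemma test_function_bound:
  assumes "smooth_on UNIV \<phi>" "compact K" "V \<subseteq> K"
  shows "\<exists>B>0. deriv_bound V L B \<phi>"
  using deriv_bound_compact[OF open_UNIV assms(2) subset_UNIV assms(1), of L] deriv_bound_mono[OF _ assms(3)]
  by blast

lemma fourier_test_moderate:
  assumes \<Omega>: "open \<Omega>" and g: "g \<in> moderate_nets \<Omega>" and K: "compact K" "K \<subseteq> \<Omega>"
    and \<phi>: "smooth_on UNIV \<phi>" "\<And>x. x \<notin> K \<Longrightarrow> \<phi> x = 0"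
  shows "\<exists>N C. C > 0 \<and> (\<forall>\<^sub>F \<epsilon> in at_right 0. \<forall>\<xi>. norm (fourier (\<lambda>x. \<phi> x * g \<epsilon> x) \<xi>) \<le> C * \<epsilon> powr (- N))"
proof -
  obtain N C where C: "C > 0" "\<forall>\<^sub>F \<epsilon> in at_right 0. \<forall>h B \<xi>. smooth_on UNIV h \<longrightarrow> (\<forall>x. x \<notin> K \<longrightarrow> h x = 0) \<longrightarrow>
     0 \<le> B \<longrightarrow> (\<forall>x\<in>K. norm (h x) \<le> B) \<longrightarrow> norm (fourier (\<lambda>x. h x * g \<epsilon> x) \<xi>) \<le> C * B * \<epsilon> powr (- N)"
    using fourier_mult_moderate[OF \<Omega> g K] by blast
  obtain B where B: "B > 0" "deriv_bound K 0 B \<phi>"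
    using test_function_bound[OF \<phi>(1) K(1) order.refl] by blast
  have "\<forall>\<^sub>F \<epsilon> in at_right 0. \<forall>\<xi>. norm (fourier (\<lambda>x. \<phi> x * g \<epsilon> x) \<xi>) \<le> (C * B) * \<epsilon> powr (- N)"
    using C(2)
  proof eventually_elim
    case (elim \<epsilon>)
    show ?case
      using elim[rule_format, of \<phi> B] \<phi> B deriv_bound_normD[OF B(2)] by (simp add: less_imp_le)
  qed
  moreover have "C * B > 0" using C(1) B(1) by simp
  ultimately show ?thesis by blast
qed

lemma transposed_outside:
  assumes "closed K" "\<And>x. x \<notin> K \<Longrightarrow> w x = 0" "x \<notin> K"
  shows "transposed m c \<xi> w x = 0"
proof -
  have "mi_deriv \<beta> (\<lambda>y. symbol_taylor m c \<xi> \<beta> y * w y) x = 0" for \<beta>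
    by (rule mi_deriv_outside[OF assms(1) _ assms(3)]) (simp add: assms(2))
  thus ?thesis by (simp add: transposed_def)
qed

text \<open>At high frequencies \<open>F(\<phi> Pv) = F(w v)\<close> with \<open>w\<close> the transposed operator applied to \<open>\<phi>\<close>. As \<open>w\<close> grows
  like \<open>(1 + \<bar>\<xi>\<bar>)\<^sup>m\<close>, decay of order \<open>l + m\<close> is asked of \<open>v\<close>.\<close>

lemma regular_in_diff_op:
  fixes A :: "('n::finite \<Rightarrow> nat) \<Rightarrow> 'n net"
  assumes \<Omega>: "open \<Omega>" and A: "\<And>\<alpha>. mi_order \<alpha> \<le> m \<Longrightarrow> A \<alpha> \<in> moderate_nets \<Omega>"
    and v: "v \<in> moderate_nets \<Omega>" and f: "(\<lambda>\<epsilon>. diff_op m (\<lambda>\<alpha>. A \<alpha> \<epsilon>) (v \<epsilon>)) \<in> moderate_nets \<Omega>"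
    and ell: "wh_elliptic_rep \<Omega> m A" and U: "open U" "U \<subseteq> \<Omega>"
    and reg: "regular_in v U \<Gamma>" and c: "0 < c" "c \<le> 1/2"
    and cone: "\<And>\<xi> \<eta>. \<xi> \<in> \<Gamma>' \<Longrightarrow> norm \<eta> \<le> c * norm \<xi> \<Longrightarrow> \<xi> - \<eta> \<in> \<Gamma>"
  shows "regular_in (\<lambda>\<epsilon>. diff_op m (\<lambda>\<alpha>. A \<alpha> \<epsilon>) (v \<epsilon>)) U \<Gamma>'"
  unfolding regular_in_def
proof
  fix \<phi> assume \<phi>: "\<phi> \<in> test_functions U"
  obtain K\<^sub>0 V K where K0: "compact K\<^sub>0" "K\<^sub>0 \<subseteq> V" and V: "open V" "V \<subseteq> K" and K: "compact K" "K \<subseteq> U"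
    and \<phi>0: "\<And>x. x \<notin> K\<^sub>0 \<Longrightarrow> \<phi> x = 0" using test_function_neighbourhood[OF \<phi> U(1)] by blast
  have \<phi>s: "smooth_on UNIV \<phi>" by (rule test_function_smooth[OF \<phi>])
  have K\<Omega>: "K \<subseteq> \<Omega>" "K\<^sub>0 \<subseteq> \<Omega>" "K\<^sub>0 \<subseteq> U" "V \<subseteq> \<Omega>" using K U K0 V by auto
  have As: "smooth_on \<Omega> (A \<alpha> \<epsilon>)" if "mi_order \<alpha> \<le> m" "\<epsilon> \<in> {0<..1}" for \<alpha> \<epsilon>
    using A[OF that(1)] that(2) by (auto simp: moderate_nets_def)
  note rel = wh_elliptic_relative_bound[OF ell K(1) K\<Omega>(1) \<Omega> V As]
  obtain Nu where "\<forall>\<^sub>F z in high_freq. \<forall>x\<in>K. norm (net_symbol m A (\<lambda>_. 0) z x) \<le> fst z powr (- Nu) * (1 + norm (snd z)) ^ m"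
    using symbol_upper_bound[of m A \<Omega> K, OF A K(1) K\<Omega>(1)] by blast
  hence upper: "\<forall>\<^sub>F z in high_freq. \<forall>x\<in>V. norm (net_symbol m A (\<lambda>_. 0) z x) \<le> fst z powr (- Nu) * (1 + norm (snd z)) ^ m"
    by eventually_elim (use V in blast)
  have \<phi>V: "smooth_on V \<phi>" "\<exists>B. deriv_bound V L B \<phi>" for L
    using smooth_on_subset[OF \<phi>s] test_function_bound[OF \<phi>s K(1) V(2)] by blast+
  have trans: "slow_symbol V L (\<lambda>z. fst z powr (- Nu) * (1 + norm (snd z)) ^ m) (\<lambda>z. transposed m (net_at A z) (snd z) \<phi>)" for L
    by (rule transposed_slow_symbol[OF V(1) \<phi>V upper rel])
  obtain N1 C1 where C1: "C1 > 0" and low: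
    "\<forall>\<^sub>F \<epsilon> in at_right 0. \<forall>\<xi>. norm (fourier (\<lambda>x. \<phi> x * diff_op m (\<lambda>\<alpha>. A \<alpha> \<epsilon>) (v \<epsilon>) x) \<xi>) \<le> C1 * \<epsilon> powr (- N1)"
    using fourier_test_moderate[OF \<Omega> f K0(1) K\<Omega>(2) \<phi>s \<phi>0] by blast
  obtain N2 where N2: "\<And>l. \<exists>C>0. \<forall>\<^sub>F \<epsilon> in at_right 0. \<forall>\<xi>\<in>\<Gamma>'. \<forall>w A. 0 \<le> A \<longrightarrow> smooth_on UNIV w \<longrightarrow>
     (\<forall>x. x \<notin> K\<^sub>0 \<longrightarrow> w x = 0) \<longrightarrow> deriv_bound K\<^sub>0 (l + 2 * CARD('n)) A w \<longrightarrow>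
     norm (fourier (\<lambda>x. w x * v \<epsilon> x) \<xi>) * (1 + norm \<xi>) ^ l \<le> C * A * \<epsilon> powr (- N2)"
    using fourier_mult_regular[OF \<Omega> v U reg K0(1) K\<Omega>(3) c cone] by blast
  show "\<exists>N. \<forall>l. \<exists>C>0. \<forall>\<^sub>F \<epsilon> in at_right 0. \<forall>\<xi>\<in>\<Gamma>'.
          norm (fourier (\<lambda>x. \<phi> x * diff_op m (\<lambda>\<alpha>. A \<alpha> \<epsilon>) (v \<epsilon>) x) \<xi>) \<le> C * \<epsilon> powr (- N) / (1 + norm \<xi>) ^ l"
  proof (rule exI, rule allI)
    fix l
    let ?L = "(l + m) + 2 * CARD('n)"
    obtain C2 where C2: "C2 > 0" and reg2: "\<forall>\<^sub>F \<epsilon> in at_right 0. \<forall>\<xi>\<in>\<Gamma>'. \<forall>w A. 0 \<le> A \<longrightarrow> smooth_on UNIV w \<longrightarrow>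
     (\<forall>x. x \<notin> K\<^sub>0 \<longrightarrow> w x = 0) \<longrightarrow> deriv_bound K\<^sub>0 ?L A w \<longrightarrow>
     norm (fourier (\<lambda>x. w x * v \<epsilon> x) \<xi>) * (1 + norm \<xi>) ^ (l + m) \<le> C2 * A * \<epsilon> powr (- N2)"
      using N2 by blast
    (* Slow scale factors are estimated by 1/\<epsilon>, that is, with \<delta> = 1. *)
    have high: "\<forall>\<^sub>F z in high_freq. snd z \<in> \<Gamma>' \<longrightarrow>
        norm (fourier (\<lambda>x. \<phi> x * diff_op m (\<lambda>\<alpha>. A \<alpha> (fst z)) (v (fst z)) x) (snd z)) * (1 + norm (snd z)) ^ l
          \<le> C2 * fst z powr (- (1 + Nu + N2))"
      using eventually_high_freq_fst[OF reg2] slow_symbol_smooth[OF trans]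
        slow_symbol_bound[OF trans[of ?L] zero_less_one] eventually_hf_unit
    proof eventually_elim
      case (elim z)
      define w where "w = transposed m (net_at A z) (snd z) \<phi>"
      have w0: "x \<notin> K\<^sub>0 \<Longrightarrow> w x = 0" for x
        unfolding w_def by (rule transposed_outside[OF compact_imp_closed[OF K0(1)] \<phi>0])
      have ws: "smooth_on UNIV w"
        using smooth_on_extend_zero[OF V(1) _ compact_imp_closed[OF K0(1)] K0(2) w0] elim(2) by (simp add: w_def)
      define Y where "Y = (1 + norm (snd z)) ^ m"
      have Y: "Y > 0" unfolding Y_def by (intro zero_less_power) (simp add: add_pos_nonneg)
      define B where "B = fst z powr (- 1) * (fst z powr (- Nu) * Y)"
      have B: "0 \<le> B" using Y by (simp add: B_def)
      have wb: "deriv_bound K\<^sub>0 ?L B w"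
        using elim(3) deriv_bound_mono[OF _ K0(2) order.refl order.refl] unfolding w_def B_def Y_def by blast
      have vz: "smooth_on \<Omega> (v (fst z))" using v elim(4) by (auto simp: moderate_nets_def)
      have "fourier (\<lambda>x. diff_op m (net_at A z) (v (fst z)) x * \<phi> x) (snd z) = fourier (\<lambda>x. v (fst z) x * w x) (snd z)"
        unfolding w_def by (rule fourier_diff_op[OF \<Omega> vz _ \<phi>s K0(1) K\<Omega>(2) \<phi>0]) (use As elim(4) in \<open>auto simp: net_at_def\<close>)
      hence eq: "fourier (\<lambda>x. \<phi> x * diff_op m (\<lambda>\<alpha>. A \<alpha> (fst z)) (v (fst z)) x) (snd z) = fourier (\<lambda>x. w x * v (fst z) x) (snd z)"
        by (simp add: net_at_def mult.commute)
      show ?case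
      proof
        assume "snd z \<in> \<Gamma>'"
        hence "norm (fourier (\<lambda>x. w x * v (fst z) x) (snd z)) * (1 + norm (snd z)) ^ (l + m) \<le> C2 * B * fst z powr (- N2)"
          using elim(1) B ws w0 wb by blast
        hence "(norm (fourier (\<lambda>x. w x * v (fst z) x) (snd z)) * (1 + norm (snd z)) ^ l) * Y \<le>
            (C2 * (fst z powr (- 1) * fst z powr (- Nu) * fst z powr (- N2))) * Y"
          by (simp add: power_add B_def Y_def mult_ac)
        hence "norm (fourier (\<lambda>x. w x * v (fst z) x) (snd z)) * (1 + norm (snd z)) ^ l \<le>
            C2 * (fst z powr (- 1) * fst z powr (- Nu) * fst z powr (- N2))"
          using Y mult_right_le_imp_le by blast
        also have "fst z powr (- 1) * fst z powr (- Nu) * fst z powr (- N2) = fst z powr (- (1 + Nu + N2))"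
          unfolding powr_add[symmetric] by simp
        finally show "norm (fourier (\<lambda>x. \<phi> x * diff_op m (\<lambda>\<alpha>. A \<alpha> (fst z)) (v (fst z)) x) (snd z)) * (1 + norm (snd z)) ^ l
          \<le> C2 * fst z powr (- (1 + Nu + N2))" unfolding eq .
      qed
    qed
    show "\<exists>C>0. \<forall>\<^sub>F \<epsilon> in at_right 0. \<forall>\<xi>\<in>\<Gamma>'. norm (fourier (\<lambda>x. \<phi> x * diff_op m (\<lambda>\<alpha>. A \<alpha> \<epsilon>) (v \<epsilon>) x) \<xi>)
        \<le> C * \<epsilon> powr (- (max N1 (1 + Nu + N2) + 1)) / (1 + norm \<xi>) ^ l"
      by (rule low_high_freq[OF low C1 high C2])
  qed
qed

text \<open>At high frequencies \<open>F(\<phi>v) = F(w Pv) + F(h v)\<close>, where \<open>w\<close> is the parametrix with \<open>l\<close> terms and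
  \<open>h = R\<^sup>l\<phi>\<close>, with \<open>R\<close> the correction, is its error. The decay of order \<open>l\<close> comes from the regularity
  of \<open>Pv\<close> in the first term and from \<open>h\<close> in the second, where a bound on \<open>v\<close> suffices.\<close>

lemma regular_in_of_diff_op:
  fixes A :: "('n::finite \<Rightarrow> nat) \<Rightarrow> 'n net"
  assumes \<Omega>: "open \<Omega>" and A: "\<And>\<alpha>. mi_order \<alpha> \<le> m \<Longrightarrow> A \<alpha> \<in> moderate_nets \<Omega>"
    and v: "v \<in> moderate_nets \<Omega>" and f: "(\<lambda>\<epsilon>. diff_op m (\<lambda>\<alpha>. A \<alpha> \<epsilon>) (v \<epsilon>)) \<in> moderate_nets \<Omega>"
    and ell: "wh_elliptic_rep \<Omega> m A" and U: "open U" "U \<subseteq> \<Omega>"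
    and reg: "regular_in (\<lambda>\<epsilon>. diff_op m (\<lambda>\<alpha>. A \<alpha> \<epsilon>) (v \<epsilon>)) U \<Gamma>" and c: "0 < c" "c \<le> 1/2"
    and cone: "\<And>\<xi> \<eta>. \<xi> \<in> \<Gamma>' \<Longrightarrow> norm \<eta> \<le> c * norm \<xi> \<Longrightarrow> \<xi> - \<eta> \<in> \<Gamma>"
  shows "regular_in v U \<Gamma>'"
  unfolding regular_in_def
proof
  fix \<phi> assume \<phi>: "\<phi> \<in> test_functions U"
  obtain K\<^sub>0 V K where K0: "compact K\<^sub>0" "K\<^sub>0 \<subseteq> V" and V: "open V" "V \<subseteq> K" and K: "compact K" "K \<subseteq> U"
    and \<phi>0: "\<And>x. x \<notin> K\<^sub>0 \<Longrightarrow> \<phi> x = 0" using test_function_neighbourhood[OF \<phi> U(1)] by blast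
  have \<phi>s: "smooth_on UNIV \<phi>" by (rule test_function_smooth[OF \<phi>])
  have K\<Omega>: "K \<subseteq> \<Omega>" "K\<^sub>0 \<subseteq> \<Omega>" "K\<^sub>0 \<subseteq> U" "V \<subseteq> \<Omega>" using K U K0 V by auto
  have As: "smooth_on \<Omega> (A \<alpha> \<epsilon>)" if "mi_order \<alpha> \<le> m" "\<epsilon> \<in> {0<..1}" for \<alpha> \<epsilon>
    using A[OF that(1)] that(2) by (auto simp: moderate_nets_def)
  note rel = wh_elliptic_relative_bound[OF ell K(1) K\<Omega>(1) \<Omega> V As]
  obtain q where "\<forall>\<^sub>F z in high_freq. \<forall>x\<in>K. fst z powr q * (1 + norm (snd z)) ^ m \<le> norm (net_symbol m A (\<lambda>_. 0) z x)"
    using wh_elliptic_lower_bound[OF ell K(1) K\<Omega>(1)] by blast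
  hence lower: "\<forall>\<^sub>F z in high_freq. \<forall>x\<in>V. fst z powr q * (1 + norm (snd z)) ^ m \<le> norm (net_symbol m A (\<lambda>_. 0) z x)"
    by eventually_elim (use V in blast)
  have P0: "\<forall>\<^sub>F z in high_freq. \<forall>x\<in>V. net_symbol m A (\<lambda>_. 0) z x \<noteq> 0"
    using lower eventually_hf_unit
  proof eventually_elim
    case (elim z)
    have "0 < fst z powr q * (1 + norm (snd z)) ^ m"
      using elim(2) by (intro mult_pos_pos zero_less_power) (auto simp: add_pos_nonneg)
    thus ?case using elim(1) by fastforce
  qed
  have \<phi>V: "smooth_on V \<phi>" "\<exists>B. deriv_bound V L B \<phi>" for L
    using smooth_on_subset[OF \<phi>s] test_function_bound[OF \<phi>s K(1) V(2)] by blast+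
  have par: "slow_symbol V L (\<lambda>z. fst z powr (- q)) (\<lambda>z. parametrix m (net_at A z) (snd z) \<phi> M)" for L M
    by (rule parametrix_slow_symbol[OF V(1) \<phi>V lower P0 rel])
  have cor: "slow_symbol V L (\<lambda>z. 1 / (1 + norm (snd z)) ^ k) (\<lambda>z. (correction m (net_at A z) (snd z) ^^ k) \<phi>)" for L k
    by (rule correction_slow_symbol[OF V(1) \<phi>V P0 rel])
  obtain N1 C1 where C1: "C1 > 0" and low:
    "\<forall>\<^sub>F \<epsilon> in at_right 0. \<forall>\<xi>. norm (fourier (\<lambda>x. \<phi> x * v \<epsilon> x) \<xi>) \<le> C1 * \<epsilon> powr (- N1)"
    using fourier_test_moderate[OF \<Omega> v K0(1) K\<Omega>(2) \<phi>s \<phi>0] by blast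
  obtain N2 where N2: "\<And>l. \<exists>C>0. \<forall>\<^sub>F \<epsilon> in at_right 0. \<forall>\<xi>\<in>\<Gamma>'. \<forall>w B. 0 \<le> B \<longrightarrow> smooth_on UNIV w \<longrightarrow>
     (\<forall>x. x \<notin> K\<^sub>0 \<longrightarrow> w x = 0) \<longrightarrow> deriv_bound K\<^sub>0 (l + 2 * CARD('n)) B w \<longrightarrow>
     norm (fourier (\<lambda>x. w x * diff_op m (\<lambda>\<alpha>. A \<alpha> \<epsilon>) (v \<epsilon>) x) \<xi>) * (1 + norm \<xi>) ^ l \<le> C * B * \<epsilon> powr (- N2)"
    using fourier_mult_regular[OF \<Omega> f U reg K0(1) K\<Omega>(3) c cone] by blast
  obtain N3 C3 where C3: "C3 > 0" and rem: "\<forall>\<^sub>F \<epsilon> in at_right 0. \<forall>h B \<xi>. smooth_on UNIV h \<longrightarrow> (\<forall>x. x \<notin> K\<^sub>0 \<longrightarrow> h x = 0) \<longrightarrow>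
     0 \<le> B \<longrightarrow> (\<forall>x\<in>K\<^sub>0. norm (h x) \<le> B) \<longrightarrow> norm (fourier (\<lambda>x. h x * v \<epsilon> x) \<xi>) \<le> C3 * B * \<epsilon> powr (- N3)"
    using fourier_mult_moderate[OF \<Omega> v K0(1) K\<Omega>(2)] by blast
  define N4 where "N4 = max (1 + q + N2) (1 + N3)"
  show "\<exists>N. \<forall>l. \<exists>C>0. \<forall>\<^sub>F \<epsilon> in at_right 0. \<forall>\<xi>\<in>\<Gamma>'.
          norm (fourier (\<lambda>x. \<phi> x * v \<epsilon> x) \<xi>) \<le> C * \<epsilon> powr (- N) / (1 + norm \<xi>) ^ l"
  proof (rule exI, rule allI)
    fix l
    let ?L = "l + 2 * CARD('n)"
    obtain C2 where C2: "C2 > 0" and reg2: "\<forall>\<^sub>F \<epsilon> in at_right 0. \<forall>\<xi>\<in>\<Gamma>'. \<forall>w B. 0 \<le> B \<longrightarrow> smooth_on UNIV w \<longrightarrow>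
     (\<forall>x. x \<notin> K\<^sub>0 \<longrightarrow> w x = 0) \<longrightarrow> deriv_bound K\<^sub>0 ?L B w \<longrightarrow>
     norm (fourier (\<lambda>x. w x * diff_op m (\<lambda>\<alpha>. A \<alpha> \<epsilon>) (v \<epsilon>) x) \<xi>) * (1 + norm \<xi>) ^ l \<le> C2 * B * \<epsilon> powr (- N2)"
      using N2 by blast
    have C23: "C2 + C3 > 0" using C2 C3 by simp
    (* Slow scale factors are estimated by 1/\<epsilon>, that is, with \<delta> = 1. *)
    have high: "\<forall>\<^sub>F z in high_freq. snd z \<in> \<Gamma>' \<longrightarrow>
        norm (fourier (\<lambda>x. \<phi> x * v (fst z) x) (snd z)) * (1 + norm (snd z)) ^ l \<le> (C2 + C3) * fst z powr (- N4)"
      using eventually_high_freq_fst[OF reg2] eventually_high_freq_fst[OF rem] P0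
        slow_symbol_bound[OF par[of ?L l] zero_less_one] slow_symbol_bound[OF cor[of 0 l] zero_less_one] eventually_hf_unit
    proof eventually_elim
      case (elim z)
      let ?c = "net_at A z"
      let ?\<xi> = "snd z"
      have cs: "smooth_on \<Omega> (?c \<alpha>)" if "mi_order \<alpha> \<le> m" for \<alpha>
        using As[OF that] elim(6) by (auto simp: net_at_def)
      hence csV: "smooth_on V (?c \<alpha>)" if "mi_order \<alpha> \<le> m" for \<alpha>
        using smooth_on_subset[OF _ K\<Omega>(4)] that by blast
      have p0: "symbol_taylor m ?c ?\<xi> (\<lambda>_. 0) x \<noteq> 0" if "x \<in> V" for x
        using elim(3) that by (simp add: net_symbol_def)
      note tp = transposed_parametrix[OF V(1) K0(2,1) csV p0 \<phi>s \<phi>0]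
      define w where "w = parametrix m ?c ?\<xi> \<phi> l"
      define h where "h = (correction m ?c ?\<xi> ^^ l) \<phi>"
      have ws: "smooth_on UNIV w" unfolding w_def by (rule tp(2))
      have hs: "smooth_on UNIV h" unfolding h_def by (rule tp(1))
      have w0: "x \<notin> K\<^sub>0 \<Longrightarrow> w x = 0" for x unfolding w_def by (rule tp(3))
      have h0: "x \<notin> K\<^sub>0 \<Longrightarrow> h x = 0" for x
        unfolding h_def by (rule correction_iter_outside[OF compact_imp_closed[OF K0(1)] \<phi>0])
      have T: "transposed m ?c ?\<xi> w x = \<phi> x - h x" for x unfolding w_def h_def by (rule tp(4))
      have vz: "smooth_on \<Omega> (v (fst z))" using v elim(6) by (auto simp: moderate_nets_def)
      have Ts: "smooth_on UNIV (\<lambda>x. \<phi> x - h x)" by (rule smooth_on_diff[OF open_UNIV \<phi>s hs])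
      define f where "f = diff_op m (\<lambda>\<alpha>. A \<alpha> (fst z)) (v (fst z))"
      have "fourier (\<lambda>x. diff_op m ?c (v (fst z)) x * w x) ?\<xi> = fourier (\<lambda>x. v (fst z) x * (\<phi> x - h x)) ?\<xi>"
        unfolding T[symmetric] by (rule fourier_diff_op[OF \<Omega> vz cs ws K0(1) K\<Omega>(2) w0])
      hence fw: "fourier (\<lambda>x. w x * f x) ?\<xi> = fourier (\<lambda>x. v (fst z) x * (\<phi> x - h x)) ?\<xi>"
        by (simp add: f_def net_at_def mult.commute)
      have i1: "integrable lborel (\<lambda>x. v (fst z) x * (\<phi> x - h x) * osc ?\<xi> x)"
        using smooth_on_mult_extend[OF \<Omega> vz Ts K0(1) K\<Omega>(2)] \<phi>0 h0
        by (intro fourier_integrable[OF K0(1)] smooth_on_continuous) auto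
      have i2: "integrable lborel (\<lambda>x. v (fst z) x * h x * osc ?\<xi> x)"
        using smooth_on_mult_extend[OF \<Omega> vz hs K0(1) K\<Omega>(2)] h0
        by (intro fourier_integrable[OF K0(1)] smooth_on_continuous) auto
      have "fourier (\<lambda>x. \<phi> x * v (fst z) x) ?\<xi> =
          (LINT x|lborel. v (fst z) x * (\<phi> x - h x) * osc ?\<xi> x + v (fst z) x * h x * osc ?\<xi> x)"
        unfolding fourier_osc by (intro arg_cong[where f = "integral\<^sup>L lborel"] ext) (simp add: algebra_simps)
      also have "\<dots> = fourier (\<lambda>x. w x * f x) ?\<xi> + fourier (\<lambda>x. h x * v (fst z) x) ?\<xi>"
        unfolding fw unfolding fourier_osc using Bochner_Integration.integral_add[OF i1 i2] by (simp add: mult.commute)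
      finally have split: "norm (fourier (\<lambda>x. \<phi> x * v (fst z) x) ?\<xi>) \<le>
          norm (fourier (\<lambda>x. w x * f x) ?\<xi>) + norm (fourier (\<lambda>x. h x * v (fst z) x) ?\<xi>)"
        by (simp add: norm_triangle_ineq)
      define Y where "Y = (1 + norm ?\<xi>) ^ l"
      have Y: "Y > 0" unfolding Y_def by (intro zero_less_power) (simp add: add_pos_nonneg)
      have p: "fst z powr a * fst z powr b = fst z powr (a + b)" for a b by (rule powr_add[symmetric])
      have wb: "deriv_bound K\<^sub>0 ?L (fst z powr (- 1) * fst z powr (- q)) w"
        using elim(4) deriv_bound_mono[OF _ K0(2) order.refl order.refl] unfolding w_def by blast
      have hb: "norm (h x) \<le> fst z powr (- 1) * (1 / Y)" if "x \<in> K\<^sub>0" for x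
        using elim(5) that K0(2) unfolding h_def Y_def deriv_bound_0 by blast
      show ?case
      proof
        assume \<xi>: "?\<xi> \<in> \<Gamma>'"
        have "norm (fourier (\<lambda>x. w x * f x) ?\<xi>) * Y \<le> C2 * (fst z powr (- 1) * fst z powr (- q)) * fst z powr (- N2)"
          unfolding Y_def f_def by (rule elim(1)[rule_format, OF \<xi> _ ws w0 wb]) simp_all
        also have "\<dots> = C2 * fst z powr (- (1 + q + N2))"
        proof -
          have "- 1 + - q + - N2 = - (1 + q + N2)" by simp
          thus ?thesis by (simp only: p mult.assoc[symmetric] mult.assoc[of C2])
        qed
        also have "\<dots> \<le> C2 * fst z powr (- N4)"
          using C2 elim(6) by (intro mult_left_mono powr_le_powr_small) (auto simp: N4_def)
        finally have 1: "norm (fourier (\<lambda>x. w x * f x) ?\<xi>) * Y \<le> C2 * fst z powr (- N4)" .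
        have "norm (fourier (\<lambda>x. h x * v (fst z) x) ?\<xi>) \<le> C3 * (fst z powr (- 1) * (1 / Y)) * fst z powr (- N3)"
          by (rule elim(2)[rule_format, OF hs h0 _ hb]) (use Y in simp_all)
        hence "norm (fourier (\<lambda>x. h x * v (fst z) x) ?\<xi>) * Y \<le> (C3 * (fst z powr (- 1) * (1 / Y)) * fst z powr (- N3)) * Y"
          using Y by (intro mult_right_mono) auto
        also have "\<dots> = C3 * (fst z powr (- 1) * fst z powr (- N3))" using Y by (simp add: field_simps)
        also have "\<dots> = C3 * fst z powr (- (1 + N3))" unfolding p by simp
        also have "\<dots> \<le> C3 * fst z powr (- N4)"
          using C3 elim(6) by (intro mult_left_mono powr_le_powr_small) (auto simp: N4_def)
        finally have 2: "norm (fourier (\<lambda>x. h x * v (fst z) x) ?\<xi>) * Y \<le> C3 * fst z powr (- N4)" .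
        have "norm (fourier (\<lambda>x. \<phi> x * v (fst z) x) ?\<xi>) * Y \<le>
           norm (fourier (\<lambda>x. w x * f x) ?\<xi>) * Y + norm (fourier (\<lambda>x. h x * v (fst z) x) ?\<xi>) * Y"
          using mult_right_mono[OF split, of Y] Y by (simp add: algebra_simps)
        also have "\<dots> \<le> (C2 + C3) * fst z powr (- N4)" using 1 2 by (simp add: algebra_simps)
        finally show "norm (fourier (\<lambda>x. \<phi> x * v (fst z) x) ?\<xi>) * (1 + norm ?\<xi>) ^ l \<le> (C2 + C3) * fst z powr (- N4)"
          unfolding Y_def .
      qed
    qed
    show "\<exists>C>0. \<forall>\<^sub>F \<epsilon> in at_right 0. \<forall>\<xi>\<in>\<Gamma>'. norm (fourier (\<lambda>x. \<phi> x * v \<epsilon> x) \<xi>)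
        \<le> C * \<epsilon> powr (- (max N1 N4 + 1)) / (1 + norm \<xi>) ^ l"
      by (rule low_high_freq[OF low C1 high C23])
  qed
qed

section \<open>Moderate and null nets\<close>

definition net_bound :: "(real ^ 'n) set \<Rightarrow> nat \<Rightarrow> real \<Rightarrow> 'n net \<Rightarrow> bool" where
  "net_bound K L N f \<longleftrightarrow> (\<forall>\<^sub>F \<epsilon> in at_right 0. deriv_bound K L (\<epsilon> powr (- N)) (f \<epsilon>))"

definition smooth_net :: "(real ^ 'n) set \<Rightarrow> 'n net \<Rightarrow> bool" where
  "smooth_net \<Omega> f \<longleftrightarrow> (\<forall>\<epsilon>\<in>{0<..1}. smooth_on \<Omega> (f \<epsilon>))"

lemma smooth_net_eventually: "smooth_net \<Omega> f \<Longrightarrow> \<forall>\<^sub>F \<epsilon> in at_right 0. smooth_on \<Omega> (f \<epsilon>)"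
  using eventually_unit by eventually_elim (auto simp: smooth_net_def)

lemma net_bound_mono:
  assumes "net_bound K L N f" "N \<le> N'"
  shows "net_bound K L N' f"
  using assms(1) eventually_unit unfolding net_bound_def
proof eventually_elim
  case (elim \<epsilon>)
  have "\<epsilon> powr (- N) \<le> \<epsilon> powr (- N')" using elim(2) assms(2) by (intro powr_le_powr_small) auto
  thus ?case by (rule deriv_bound_mono[OF elim(1) order.refl order.refl])
qed

lemma net_bound_add:
  assumes \<Omega>: "open \<Omega>" "K \<subseteq> \<Omega>" and s: "smooth_net \<Omega> f" "smooth_net \<Omega> g"
    and b: "net_bound K L N f" "net_bound K L N g"
  shows "net_bound K L (N + 1) (\<lambda>\<epsilon> x. f \<epsilon> x + g \<epsilon> x)"
  using smooth_net_eventually[OF s(1)] smooth_net_eventually[OF s(2)] b[unfolded net_bound_def]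
    const_le_powr_small[OF zero_less_one, of 2]
  unfolding net_bound_def
proof eventually_elim
  case (elim \<epsilon>)
  have "\<epsilon> powr (- N) + \<epsilon> powr (- N) = 2 * \<epsilon> powr (- N)" by simp
  also have "\<dots> \<le> \<epsilon> powr (- 1) * \<epsilon> powr (- N)" using elim(5) by (intro mult_right_mono) auto
  also have "\<dots> = \<epsilon> powr (- (N + 1))" unfolding powr_add[symmetric] by (simp add: algebra_simps)
  finally show ?case
    by (rule deriv_bound_mono[OF deriv_bound_add[OF \<Omega> elim(1-4)] order.refl order.refl])
qed

lemma net_bound_mult:
  assumes \<Omega>: "open \<Omega>" "K \<subseteq> \<Omega>" and s: "smooth_net \<Omega> f" "smooth_net \<Omega> g"
    and b: "net_bound K L N f" "net_bound K L M g"
  shows "net_bound K L (N + M + 1) (\<lambda>\<epsilon> x. f \<epsilon> x * g \<epsilon> x)"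
  using smooth_net_eventually[OF s(1)] smooth_net_eventually[OF s(2)] b[unfolded net_bound_def]
    const_le_powr_small[OF zero_less_one, of "2 ^ L"]
  unfolding net_bound_def
proof eventually_elim
  case (elim \<epsilon>)
  have "2 ^ L * \<epsilon> powr (- N) * \<epsilon> powr (- M) = 2 ^ L * (\<epsilon> powr (- N) * \<epsilon> powr (- M))" by simp
  also have "\<dots> \<le> \<epsilon> powr (- 1) * (\<epsilon> powr (- N) * \<epsilon> powr (- M))" using elim(5) by (intro mult_right_mono) auto
  also have "\<dots> = \<epsilon> powr (- (N + M + 1))" unfolding powr_add[symmetric] by (simp add: algebra_simps)
  finally have "2 ^ L * \<epsilon> powr (- N) * \<epsilon> powr (- M) \<le> \<epsilon> powr (- (N + M + 1))" .
  moreover have "deriv_bound K L (2 ^ L * \<epsilon> powr (- N) * \<epsilon> powr (- M)) (\<lambda>x. f \<epsilon> x * g \<epsilon> x)"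
    by (rule deriv_bound_mult[OF \<Omega> elim(1-4)]) auto
  ultimately show ?case by (rule deriv_bound_mono[OF _ order.refl order.refl, rotated])
qed

lemma net_bound_finite:
  assumes s: "\<And>js. length js \<le> L \<Longrightarrow> \<forall>\<^sub>F \<epsilon> in at_right 0. \<forall>x\<in>K. norm (iter_deriv js (f \<epsilon>) x) \<le> \<epsilon> powr (- N)"
  shows "net_bound K L N f"
proof -
  have "finite {js :: 'a list. set js \<subseteq> UNIV \<and> length js \<le> L}" by (rule finite_lists_length_le) simp
  hence "\<forall>\<^sub>F \<epsilon> in at_right 0. \<forall>js\<in>{js :: 'a list. set js \<subseteq> UNIV \<and> length js \<le> L}. \<forall>x\<in>K. norm (iter_deriv js (f \<epsilon>) x) \<le> \<epsilon> powr (- N)"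
    by (rule eventually_ball_finite) (use s in blast)
  thus ?thesis unfolding net_bound_def by eventually_elim (auto simp: deriv_bound_def)
qed

lemma iter_deriv_bound_of_mi_deriv:
  assumes \<Omega>: "open \<Omega>" and f: "smooth_net \<Omega> f" and K: "K \<subseteq> \<Omega>" and N: "1 - q \<le> N"
    and b: "\<forall>\<^sub>F \<epsilon> in at_right 0. \<forall>x\<in>K. norm (mi_deriv (count_list js) (f \<epsilon>) x) \<le> C * \<epsilon> powr q"
  shows "\<forall>\<^sub>F \<epsilon> in at_right 0. \<forall>x\<in>K. norm (iter_deriv js (f \<epsilon>) x) \<le> \<epsilon> powr (- N)"
  using b smooth_net_eventually[OF f] const_le_powr_small[OF zero_less_one, of C] eventually_unit
proof eventually_elim
  case (elim \<epsilon>)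
  have "C * \<epsilon> powr q \<le> \<epsilon> powr (- 1) * \<epsilon> powr q" using elim(3) by (intro mult_right_mono) auto
  also have "\<dots> = \<epsilon> powr (- (1 - q))" unfolding powr_add[symmetric] by simp
  also have "\<dots> \<le> \<epsilon> powr (- N)" using elim(4) N by (intro powr_le_powr_small) auto
  finally have c: "C * \<epsilon> powr q \<le> \<epsilon> powr (- N)" .
  show ?case
  proof
    fix x assume x: "x \<in> K"
    hence "x \<in> \<Omega>" using K by blast
    from mi_deriv_eq_iter_deriv[OF \<Omega> elim(2) this, of js "count_list js"]
    have "norm (iter_deriv js (f \<epsilon>) x) = norm (mi_deriv (count_list js) (f \<epsilon>) x)" by simp
    also have "\<dots> \<le> C * \<epsilon> powr q" using elim(1) x by blast
    finally show "norm (iter_deriv js (f \<epsilon>) x) \<le> \<epsilon> powr (- N)" using c by linarith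
  qed
qed

text \<open>Bounds on all derivatives up to a given order at once, without constant, are what the product rule
  needs. The constant is absorbed by one more power of \<open>1/\<epsilon>\<close>.\<close>

lemma moderate_nets_iff:
  assumes \<Omega>: "open \<Omega>"
  shows "f \<in> moderate_nets \<Omega> \<longleftrightarrow> smooth_net \<Omega> f \<and> (\<forall>K L. compact K \<and> K \<subseteq> \<Omega> \<longrightarrow> (\<exists>N. net_bound K L N f))"
proof (intro iffI conjI allI impI)
  assume f: "f \<in> moderate_nets \<Omega>"
  show sm: "smooth_net \<Omega> f" using f by (simp add: moderate_nets_def smooth_net_def)
  fix K L assume K: "compact K \<and> K \<subseteq> \<Omega>"
  let ?I = "{js :: 'a list. set js \<subseteq> UNIV \<and> length js \<le> L}"
  have fin: "finite ?I" by (rule finite_lists_length_le) simp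
  have "\<exists>N. \<forall>\<^sub>F \<epsilon> in at_right 0. \<forall>x\<in>K. norm (iter_deriv js (f \<epsilon>) x) \<le> \<epsilon> powr (- N)" for js
  proof -
    obtain p C where "\<forall>\<^sub>F \<epsilon> in at_right 0. \<forall>x\<in>K. norm (mi_deriv (count_list js) (f \<epsilon>) x) \<le> C * \<epsilon> powr (- p)"
      using f K unfolding moderate_nets_def by blast
    from iter_deriv_bound_of_mi_deriv[OF \<Omega> sm _ order.refl this] K
    have "\<forall>\<^sub>F \<epsilon> in at_right 0. \<forall>x\<in>K. norm (iter_deriv js (f \<epsilon>) x) \<le> \<epsilon> powr (- (1 - - p))" by blast
    thus ?thesis by blast
  qed
  hence "\<forall>js. \<exists>N. \<forall>\<^sub>F \<epsilon> in at_right 0. \<forall>x\<in>K. norm (iter_deriv js (f \<epsilon>) x) \<le> \<epsilon> powr (- N)" by blast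
  from choice[OF this] obtain N where N: "\<And>js. \<forall>\<^sub>F \<epsilon> in at_right 0. \<forall>x\<in>K. norm (iter_deriv js (f \<epsilon>) x) \<le> \<epsilon> powr (- N js)"
    by blast
  define N0 where "N0 = (\<Sum>js\<in>?I. \<bar>N js\<bar>)"
  have "net_bound K L N0 f"
  proof (rule net_bound_finite)
    fix js :: "'a list" assume "length js \<le> L"
    hence "\<bar>N js\<bar> \<le> N0" unfolding N0_def using fin by (intro member_le_sum) auto
    hence le: "N js \<le> N0" by linarith
    show "\<forall>\<^sub>F \<epsilon> in at_right 0. \<forall>x\<in>K. norm (iter_deriv js (f \<epsilon>) x) \<le> \<epsilon> powr (- N0)"
      using N[of js] eventually_unit
    proof eventually_elim
      case (elim \<epsilon>)
      have "\<epsilon> powr (- N js) \<le> \<epsilon> powr (- N0)" using elim(2) le by (intro powr_le_powr_small) auto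
      thus ?case using elim(1) order_trans by blast
    qed
  qed
  thus "\<exists>N. net_bound K L N f" by blast
next
  assume r: "smooth_net \<Omega> f \<and> (\<forall>K L. compact K \<and> K \<subseteq> \<Omega> \<longrightarrow> (\<exists>N. net_bound K L N f))"
  show "f \<in> moderate_nets \<Omega>"
    unfolding moderate_nets_def
  proof (intro CollectI conjI allI impI)
    show "\<forall>\<epsilon>\<in>{0<..1}. smooth_on \<Omega> (f \<epsilon>)" using r by (simp add: smooth_net_def)
    fix K and \<alpha> :: "'a \<Rightarrow> nat" assume K: "compact K \<and> K \<subseteq> \<Omega>"
    obtain js where js: "length js = mi_order \<alpha>" "\<forall>f. mi_deriv \<alpha> f = iter_deriv js f" using mi_deriv_iter_list by blast
    obtain N where "net_bound K (mi_order \<alpha>) N f" using r K by blast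
    hence "net_bound K (mi_order \<alpha>) (max N 0) f" by (rule net_bound_mono) simp
    hence "\<forall>\<^sub>F \<epsilon> in at_right 0. \<forall>x\<in>K. norm (mi_deriv \<alpha> (f \<epsilon>) x) \<le> 1 * \<epsilon> powr (- max N 0)"
      unfolding net_bound_def by eventually_elim (use js in \<open>auto simp: deriv_bound_def\<close>)
    thus "\<exists>p\<ge>0. \<exists>C. \<forall>\<^sub>F \<epsilon> in at_right 0. \<forall>x\<in>K. norm (mi_deriv \<alpha> (f \<epsilon>) x) \<le> C * \<epsilon> powr (- p)"
      by (intro exI[of _ "max N 0"] conjI exI[of _ 1]) auto
  qed
qed

lemma null_nets_iff:
  assumes \<Omega>: "open \<Omega>"
  shows "f \<in> null_nets \<Omega> \<longleftrightarrow> smooth_net \<Omega> f \<and> (\<forall>K L N. compact K \<and> K \<subseteq> \<Omega> \<longrightarrow> net_bound K L N f)"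
proof (intro iffI conjI allI impI)
  assume f: "f \<in> null_nets \<Omega>"
  show sm: "smooth_net \<Omega> f" using f by (simp add: null_nets_def smooth_net_def)
  fix K L and N :: real assume K: "compact K \<and> K \<subseteq> \<Omega>"
  (* The additional power of \<epsilon> absorbs the constant. *)
  define q where "q = max 0 (- N) + 1"
  have q: "q \<ge> 0" "1 - q \<le> N" by (auto simp: q_def)
  show "net_bound K L N f"
  proof (rule net_bound_finite)
    fix js :: "'a list"
    obtain C where "\<forall>\<^sub>F \<epsilon> in at_right 0. \<forall>x\<in>K. norm (mi_deriv (count_list js) (f \<epsilon>) x) \<le> C * \<epsilon> powr q"
      using f K q(1) unfolding null_nets_def by blast
    from iter_deriv_bound_of_mi_deriv[OF \<Omega> sm _ q(2) this] K
    show "\<forall>\<^sub>F \<epsilon> in at_right 0. \<forall>x\<in>K. norm (iter_deriv js (f \<epsilon>) x) \<le> \<epsilon> powr (- N)" by blast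
  qed
next
  assume r: "smooth_net \<Omega> f \<and> (\<forall>K L N. compact K \<and> K \<subseteq> \<Omega> \<longrightarrow> net_bound K L N f)"
  show "f \<in> null_nets \<Omega>"
    unfolding null_nets_def
  proof (intro CollectI conjI allI impI)
    show "\<forall>\<epsilon>\<in>{0<..1}. smooth_on \<Omega> (f \<epsilon>)" using r by (simp add: smooth_net_def)
    fix K and \<alpha> :: "'a \<Rightarrow> nat" and q :: real assume K: "compact K \<and> K \<subseteq> \<Omega>"
    obtain js where js: "length js = mi_order \<alpha>" "\<forall>f. mi_deriv \<alpha> f = iter_deriv js f" using mi_deriv_iter_list by blast
    have "net_bound K (mi_order \<alpha>) (- q) f" using r K by blast
    hence "\<forall>\<^sub>F \<epsilon> in at_right 0. \<forall>x\<in>K. norm (mi_deriv \<alpha> (f \<epsilon>) x) \<le> 1 * \<epsilon> powr q"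
      unfolding net_bound_def by eventually_elim (use js in \<open>auto simp: deriv_bound_def\<close>)
    thus "\<exists>C. \<forall>\<^sub>F \<epsilon> in at_right 0. \<forall>x\<in>K. norm (mi_deriv \<alpha> (f \<epsilon>) x) \<le> C * \<epsilon> powr q" by blast
  qed
qed

lemma smooth_net_add: "open \<Omega> \<Longrightarrow> smooth_net \<Omega> f \<Longrightarrow> smooth_net \<Omega> g \<Longrightarrow> smooth_net \<Omega> (\<lambda>\<epsilon> x. f \<epsilon> x + g \<epsilon> x)"
  unfolding smooth_net_def by (intro ballI smooth_on_add) auto

lemma smooth_net_mult: "open \<Omega> \<Longrightarrow> smooth_net \<Omega> f \<Longrightarrow> smooth_net \<Omega> g \<Longrightarrow> smooth_net \<Omega> (\<lambda>\<epsilon> x. f \<epsilon> x * g \<epsilon> x)"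
  unfolding smooth_net_def by (intro ballI smooth_on_mult) auto

lemma moderate_nets_add:
  assumes \<Omega>: "open \<Omega>" and f: "f \<in> moderate_nets \<Omega>" and g: "g \<in> moderate_nets \<Omega>"
  shows "(\<lambda>\<epsilon> x. f \<epsilon> x + g \<epsilon> x) \<in> moderate_nets \<Omega>"
  unfolding moderate_nets_iff[OF \<Omega>]
proof (intro conjI allI impI)
  have s: "smooth_net \<Omega> f" "smooth_net \<Omega> g" using f g by (auto simp: moderate_nets_iff[OF \<Omega>])
  show "smooth_net \<Omega> (\<lambda>\<epsilon> x. f \<epsilon> x + g \<epsilon> x)" by (rule smooth_net_add[OF \<Omega> s])
  fix K L assume K: "compact K \<and> K \<subseteq> \<Omega>"
  obtain N M where "net_bound K L N f" "net_bound K L M g" using f g K unfolding moderate_nets_iff[OF \<Omega>] by blast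
  hence "net_bound K L (max N M) f" "net_bound K L (max N M) g" using net_bound_mono by fastforce+
  thus "\<exists>N. net_bound K L N (\<lambda>\<epsilon> x. f \<epsilon> x + g \<epsilon> x)" using net_bound_add[OF \<Omega> _ s] K by blast
qed

lemma moderate_nets_mult:
  assumes \<Omega>: "open \<Omega>" and f: "f \<in> moderate_nets \<Omega>" and g: "g \<in> moderate_nets \<Omega>"
  shows "(\<lambda>\<epsilon> x. f \<epsilon> x * g \<epsilon> x) \<in> moderate_nets \<Omega>"
  unfolding moderate_nets_iff[OF \<Omega>]
proof (intro conjI allI impI)
  have s: "smooth_net \<Omega> f" "smooth_net \<Omega> g" using f g by (auto simp: moderate_nets_iff[OF \<Omega>])
  show "smooth_net \<Omega> (\<lambda>\<epsilon> x. f \<epsilon> x * g \<epsilon> x)" by (rule smooth_net_mult[OF \<Omega> s])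
  fix K L assume K: "compact K \<and> K \<subseteq> \<Omega>"
  obtain N M where "net_bound K L N f" "net_bound K L M g" using f g K unfolding moderate_nets_iff[OF \<Omega>] by blast
  thus "\<exists>N. net_bound K L N (\<lambda>\<epsilon> x. f \<epsilon> x * g \<epsilon> x)" using net_bound_mult[OF \<Omega> _ s] K by blast
qed

lemma moderate_nets_const: "open \<Omega> \<Longrightarrow> (\<lambda>_ _. c) \<in> moderate_nets \<Omega>"
proof -
  assume \<Omega>: "open \<Omega>"
  have "net_bound K L 1 (\<lambda>_ _. c)" for K :: "(real ^ 'a) set" and L
    unfolding net_bound_def using const_le_powr_small[OF zero_less_one, of "norm c"]
    by eventually_elim (rule deriv_bound_const)
  thus ?thesis unfolding moderate_nets_iff[OF \<Omega>] by (auto simp: smooth_net_def smooth_on_const[OF \<Omega>])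
qed

lemma null_nets_zero: "open \<Omega> \<Longrightarrow> (\<lambda>_ _. 0) \<in> null_nets \<Omega>"
  by (auto simp: null_nets_iff smooth_net_def smooth_on_const net_bound_def intro!: deriv_bound_const always_eventually)

lemma null_nets_add:
  assumes \<Omega>: "open \<Omega>" and f: "f \<in> null_nets \<Omega>" and g: "g \<in> null_nets \<Omega>"
  shows "(\<lambda>\<epsilon> x. f \<epsilon> x + g \<epsilon> x) \<in> null_nets \<Omega>"
  unfolding null_nets_iff[OF \<Omega>]
proof (intro conjI allI impI)
  have s: "smooth_net \<Omega> f" "smooth_net \<Omega> g" using f g by (auto simp: null_nets_iff[OF \<Omega>])
  show "smooth_net \<Omega> (\<lambda>\<epsilon> x. f \<epsilon> x + g \<epsilon> x)" by (rule smooth_net_add[OF \<Omega> s])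
  fix K L N assume K: "compact K \<and> K \<subseteq> \<Omega>"
  hence "net_bound K L (N - 1) f" "net_bound K L (N - 1) g" using f g unfolding null_nets_iff[OF \<Omega>] by blast+
  from net_bound_add[OF \<Omega> _ s this] K show "net_bound K L N (\<lambda>\<epsilon> x. f \<epsilon> x + g \<epsilon> x)" by simp
qed

lemma null_nets_mult:
  assumes \<Omega>: "open \<Omega>" and f: "f \<in> null_nets \<Omega>" and g: "g \<in> moderate_nets \<Omega>"
  shows "(\<lambda>\<epsilon> x. f \<epsilon> x * g \<epsilon> x) \<in> null_nets \<Omega>"
  unfolding null_nets_iff[OF \<Omega>]
proof (intro conjI allI impI)
  have s: "smooth_net \<Omega> f" "smooth_net \<Omega> g" using f g by (auto simp: null_nets_iff[OF \<Omega>] moderate_nets_iff[OF \<Omega>])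
  show "smooth_net \<Omega> (\<lambda>\<epsilon> x. f \<epsilon> x * g \<epsilon> x)" by (rule smooth_net_mult[OF \<Omega> s])
  fix K L N assume K: "compact K \<and> K \<subseteq> \<Omega>"
  then obtain M where M: "net_bound K L M g" using g unfolding moderate_nets_iff[OF \<Omega>] by blast
  have "net_bound K L (N - M - 1) f" using f K unfolding null_nets_iff[OF \<Omega>] by blast
  from net_bound_mult[OF \<Omega> _ s this M] K show "net_bound K L N (\<lambda>\<epsilon> x. f \<epsilon> x * g \<epsilon> x)" by simp
qed

lemma null_nets_diff:
  assumes \<Omega>: "open \<Omega>" and f: "f \<in> null_nets \<Omega>" and g: "g \<in> null_nets \<Omega>"
  shows "(\<lambda>\<epsilon> x. f \<epsilon> x - g \<epsilon> x) \<in> null_nets \<Omega>"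
  using null_nets_add[OF \<Omega> f null_nets_mult[OF \<Omega> g moderate_nets_const[OF \<Omega>, of "-1"]]] by simp

lemma moderate_nets_sum:
  assumes \<Omega>: "open \<Omega>" and "finite I" and f: "\<And>i. i \<in> I \<Longrightarrow> f i \<in> moderate_nets \<Omega>"
  shows "(\<lambda>\<epsilon> x. \<Sum>i\<in>I. f i \<epsilon> x) \<in> moderate_nets \<Omega>"
  using assms(2) f
proof (induction I)
  case empty
  show ?case using moderate_nets_const[OF \<Omega>, of 0] by simp
next
  case (insert i I)
  have "(\<lambda>\<epsilon> x. f i \<epsilon> x + (\<Sum>i\<in>I. f i \<epsilon> x)) \<in> moderate_nets \<Omega>"
    by (rule moderate_nets_add[OF \<Omega>]) (use insert in auto)
  thus ?case using insert.hyps by simp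
qed

lemma null_nets_sum:
  assumes \<Omega>: "open \<Omega>" and "finite I" and f: "\<And>i. i \<in> I \<Longrightarrow> f i \<in> null_nets \<Omega>"
  shows "(\<lambda>\<epsilon> x. \<Sum>i\<in>I. f i \<epsilon> x) \<in> null_nets \<Omega>"
  using assms(2) f
proof (induction I)
  case empty
  show ?case using null_nets_zero[OF \<Omega>] by simp
next
  case (insert i I)
  have "(\<lambda>\<epsilon> x. f i \<epsilon> x + (\<Sum>i\<in>I. f i \<epsilon> x)) \<in> null_nets \<Omega>"
    by (rule null_nets_add[OF \<Omega>]) (use insert in auto)
  thus ?case using insert.hyps by simp
qed

lemma moderate_nets_mi_deriv:
  assumes \<Omega>: "open \<Omega>" and f: "f \<in> moderate_nets \<Omega>"
  shows "(\<lambda>\<epsilon>. mi_deriv \<alpha> (f \<epsilon>)) \<in> moderate_nets \<Omega>"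
  unfolding moderate_nets_iff[OF \<Omega>]
proof (intro conjI allI impI)
  show "smooth_net \<Omega> (\<lambda>\<epsilon>. mi_deriv \<alpha> (f \<epsilon>))"
    using f smooth_on_mi_deriv unfolding moderate_nets_iff[OF \<Omega>] smooth_net_def by blast
  fix K L assume K: "compact K \<and> K \<subseteq> \<Omega>"
  obtain N where "net_bound K (mi_order \<alpha> + L) N f" using f K unfolding moderate_nets_iff[OF \<Omega>] by blast
  hence "net_bound K L N (\<lambda>\<epsilon>. mi_deriv \<alpha> (f \<epsilon>))"
    unfolding net_bound_def by eventually_elim (rule deriv_bound_mi_deriv)
  thus "\<exists>N. net_bound K L N (\<lambda>\<epsilon>. mi_deriv \<alpha> (f \<epsilon>))" by blast
qed

lemma diff_op_moderate:
  fixes A :: "('n::finite \<Rightarrow> nat) \<Rightarrow> 'n net"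
  assumes \<Omega>: "open \<Omega>" and A: "\<And>\<alpha>. mi_order \<alpha> \<le> m \<Longrightarrow> A \<alpha> \<in> moderate_nets \<Omega>" and v: "v \<in> moderate_nets \<Omega>"
  shows "(\<lambda>\<epsilon>. diff_op m (\<lambda>\<alpha>. A \<alpha> \<epsilon>) (v \<epsilon>)) \<in> moderate_nets \<Omega>"
  unfolding diff_op_def[abs_def]
  by (rule moderate_nets_sum[OF \<Omega> finite_mi_order],
      rule moderate_nets_mult[OF \<Omega> A moderate_nets_mult[OF \<Omega> moderate_nets_const[OF \<Omega>] moderate_nets_mi_deriv[OF \<Omega> v]]]) simp

lemma diff_op_null:
  fixes A B :: "('n::finite \<Rightarrow> nat) \<Rightarrow> 'n net"
  assumes \<Omega>: "open \<Omega>" and AB: "\<And>\<alpha>. mi_order \<alpha> \<le> m \<Longrightarrow> (\<lambda>\<epsilon> x. A \<alpha> \<epsilon> x - B \<alpha> \<epsilon> x) \<in> null_nets \<Omega>" and v: "v \<in> moderate_nets \<Omega>"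
  shows "(\<lambda>\<epsilon> x. diff_op m (\<lambda>\<alpha>. A \<alpha> \<epsilon>) (v \<epsilon>) x - diff_op m (\<lambda>\<alpha>. B \<alpha> \<epsilon>) (v \<epsilon>) x) \<in> null_nets \<Omega>"
proof -
  have "(\<lambda>\<epsilon> x. \<Sum>\<alpha> | mi_order \<alpha> \<le> m. (A \<alpha> \<epsilon> x - B \<alpha> \<epsilon> x) * ((- \<i>) ^ mi_order \<alpha> * mi_deriv \<alpha> (v \<epsilon>) x)) \<in> null_nets \<Omega>"
    by (rule null_nets_sum[OF \<Omega> finite_mi_order],
        rule null_nets_mult[OF \<Omega> AB moderate_nets_mult[OF \<Omega> moderate_nets_const[OF \<Omega>] moderate_nets_mi_deriv[OF \<Omega> v]]]) simp
  thus ?thesis by (simp add: diff_op_def left_diff_distrib sum_subtractf)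
qed

section \<open>Independence of representatives\<close>

text \<open>The difference, cut off by \<open>\<phi>\<close>, has all its derivatives bounded by any power of \<open>\<epsilon>\<close>; its transform
  therefore decays rapidly in all directions.\<close>

lemma regular_in_null:
  assumes \<Omega>: "open \<Omega>" and f: "f \<in> moderate_nets \<Omega>" and g: "g \<in> moderate_nets \<Omega>"
    and null: "(\<lambda>\<epsilon> x. f \<epsilon> x - g \<epsilon> x) \<in> null_nets \<Omega>" and U: "open U" "U \<subseteq> \<Omega>" and reg: "regular_in g U \<Gamma>"
  shows "regular_in f U \<Gamma>"
  unfolding regular_in_def
proof
  fix \<phi> assume \<phi>: "\<phi> \<in> test_functions U"
  obtain K V K' where K: "compact K" "K \<subseteq> V" and "open V" and V: "V \<subseteq> K'" and "compact K'" and V': "K' \<subseteq> U"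
    and \<phi>0: "\<And>x. x \<notin> K \<Longrightarrow> \<phi> x = 0" by (rule test_function_neighbourhood[OF \<phi> U(1)]) (rule that)
  have K\<Omega>: "K \<subseteq> \<Omega>" using K V V' U by blast
  have \<phi>s: "smooth_on UNIV \<phi>" by (rule test_function_smooth[OF \<phi>])
  obtain N where N: "\<And>l. \<exists>C>0. \<forall>\<^sub>F \<epsilon> in at_right 0. \<forall>\<xi>\<in>\<Gamma>.
          norm (fourier (\<lambda>x. \<phi> x * g \<epsilon> x) \<xi>) \<le> C * \<epsilon> powr (- N) / (1 + norm \<xi>) ^ l"
    using reg \<phi> unfolding regular_in_def by blast
  let ?d = "\<lambda>\<epsilon> x. f \<epsilon> x - g \<epsilon> x"
  show "\<exists>N. \<forall>l. \<exists>C>0. \<forall>\<^sub>F \<epsilon> in at_right 0. \<forall>\<xi>\<in>\<Gamma>.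
          norm (fourier (\<lambda>x. \<phi> x * f \<epsilon> x) \<xi>) \<le> C * \<epsilon> powr (- N) / (1 + norm \<xi>) ^ l"
  proof (rule exI[of _ N], rule allI)
    fix l
    obtain C where C: "C > 0" "\<forall>\<^sub>F \<epsilon> in at_right 0. \<forall>\<xi>\<in>\<Gamma>.
          norm (fourier (\<lambda>x. \<phi> x * g \<epsilon> x) \<xi>) \<le> C * \<epsilon> powr (- N) / (1 + norm \<xi>) ^ l" using N by blast
    obtain B where B: "B > 0" "deriv_bound K l B \<phi>"
      using test_function_bound[OF \<phi>s K(1) order.refl] by blast
    have nb: "\<forall>\<^sub>F \<epsilon> in at_right 0. deriv_bound K l (\<epsilon> powr (- N)) (?d \<epsilon>)"
      using null K(1) K\<Omega> unfolding null_nets_iff[OF \<Omega>] net_bound_def by blast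
    define D where "D = (real CARD('a) + 1) ^ l * (measure lborel K * (2 ^ l * B))"
    have D: "D \<ge> 0" using B(1) by (simp add: D_def)
    have "\<forall>\<^sub>F \<epsilon> in at_right 0. \<forall>\<xi>\<in>\<Gamma>.
          norm (fourier (\<lambda>x. \<phi> x * f \<epsilon> x) \<xi>) \<le> (C + D) * \<epsilon> powr (- N) / (1 + norm \<xi>) ^ l"
      using C(2) nb eventually_unit
    proof eventually_elim
      case (elim \<epsilon>)
      have s: "smooth_on \<Omega> (f \<epsilon>)" "smooth_on \<Omega> (g \<epsilon>)" using f g elim(3) by (auto simp: moderate_nets_def)
      have sd: "smooth_on \<Omega> (?d \<epsilon>)" by (rule smooth_on_diff[OF \<Omega> s])
      have ext: "smooth_on UNIV (\<lambda>x. \<phi> x * h x)" if "smooth_on \<Omega> h" for h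
        using smooth_on_mult_extend[OF \<Omega> that \<phi>s K(1) K\<Omega> \<phi>0] by (simp add: mult.commute)
      have int: "integrable lborel (\<lambda>x. \<phi> x * h x * osc \<xi> x)" if "smooth_on \<Omega> h" for h \<xi>
        by (rule fourier_integrable[OF K(1) smooth_on_continuous[OF ext[OF that]]]) (simp add: \<phi>0)
      have "deriv_bound K l (2 ^ l * B * \<epsilon> powr (- N)) (\<lambda>x. \<phi> x * ?d \<epsilon> x)"
        by (rule deriv_bound_mult[OF \<Omega> K\<Omega> smooth_on_subset[OF \<phi>s] sd B(2) elim(2)]) (use B(1) in auto)
      hence *: "deriv_bound UNIV l (2 ^ l * B * \<epsilon> powr (- N)) (\<lambda>x. \<phi> x * ?d \<epsilon> x)"
        using B(1) by (intro deriv_bound_extend[OF compact_imp_closed[OF K(1)]]) (auto simp: \<phi>0)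
      have db: "norm (fourier (\<lambda>x. \<phi> x * ?d \<epsilon> x) \<xi>) * (1 + norm \<xi>) ^ l \<le> D * \<epsilon> powr (- N)" for \<xi>
        using fourier_decay[OF ext[OF sd] K(1) _ *, of \<xi>] \<phi>0 by (simp add: D_def mult_ac)
      show ?case
      proof
        fix \<xi> assume \<xi>: "\<xi> \<in> \<Gamma>"
        have pos: "(1 + norm \<xi>) ^ l > 0" by (intro zero_less_power) (simp add: add_pos_nonneg)
        have "fourier (\<lambda>x. \<phi> x * f \<epsilon> x) \<xi> = (LINT x|lborel. \<phi> x * g \<epsilon> x * osc \<xi> x + \<phi> x * ?d \<epsilon> x * osc \<xi> x)"
          unfolding fourier_osc by (intro arg_cong[where f = "integral\<^sup>L lborel"] ext) (simp add: algebra_simps)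
        also have "\<dots> = fourier (\<lambda>x. \<phi> x * g \<epsilon> x) \<xi> + fourier (\<lambda>x. \<phi> x * ?d \<epsilon> x) \<xi>"
          unfolding fourier_osc by (rule Bochner_Integration.integral_add[OF int[OF s(2)] int[OF sd]])
        finally have "norm (fourier (\<lambda>x. \<phi> x * f \<epsilon> x) \<xi>) \<le> norm (fourier (\<lambda>x. \<phi> x * g \<epsilon> x) \<xi>) + norm (fourier (\<lambda>x. \<phi> x * ?d \<epsilon> x) \<xi>)"
          by (simp add: norm_triangle_ineq)
        also have "\<dots> \<le> C * \<epsilon> powr (- N) / (1 + norm \<xi>) ^ l + D * \<epsilon> powr (- N) / (1 + norm \<xi>) ^ l"
          using elim(1) \<xi> db[of \<xi>] pos by (intro add_mono) (auto simp: pos_le_divide_eq)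
        also have "\<dots> = (C + D) * \<epsilon> powr (- N) / (1 + norm \<xi>) ^ l"
          by (simp add: add_divide_distrib[symmetric] distrib_right)
        finally show "norm (fourier (\<lambda>x. \<phi> x * f \<epsilon> x) \<xi>) \<le> (C + D) * \<epsilon> powr (- N) / (1 + norm \<xi>) ^ l" .
      qed
    qed
    moreover have "C + D > 0" using C(1) D by simp
    ultimately show "\<exists>C>0. \<forall>\<^sub>F \<epsilon> in at_right 0. \<forall>\<xi>\<in>\<Gamma>.
          norm (fourier (\<lambda>x. \<phi> x * f \<epsilon> x) \<xi>) \<le> C * \<epsilon> powr (- N) / (1 + norm \<xi>) ^ l" by blast
  qed
qed

lemma colombeau_rep_moderate: "u \<in> colombeau \<Omega> \<Longrightarrow> v \<in> u \<Longrightarrow> v \<in> moderate_nets \<Omega>"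
  by (auto simp: colombeau_def quotient_def colombeau_rel_def)

lemma colombeau_rep_diff_null:
  assumes \<Omega>: "open \<Omega>" and u: "u \<in> colombeau \<Omega>" and v: "v \<in> u" "w \<in> u"
  shows "(\<lambda>\<epsilon> x. v \<epsilon> x - w \<epsilon> x) \<in> null_nets \<Omega>"
proof -
  obtain x where "u = colombeau_rel \<Omega> `` {x}" using u by (auto simp: colombeau_def quotient_def)
  hence "(\<lambda>\<epsilon> y. x \<epsilon> y - w \<epsilon> y) \<in> null_nets \<Omega>" "(\<lambda>\<epsilon> y. x \<epsilon> y - v \<epsilon> y) \<in> null_nets \<Omega>"
    using v by (auto simp: colombeau_rel_def)
  from null_nets_diff[OF \<Omega> this] show ?thesis by simp
qed

lemma microlocally_regular_rep_iff:
  "microlocally_regular_rep \<Omega> v x \<xi> \<longleftrightarrow>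
     (\<exists>U \<Gamma>. open U \<and> x \<in> U \<and> U \<subseteq> \<Omega> \<and> conic_neighborhood \<xi> \<Gamma> \<and> regular_in v U \<Gamma>)"
  unfolding microlocally_regular_rep_def regular_in_def ..

theorem corollary4p1:
  fixes \<Omega> :: "(real ^ 'n) set"
    and m :: nat
    and a :: "('n \<Rightarrow> nat) \<Rightarrow> 'n net set"
    and u :: "'n net set"
  assumes "open \<Omega>"
    and "\<And>\<alpha>. mi_order \<alpha> \<le> m \<Longrightarrow> a \<alpha> \<in> colombeau \<Omega>"
    and "wh_elliptic_slow \<Omega> m a"
    and "u \<in> colombeau \<Omega>"
  shows "WF_g \<Omega> u = WF_g \<Omega> (gen_diff_op \<Omega> m a u)"
proof -
  note \<Omega> = assms(1)
  obtain A where A: "A \<in> coeff_reps m a" and ell: "wh_elliptic_rep \<Omega> m A"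
    using assms(3) unfolding wh_elliptic_slow_def by blast
  have rep: "B \<alpha> \<in> moderate_nets \<Omega>" if "B \<in> coeff_reps m a" "mi_order \<alpha> \<le> m" for B \<alpha>
    using colombeau_rep_moderate[OF assms(2)[OF that(2)]] that by (auto simp: coeff_reps_def)
  define P where "P = (\<lambda>(B :: ('n \<Rightarrow> nat) \<Rightarrow> 'n net) (v :: 'n net) \<epsilon>. diff_op m (\<lambda>\<alpha>. B \<alpha> \<epsilon>) (v \<epsilon>))"
  have vm: "v \<in> moderate_nets \<Omega>" if "v \<in> u" for v by (rule colombeau_rep_moderate[OF assms(4) that])
  have Pm: "P B v \<in> moderate_nets \<Omega>" if "B \<in> coeff_reps m a" "v \<in> u" for B v
    unfolding P_def by (rule diff_op_moderate[OF \<Omega> rep[OF that(1)] vm[OF that(2)]])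
  have "microlocally_regular \<Omega> u x \<xi> \<longleftrightarrow> microlocally_regular \<Omega> (gen_diff_op \<Omega> m a u) x \<xi>" for x \<xi>
  proof
    assume "microlocally_regular \<Omega> u x \<xi>"
    then obtain v U \<Gamma> where v: "v \<in> u" and U: "open U" "x \<in> U" "U \<subseteq> \<Omega>" and \<Gamma>: "conic_neighborhood \<xi> \<Gamma>"
      and reg: "regular_in v U \<Gamma>"
      unfolding microlocally_regular_def microlocally_regular_rep_iff by blast
    obtain \<Gamma>' c where \<Gamma>': "conic_neighborhood \<xi> \<Gamma>'" and c: "0 < c" "c \<le> 1/2"
      and cone: "\<And>\<xi> \<eta>. \<xi> \<in> \<Gamma>' \<Longrightarrow> norm \<eta> \<le> c * norm \<xi> \<Longrightarrow> \<xi> - \<eta> \<in> \<Gamma>"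
      using conic_neighborhood_shrink[OF \<Gamma>] by blast
    have "regular_in (P A v) U \<Gamma>'"
      unfolding P_def
      by (rule regular_in_diff_op[OF \<Omega> rep[OF A] vm[OF v] Pm[OF A v, unfolded P_def] ell U(1,3) reg c cone])
    hence "microlocally_regular_rep \<Omega> (P A v) x \<xi>"
      unfolding microlocally_regular_rep_iff using U \<Gamma>' by blast
    moreover have "(P A v, P A v) \<in> colombeau_rel \<Omega>"
      using Pm[OF A v] null_nets_zero[OF \<Omega>] by (simp add: colombeau_rel_def)
    hence "P A v \<in> gen_diff_op \<Omega> m a u"
      unfolding gen_diff_op_def using A v unfolding P_def by blast
    ultimately show "microlocally_regular \<Omega> (gen_diff_op \<Omega> m a u) x \<xi>"
      unfolding microlocally_regular_def by blast
  next
    assume "microlocally_regular \<Omega> (gen_diff_op \<Omega> m a u) x \<xi>"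
    then obtain g U \<Gamma> where g: "g \<in> gen_diff_op \<Omega> m a u" and U: "open U" "x \<in> U" "U \<subseteq> \<Omega>"
      and \<Gamma>: "conic_neighborhood \<xi> \<Gamma>" and reg: "regular_in g U \<Gamma>"
      unfolding microlocally_regular_def microlocally_regular_rep_iff by blast
    obtain B v where B: "B \<in> coeff_reps m a" and v: "v \<in> u" and "(P B v, g) \<in> colombeau_rel \<Omega>"
      using g unfolding gen_diff_op_def P_def by blast
    hence gm: "g \<in> moderate_nets \<Omega>" and n1: "(\<lambda>\<epsilon> x. P B v \<epsilon> x - g \<epsilon> x) \<in> null_nets \<Omega>"
      by (auto simp: colombeau_rel_def)
    have "(\<lambda>\<epsilon> x. A \<alpha> \<epsilon> x - B \<alpha> \<epsilon> x) \<in> null_nets \<Omega>" if "mi_order \<alpha> \<le> m" for \<alpha>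
      using colombeau_rep_diff_null[OF \<Omega> assms(2)[OF that]] A B that by (auto simp: coeff_reps_def)
    hence "(\<lambda>\<epsilon> x. P A v \<epsilon> x - P B v \<epsilon> x) \<in> null_nets \<Omega>"
      unfolding P_def by (rule diff_op_null[OF \<Omega> _ vm[OF v]])
    from null_nets_add[OF \<Omega> this n1]
    have n2: "(\<lambda>\<epsilon> x. P A v \<epsilon> x - g \<epsilon> x) \<in> null_nets \<Omega>" by simp
    have regP: "regular_in (P A v) U \<Gamma>"
      by (rule regular_in_null[OF \<Omega> Pm[OF A v] gm n2 U(1,3) reg])
    obtain \<Gamma>' c where \<Gamma>': "conic_neighborhood \<xi> \<Gamma>'" and c: "0 < c" "c \<le> 1/2"
      and cone: "\<And>\<xi> \<eta>. \<xi> \<in> \<Gamma>' \<Longrightarrow> norm \<eta> \<le> c * norm \<xi> \<Longrightarrow> \<xi> - \<eta> \<in> \<Gamma>"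
      using conic_neighborhood_shrink[OF \<Gamma>] by blast
    have "regular_in v U \<Gamma>'"
      by (rule regular_in_of_diff_op[OF \<Omega> rep[OF A] vm[OF v] Pm[OF A v, unfolded P_def] ell U(1,3)
            regP[unfolded P_def] c cone])
    hence "microlocally_regular_rep \<Omega> v x \<xi>"
      unfolding microlocally_regular_rep_iff using U \<Gamma>' by blast
    thus "microlocally_regular \<Omega> u x \<xi>" unfolding microlocally_regular_def using v by blast
  qed
  thus ?thesis unfolding WF_g_def by simp
qed

end
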